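(* Let $X$ be a separable infinite-dimensional Fréchet algebra over $\mathbb{K}\in\{\mathbb{R},\mathbb{C}\}$ and let $\mathcal{A}\subset X$ be a dense countable-dimensional subalgebra. Then there exists a continuous linear operator $T:X\to X$ such that $$T(\mathcal{A})\subset\mathcal{A}\qquad\text{and}\qquad \mathcal{A}\setminus\{0\}\subset HC(T).$$
   Context: All vector spaces are over $\mathbb{K}\in\{\mathbb{R},\mathbb{C}\}$ and Hausdorff; all dimensions are algebraic (Hamel) dimensions. A Fréchet space is a locally convex, complete metrizable topological vector space (equivalently, its topology is defined by a separating increasing sequence of seminorms for which it is complete). A Fréchet algebra is a Fréchet space equipped with a bilinear associative multiplication $X\times X\to X$ that is continuous for the product topology; it need not be commutative or unital. A subalgebra is a linear subspace closed under multiplication; it is not required to contain a unit. For a continuous linear operator $T:X\to X$ and $x\in X$, the orbit is $\mathrm{Orb}(x,T)=\{T^n x: n\ge 0\}$; $x$ is a hypercyclic vector for $T$ if $\mathrm{Orb}(x,T)$ is dense in $X$, and $HC(T)$ is the set of all hypercyclic vectors for $T$. *)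

theory Defs
  imports "HOL-Analysis.Analysis"
begin

definition seminorm :: "('k::real_normed_field \<Rightarrow> 'a::ab_group_add \<Rightarrow> 'a) \<Rightarrow> ('a \<Rightarrow> real) \<Rightarrow> bool"
  where "seminorm scl p \<longleftrightarrow>
    (\<forall>x. 0 \<le> p x) \<and>
    (\<forall>x y. p (x + y) \<le> p x + p y) \<and>
    (\<forall>c x. p (scl c x) = norm c * p x)"

text \<open>
  The topology is the one of the type class \<^class>\<open>topological_space\<close>; the scalar
  multiplication is a parameter, so that one development serves both real and complex scalars.
  Since the seminorms increase, the sets \<open>{y. p n (y - x) < e}\<close> form a neighbourhood base at
  \<open>x\<close>, and no finite intersections are needed.
\<close>

locale frechet_space = vector_space scl
  for scl :: "'k::real_normed_field \<Rightarrow> 'a::{ab_group_add, topological_space} \<Rightarrow> 'a" +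
  assumes frechet_seminorms: "\<exists>p :: nat \<Rightarrow> 'a \<Rightarrow> real.
    (\<forall>n. seminorm scl (p n)) \<and>
    (\<forall>n x. p n x \<le> p (Suc n) x) \<and>
    (\<forall>x. (\<forall>n. p n x = 0) \<longrightarrow> x = 0) \<and>
    (\<forall>U. open U \<longleftrightarrow> (\<forall>x\<in>U. \<exists>n. \<exists>e>0. {y. p n (y - x) < e} \<subseteq> U)) \<and>
    (\<forall>X :: nat \<Rightarrow> 'a.
      (\<forall>n. \<forall>e>0. \<exists>N. \<forall>i\<ge>N. \<forall>j\<ge>N. p n (X i - X j) < e) \<longrightarrow> (\<exists>L. X \<longlonglongrightarrow> L))"

text \<open>Associativity and distributivity come from \<^class>\<open>ring\<close>, which has no unit.\<close>

locale frechet_algebra = frechet_space scl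
  for scl :: "'k::real_normed_field \<Rightarrow> 'a::{ring, topological_space} \<Rightarrow> 'a" +
  assumes mult_scale_left: "scl c x * y = scl c (x * y)"
    and mult_scale_right: "x * scl c y = scl c (x * y)"
    and continuous_mult: "continuous_on UNIV (\<lambda>(x, y). x * y :: 'a)"

definition hamel_basis :: "('k::field \<Rightarrow> 'a::ab_group_add \<Rightarrow> 'a) \<Rightarrow> 'a set \<Rightarrow> 'a set \<Rightarrow> bool"
  where "hamel_basis scl B V \<longleftrightarrow> \<not> module.dependent scl B \<and> module.span scl B = V"

definition infinite_dimensional :: "('k::field \<Rightarrow> 'a::ab_group_add \<Rightarrow> 'a) \<Rightarrow> 'a set \<Rightarrow> bool"
  where "infinite_dimensional scl V \<longleftrightarrow> (\<exists>B. infinite B \<and> hamel_basis scl B V)"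

text \<open>Finite dimension is allowed here.\<close>

definition countable_dimensional :: "('k::field \<Rightarrow> 'a::ab_group_add \<Rightarrow> 'a) \<Rightarrow> 'a set \<Rightarrow> bool"
  where "countable_dimensional scl V \<longleftrightarrow> (\<exists>B. countable B \<and> hamel_basis scl B V)"

definition linear_subalgebra :: "('k::field \<Rightarrow> 'a::ring \<Rightarrow> 'a) \<Rightarrow> 'a set \<Rightarrow> bool"
  where "linear_subalgebra scl A \<longleftrightarrow> module.subspace scl A \<and> (\<forall>x\<in>A. \<forall>y\<in>A. x * y \<in> A)"

definition operator_orbit :: "('a \<Rightarrow> 'a) \<Rightarrow> 'a \<Rightarrow> 'a set"
  where "operator_orbit T x = {(T ^^ n) x | n. True}"

definition hypercyclic_vectors :: "('a::topological_space \<Rightarrow> 'a) \<Rightarrow> 'a set"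
  where "hypercyclic_vectors T = {x. closure (operator_orbit T x) = UNIV}"

end

theory Submission
  imports Defs "HOL-Computational_Algebra.Fundamental_Theorem_Algebra"
begin

text \<open>
  The multiplication plays no role: only a dense subspace \<open>E\<close> of countable dimension matters.
  Gram--Schmidt with Hahn--Banach gives a Hamel basis \<open>e\<^sub>k\<close> of \<open>E\<close> with biorthogonal continuous
  functionals \<open>f\<^sub>k\<close> and levels such that \<open>f\<^sub>k\<close> is bounded by the seminorm of index \<open>lev k\<close>,
  while all seminorms of smaller index vanish at \<open>e\<^sub>k\<close>. An operator given by its columns is
  continuous as soon as the columns are small and respect the levels.

  If \<open>u\<close> is hypercyclic then so is \<open>P(T)u\<close> for every nonzero polynomial \<open>P\<close>: otherwise a
  functional annihilates the range of \<open>P(T)\<close>, and factoring \<open>P\<close> over the complex numbers turns it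
  into an eigenfunctional of \<open>T\<close>, which cannot map an orbit to a dense set. So it suffices to
  build \<open>T\<close> with a hypercyclic \<open>u \<in> E\<close> such that every \<open>x \<in> E\<close> satisfies \<open>T\<^sup>j x = P(T)u\<close>.

  If the levels are bounded (there is a continuous norm on \<open>E\<close>), take \<open>T = I + N\<close> with \<open>N\<close> small.
  In stage \<open>s\<close>, \<open>N\<close> is a backward shift along a chain spanning \<open>E\<close>; some power of \<open>I + N\<close> maps
  \<open>u + v\<close>, with \<open>v\<close> small and far out in the chain, close to a prescribed vector, and \<open>N\<close> is
  conjugated by the map that takes \<open>u\<close> to \<open>u + v\<close>.

  If the levels are unbounded, split the basis into \<open>a\<^sub>k\<close> and \<open>b\<^sub>j\<close>, where the levels of \<open>b\<^sub>j\<close> tend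
  to infinity, and take \<open>T b\<^sub>j\<^sub>+\<^sub>1 = b\<^sub>j\<close>, \<open>T b\<^sub>0 = a\<^sub>0 = u\<close>, \<open>T a\<^sub>k = \<eta>\<^sub>k a\<^sub>k\<^sub>+\<^sub>1 + \<rho>\<^sub>k\<close> with \<open>\<eta>\<^sub>k\<close>
  small and \<open>\<rho>\<^sub>k\<close> in the span of far out \<open>b\<^sub>j\<close>. Such \<open>\<rho>\<^sub>k\<close> are invisible to the first seminorms
  until they have been shifted down, and they can be chosen to steer the orbit of \<open>u\<close>.
\<close>

text \<open>Smallness of the columns alone does not give continuity: \<open>f k\<close> is
  controlled only by \<open>p (lev k)\<close>, so among the columns visible to a given
  \<open>p n\<close> the levels must be bounded. With bounded levels this is automatic and early
  columns may be perturbed at will. With unbounded levels the conjugations of the first construction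
  can make vectors of high level visible to low seminorms in one stage after another. In the second
  construction each column is therefore set only once, to a multiple of one further basis vector
  plus a remainder invisible below the level of the column.

  A real polynomial need not split, so eigenvalues are sought among functionals with complex values,
  on which complex coefficients act even when the space is real.

  The relation \<open>T^j x = P(T) u\<close> helps only if \<open>P\<close> is nonzero. In the first
  construction \<open>j = 0\<close> and this follows from \<open>x\<close> being nonzero; in the
  second it follows from injectivity of \<open>T\<close> on the subspace, for which the coefficients
  \<open>\<eta>\<^sub>k\<close> must be nonzero.\<close>

section \<open>Splitting an unbounded level function\<close>

text \<open>The Cantor enumeration walks along antidiagonals with the second coordinate falling by
  one per step, and jumps only when that coordinate is 0. If the second coordinate records the class
  of a vector, the class falls by at most one from a vector to its successor.\<close>

lemma snd_prod_decode_le_Suc: "snd (prod_decode k) \<le> Suc (snd (prod_decode (Suc k)))"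
proof (cases "prod_decode k")
  case (Pair m n)
  then have k: "k = prod_encode (m, n)"
    by (metis prod_decode_inverse)
  show ?thesis
  proof (cases n)
    case 0
    then show ?thesis by (simp add: Pair)
  next
    case (Suc n')
    have "prod_encode (Suc m, n') = Suc k"
      by (simp add: k Suc prod_encode_def)
    then have "prod_decode (Suc k) = (Suc m, n')"
      by (metis prod_encode_inverse)
    then show ?thesis by (simp add: Pair Suc)
  qed
qed

text \<open>The last two conclusions are what continuity asks of the columns
  \<open>b (Suc j) -> b j\<close> and \<open>a k -> a (Suc k)\<close>: a seminorm sees only finitely
  many \<open>b j\<close>, and wherever it sees \<open>a (Suc k)\<close> the level of
  \<open>a k\<close> is bounded. The cases differ in how many levels are attained infinitely
  often.\<close>

lemma split_by_levels:
  fixes lev :: "nat \<Rightarrow> nat"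
  assumes unb: "\<And>L. \<exists>k. L < lev k"
  obtains \<alpha> \<beta> :: "nat \<Rightarrow> nat" where
    "inj \<alpha>" "inj \<beta>" "range \<alpha> \<inter> range \<beta> = {}" "range \<alpha> \<union> range \<beta> = UNIV"
    "\<And>L. finite {j. lev (\<beta> j) \<le> L}"
    "\<And>L. \<exists>M. \<forall>k. lev (\<alpha> (Suc k)) \<le> L \<longrightarrow> lev (\<alpha> k) \<le> M"
proof -
  define S where "S = {n. infinite {k. lev k = n}}"
  show thesis
  proof (cases "infinite S")
    case True
    define \<sigma> where "\<sigma> = enumerate S"
    have \<sigma>S: "\<sigma> i \<in> S" for i
      using True by (simp add: \<sigma>_def enumerate_in_set)
    have \<sigma>mono: "strict_mono \<sigma>"
      using True by (simp add: \<sigma>_def strict_mono_enumerate)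
    have le_\<sigma>: "i \<le> \<sigma> i" for i
      using \<sigma>mono by (rule strict_mono_imp_increasing)
    \<comment> \<open>The levels in \<open>S\<close> cut the indices into classes. Class
      \<open>i\<close> contains the whole fibre of the level \<open>\<sigma> i\<close>, hence is
      infinite.\<close>
    define cl where "cl k = (LEAST i. lev k \<le> \<sigma> i)" for k
    have cl: "lev k \<le> \<sigma> (cl k)" for k
      unfolding cl_def by (rule LeastI[of _ "lev k"]) (rule le_\<sigma>)
    have cl_le: "cl k \<le> i" if "lev k \<le> \<sigma> i" for k i
      unfolding cl_def by (rule Least_le) (rule that)
    have cl_le': "cl k \<le> L" if "lev k \<le> L" for k L
      using cl_le[of k L] le_\<sigma>[of L] that by linarith
    define K where "K i = {k. cl k = i}" for i
    have "cl k = i" if "lev k = \<sigma> i" for k i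
    proof (rule antisym)
      show "cl k \<le> i" using that by (intro cl_le) simp
      have "\<sigma> i \<le> \<sigma> (cl k)" using cl[of k] that by simp
      then show "i \<le> cl k" using \<sigma>mono by (simp add: strict_mono_less_eq)
    qed
    then have "{k. lev k = \<sigma> i} \<subseteq> K i" for i
      by (auto simp: K_def)
    then have infK: "infinite (K i)" for i
      using \<sigma>S[of i] infinite_super by (fastforce simp: S_def)
    define en where "en i = enumerate (K i)" for i
    have bij_en: "bij_betw (en i) UNIV (K i)" for i
      unfolding en_def using infK by (rule bij_enumerate)
    have cl_en: "cl (en i j) = i" for i j
      using bij_en[of i] by (auto simp: K_def bij_betw_def)
    have en_inj: "en i j = en i' j' \<longleftrightarrow> i = i' \<and> j = j'" for i i' j j'
      using bij_en[of i] cl_en by (metis bij_betw_def injD)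
    have en_surj: "\<exists>j. k = en (cl k) j" for k
      using bij_en[of "cl k"] by (auto simp: K_def bij_betw_def)
    \<comment> \<open>Each class gives its first member to \<open>\<beta>\<close>, whose levels then
      tend to infinity, and the others to \<open>\<alpha>\<close>, in the order of the Cantor walk
      over pairs of position and class.\<close>
    define \<alpha> where "\<alpha> k = en (snd (prod_decode k)) (Suc (fst (prod_decode k)))" for k
    define \<beta> where "\<beta> j = en j 0" for j
    show thesis
    proof (rule that[of \<alpha> \<beta>])
      show "inj \<alpha>"
      proof (rule injI)
        fix x y assume "\<alpha> x = \<alpha> y"
        then have "prod_decode x = prod_decode y"
          by (auto simp: \<alpha>_def en_inj prod_eq_iff)
        then show "x = y" by (metis prod_decode_inverse)
      qed
      show "inj \<beta>" by (auto simp: inj_def \<beta>_def en_inj)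
      show "range \<alpha> \<inter> range \<beta> = {}" by (auto simp: \<alpha>_def \<beta>_def en_inj)
      have "k \<in> range \<alpha> \<union> range \<beta>" for k
      proof -
        obtain j where j: "k = en (cl k) j" using en_surj by blast
        show ?thesis
        proof (cases j)
          case 0
          then show ?thesis using j by (auto simp: \<beta>_def)
        next
          case (Suc j')
          then have "k = \<alpha> (prod_encode (j', cl k))" using j by (simp add: \<alpha>_def)
          then show ?thesis by blast
        qed
      qed
      then show "range \<alpha> \<union> range \<beta> = UNIV" by blast
      show "finite {j. lev (\<beta> j) \<le> L}" for L
      proof (rule finite_subset)
        show "{j. lev (\<beta> j) \<le> L} \<subseteq> {..L}"
          using cl_le' by (auto simp: \<beta>_def cl_en) (metis cl_en)
      qed simp
      show "\<exists>M. \<forall>k. lev (\<alpha> (Suc k)) \<le> L \<longrightarrow> lev (\<alpha> k) \<le> M" for L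
      proof (intro exI allI impI)
        fix k assume "lev (\<alpha> (Suc k)) \<le> L"
        then have "snd (prod_decode (Suc k)) \<le> L"
          using cl_le' by (metis \<alpha>_def cl_en)
        then have "snd (prod_decode k) \<le> Suc L"
          using snd_prod_decode_le_Suc[of k] by linarith
        then have "\<sigma> (snd (prod_decode k)) \<le> \<sigma> (Suc L)"
          using \<sigma>mono by (simp add: strict_mono_less_eq)
        moreover have "lev (\<alpha> k) \<le> \<sigma> (snd (prod_decode k))"
          using cl[of "\<alpha> k"] by (simp add: \<alpha>_def cl_en)
        ultimately show "lev (\<alpha> k) \<le> \<sigma> (Suc L)" by simp
      qed
    qed
  next
    case False
    \<comment> \<open>Only finitely many levels have infinite fibres, so above the bound
      \<open>Q\<close> every fibre is finite.\<close>
    define Q where "Q = Max (insert 0 S)"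
    have Q: "n \<le> Q" if "n \<in> S" for n
      using False that by (simp add: Q_def)
    define A where "A = {k. lev k \<le> Q}"
    have fin: "finite {k. Q < lev k \<and> lev k \<le> L}" for L
    proof (rule finite_subset)
      show "{k. Q < lev k \<and> lev k \<le> L} \<subseteq> (\<Union>n\<in>{Q<..L}. {k. lev k = n})" by auto
      show "finite (\<Union>n\<in>{Q<..L}. {k. lev k = n})"
        using Q by (force simp: S_def)
    qed
    show thesis
    proof (cases "finite A")
      case True
      have finL: "finite {k. lev k \<le> L}" for L
        by (rule finite_subset[OF _ finite_UnI[OF True fin[of L]]]) (auto simp: A_def)
      have finL': "finite {k. lev (h k) \<le> L}" if "inj h" for L and h :: "nat \<Rightarrow> nat"
        using finite_vimageI[OF finL[of L] that] by (simp add: vimage_def)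
      show thesis
      proof (rule that[of "\<lambda>k. 2 * k" "\<lambda>k. Suc (2 * k)"])
        \<comment> \<open>All sets \<open>{k. lev k \<le> L}\<close> are finite here, so any
          partition into two infinite sets would do; even and odd numbers are one.\<close>
        show "inj (\<lambda>k::nat. 2 * k)" "inj (\<lambda>k::nat. Suc (2 * k))" by (auto simp: inj_def)
        show "range (\<lambda>k::nat. 2 * k) \<inter> range (\<lambda>k::nat. Suc (2 * k)) = {}"
          by auto presburger
        show "range (\<lambda>k::nat. 2 * k) \<union> range (\<lambda>k::nat. Suc (2 * k)) = UNIV"
          by (auto simp: image_def) presburger
        show "finite {j. lev (Suc (2 * j)) \<le> L}" for L
          by (rule finL') (auto simp: inj_def)
        show "\<exists>M. \<forall>k. lev (2 * Suc k) \<le> L \<longrightarrow> lev (2 * k) \<le> M" for L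
        proof -
          have "finite {k. lev (2 * Suc k) \<le> L}"
            by (rule finL') (auto simp: inj_def)
          then have "finite ((\<lambda>k. lev (2 * k)) ` {k. lev (2 * Suc k) \<le> L})" by simp
          then show ?thesis using finite_nat_set_iff_bounded_le by auto
        qed
      qed
    next
      case infA: False
      have infB: "infinite (- A)"
      proof
        assume "finite (- A)"
        then obtain M where "\<And>k. k \<in> - A \<Longrightarrow> lev k \<le> M"
          by (metis finite_imageI finite_nat_set_iff_bounded_le image_eqI)
        then have "lev k \<le> max Q M" for k
          by (cases "k \<in> A") (auto simp: A_def le_max_iff_disj)
        then show False using unb[of "max Q M"] by (meson not_less)
      qed
      have bA: "bij_betw (enumerate A) UNIV A" using infA by (rule bij_enumerate)
      have bB: "bij_betw (enumerate (- A)) UNIV (- A)" using infB by (rule bij_enumerate)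
      show thesis
      proof (rule that[of "enumerate A" "enumerate (- A)"])
        show "inj (enumerate A)" "inj (enumerate (- A))"
          using bA bB by (auto simp: bij_betw_def)
        show "range (enumerate A) \<inter> range (enumerate (- A)) = {}"
          "range (enumerate A) \<union> range (enumerate (- A)) = UNIV"
          using bA bB by (auto simp: bij_betw_def)
        show "finite {j. lev (enumerate (- A) j) \<le> L}" for L
        proof (rule finite_subset)
          have "Q < lev (enumerate (- A) j)" for j
            using enumerate_in_set[OF infB, of j] by (simp add: A_def)
          then show "{j. lev (enumerate (- A) j) \<le> L} \<subseteq> enumerate (- A) -` {k. Q < lev k \<and> lev k \<le> L}"
            by auto
          show "finite (enumerate (- A) -` {k. Q < lev k \<and> lev k \<le> L})"
            using bB by (intro finite_vimageI fin) (auto simp: bij_betw_def)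
        qed
        have "lev (enumerate A k) \<le> Q" for k
          using bA by (auto simp: A_def bij_betw_def)
        then show "\<exists>M. \<forall>k. lev (enumerate A (Suc k)) \<le> L \<longrightarrow> lev (enumerate A k) \<le> M" for L
          by blast
      qed
    qed
  qed
qed

section \<open>Steering in a Jordan chain\<close>

text \<open>Newton's forward difference series: \<open>c i\<close> is the \<open>i\<close>-th
  difference at 0 of the sequence \<open>newton_value c\<close>.\<close>

definition newton_value :: "(nat \<Rightarrow> 'k::comm_ring_1) \<Rightarrow> nat \<Rightarrow> 'k"
  where "newton_value c l = (\<Sum>i\<le>l. c i * of_nat (l choose i))"

text \<open>The action of \<open>I + N\<close> on coordinates in a chain where \<open>N\<close> maps
  each vector to its predecessor and the first one to 0.\<close>

definition add_shift :: "(nat \<Rightarrow> 'k::comm_ring_1) \<Rightarrow> nat \<Rightarrow> 'k"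
  where "add_shift c i = c i + c (Suc i)"

lemma newton_value_add: "newton_value (\<lambda>i. b i + c i) l = newton_value b l + newton_value c l"
  by (simp add: newton_value_def algebra_simps sum.distrib)

text \<open>Pascal's rule. The shift leaves one summand beyond \<open>l\<close>, which vanishes
  because \<open>l choose Suc l\<close> is 0.\<close>

lemma newton_value_add_shift: "newton_value (add_shift c) l = newton_value c (Suc l)"
proof -
  have "newton_value c (Suc l) = c 0 + (\<Sum>i\<le>l. c (Suc i) * of_nat (Suc l choose Suc i))"
    unfolding newton_value_def by (subst sum.atMost_Suc_shift) simp
  also have "\<dots> = (\<Sum>i\<le>l. c (Suc i) * of_nat (l choose i))
      + (c 0 + (\<Sum>i\<le>l. c (Suc i) * of_nat (l choose Suc i)))"
    by (simp add: algebra_simps sum.distrib)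
  also have "c 0 + (\<Sum>i\<le>l. c (Suc i) * of_nat (l choose Suc i)) = (\<Sum>i\<le>Suc l. c i * of_nat (l choose i))"
    using sum.atMost_Suc_shift[of "\<lambda>i. c i * of_nat (l choose i)" l] by (simp del: sum.atMost_Suc)
  also have "\<dots> = (\<Sum>i\<le>l. c i * of_nat (l choose i))"
    by (simp add: binomial_eq_0)
  finally show ?thesis
    by (simp add: newton_value_def add_shift_def algebra_simps sum.distrib)
qed

lemma newton_value_add_shift_funpow:
  "newton_value ((add_shift ^^ m) c) l = newton_value c (l + m)"
  by (induction m arbitrary: l) (simp_all add: newton_value_add_shift)

text \<open>The matrix of binomial coefficients is unitriangular, so the coefficients can be
  recovered from the values one after the other. Vanishing and convergence thereby pass from values
  to coefficients.\<close>

lemma newton_value_triangular: "c i = newton_value c i - (\<Sum>j<i. c j * of_nat (i choose j))"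
  by (simp add: newton_value_def lessThan_Suc_atMost[symmetric])

lemma newton_value_eq_0D:
  assumes "\<And>l. l < J \<Longrightarrow> newton_value c l = 0" and "i < J"
  shows "c i = 0"
  using assms(2)
proof (induction i rule: less_induct)
  case (less i)
  then have "(\<Sum>j<i. c j * of_nat (i choose j)) = 0"
    by (intro sum.neutral) auto
  then show ?case
    using newton_value_triangular[of c i] assms(1)[OF less.prems] by simp
qed

lemma newton_value_tendstoD:
  fixes c :: "nat \<Rightarrow> nat \<Rightarrow> 'k::real_normed_field"
  assumes "\<And>l. (\<lambda>m. newton_value (c m) l) \<longlonglongrightarrow> newton_value z l"
  shows "(\<lambda>m. c m i) \<longlonglongrightarrow> z i"
proof (induction i rule: less_induct)
  case (less i)
  then have "(\<lambda>m. newton_value (c m) i - (\<Sum>j<i. c m j * of_nat (i choose j)))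
      \<longlonglongrightarrow> newton_value z i - (\<Sum>j<i. z j * of_nat (i choose j))"
    by (intro tendsto_intros assms) auto
  then show ?case
    by (simp only: newton_value_triangular[symmetric])
qed

section \<open>Polynomials as Newton series\<close>

definition binomial_poly :: "nat \<Rightarrow> 'k::field_char_0 poly"
  where "binomial_poly i = smult (1 / fact i) (\<Prod>j<i. [:- of_nat j, 1:])"

lemma poly_binomial_poly: "poly (binomial_poly i) (of_nat t) = of_nat (t choose i)"
  by (simp add: binomial_poly_def poly_prod binomial_gbinomial gbinomial_prod_rev atLeast0LessThan)

lemma degree_binomial_poly: "degree (binomial_poly i :: 'k::field_char_0 poly) = i"
proof -
  have "degree (\<Prod>j<i. [:- of_nat j, 1:] :: 'k poly) = i"
    by (subst degree_prod_eq_sum_degree) auto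
  then show ?thesis by (simp add: binomial_poly_def)
qed

text \<open>Induction on the degree bound: a multiple of \<open>binomial_poly (Suc R)\<close>
  removes the leading term.\<close>

lemma ex_newton_value:
  fixes P :: "'k::field_char_0 poly"
  assumes "degree P \<le> R"
  shows "\<exists>c. (\<forall>i>R. c i = 0) \<and> (\<forall>t. poly P (of_nat t) = newton_value c t)"
  using assms
proof (induction R arbitrary: P)
  case 0
  then obtain a where a: "P = [:a:]" by (metis le_zero_eq degree_eq_zeroE)
  show ?case
    by (rule exI[of _ "\<lambda>i. if i = 0 then a else 0"])
      (simp add: a newton_value_def if_distrib if_distribR sum.delta cong: if_cong)
next
  case (Suc R)
  define b :: "'k poly" where "b = binomial_poly (Suc R)"
  define a where "a = coeff P (Suc R) / coeff b (Suc R)"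
  have b0: "coeff b (Suc R) \<noteq> 0"
    using degree_binomial_poly[of "Suc R", where 'k='k]
    by (metis b_def coeff_eq_0 degree_0 leading_coeff_0_iff nat.distinct(1))
  have "degree (P - smult a b) \<le> R"
  proof (rule degree_le, intro allI impI)
    fix i assume i: "R < i"
    show "coeff (P - smult a b) i = 0"
    proof (cases "i = Suc R")
      case True
      then show ?thesis using b0 by (simp add: a_def)
    next
      case False
      then show ?thesis using i Suc.prems degree_binomial_poly[of "Suc R", where 'k='k]
        by (simp add: b_def coeff_eq_0)
    qed
  qed
  from Suc.IH[OF this] obtain c where c: "\<forall>i>R. c i = 0"
    "\<And>t. poly (P - smult a b) (of_nat t) = newton_value c t" by blast
  have "poly P (of_nat t) = newton_value (\<lambda>i. c i + (if i = Suc R then a else 0)) t" for t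
  proof -
    have "newton_value (\<lambda>i. if i = Suc R then a else 0) t = a * of_nat (t choose Suc R)"
      by (simp add: newton_value_def if_distrib if_distribR sum.delta cong: if_cong)
    then show ?thesis
      using c(2)[of t] by (simp add: newton_value_add b_def poly_binomial_poly algebra_simps)
  qed
  then show ?case
    using c(1) by (intro exI[of _ "\<lambda>i. c i + (if i = Suc R then a else 0)"]) auto
qed

lemma poly_growth:
  fixes P :: "'k::real_normed_field poly"
  assumes "degree P \<le> d"
  shows "\<exists>B\<ge>0. \<forall>x. norm (poly P x) \<le> B * (1 + norm x) ^ d"
proof (intro exI[of _ "\<Sum>i\<le>degree P. norm (coeff P i)"] conjI allI)
  fix x
  have "norm (poly P x) \<le> (\<Sum>i\<le>degree P. norm (coeff P i) * norm x ^ i)"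
    unfolding poly_altdef by (intro sum_norm_le) (simp add: norm_mult norm_power)
  also have "\<dots> \<le> (\<Sum>i\<le>degree P. norm (coeff P i) * (1 + norm x) ^ d)"
  proof (intro sum_mono mult_left_mono)
    fix i assume "i \<in> {..degree P}"
    then have "norm x ^ i \<le> (1 + norm x) ^ i" "(1 + norm x) ^ i \<le> (1 + norm x) ^ d"
      using assms by (auto intro!: power_mono power_increasing)
    then show "norm x ^ i \<le> (1 + norm x) ^ d" by linarith
  qed simp
  finally show "norm (poly P x) \<le> (\<Sum>i\<le>degree P. norm (coeff P i)) * (1 + norm x) ^ d"
    by (simp add: sum_distrib_right)
qed (simp add: sum_nonneg)


section \<open>Growth of binomial coefficients\<close>

lemma binomial_diff_le: "(l + m) choose (Suc J) \<le> (m choose Suc J) + l * (l + m) ^ J"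
proof (induction l)
  case (Suc l)
  have "(l + m) choose J \<le> (l + m) ^ J"
    by (cases "J \<le> l + m") (simp_all add: binomial_le_pow binomial_eq_0)
  also have "\<dots> \<le> (Suc l + m) ^ J"
    by (intro power_mono) auto
  finally have "(l + m) choose J \<le> (Suc l + m) ^ J" .
  moreover have "l * (l + m) ^ J \<le> l * (Suc l + m) ^ J"
    by (intro mult_left_mono power_mono) auto
  moreover have "Suc l + m choose Suc J = ((l + m) choose J) + ((l + m) choose Suc J)"
    "Suc l * (Suc l + m) ^ J = (Suc l + m) ^ J + l * (Suc l + m) ^ J" by simp_all
  ultimately show ?case using Suc.IH by linarith
qed simp

lemma binomial_ge_power:
  assumes "0 < J" "J \<le> m"
  shows "0 < real (m choose J)" "1 / real (m choose J) \<le> real J ^ J / real m ^ J"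
proof -
  show pos: "0 < real (m choose J)" using assms by simp
  have "(real m / real J) ^ J \<le> real (m choose J)"
    using binomial_ge_n_over_k_pow_k[OF assms(2), where 'a=real] by simp
  moreover have "0 < (real m / real J) ^ J" using assms by simp
  ultimately have "1 / real (m choose J) \<le> 1 / (real m / real J) ^ J"
    using pos by (intro divide_left_mono) auto
  then show "1 / real (m choose J) \<le> real J ^ J / real m ^ J"
    by (simp add: power_divide)
qed

text \<open>\<open>m choose J\<close> has order \<open>m ^ J\<close>, while \<open>l\<close> steps
  of Pascal's rule add only terms of order \<open>m ^ (J - 1)\<close>. For fixed \<open>l\<close> a
  factor \<open>1 / m\<close> remains.\<close>

lemma binomial_ratio_bound:
  assumes J: "0 < J" "J \<le> m"
  shows "\<bar>1 - real ((l + m) choose J) / real (m choose J)\<bar>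
    \<le> real l * (1 + real l) ^ (J - 1) * real J ^ J / real m"
proof -
  obtain J' where J': "J = Suc J'" using J by (cases J) auto
  note pos = binomial_ge_power(1)[OF J]
  have m: "0 < real m" using J by simp
  have le: "m choose J \<le> (l + m) choose J"
    by (rule binomial_right_mono) simp
  have "\<bar>1 - real ((l + m) choose J) / real (m choose J)\<bar>
      = (real ((l + m) choose J) - real (m choose J)) * (1 / real (m choose J))"
    using pos le by (simp add: field_simps abs_if)
  also have "\<dots> \<le> (real l * real (l + m) ^ J') * (real J ^ J / real m ^ J)"
  proof (intro mult_mono binomial_ge_power(2) J)
    have "real ((l + m) choose J) \<le> real ((m choose J) + l * (l + m) ^ J')"
      using binomial_diff_le[of l m J'] by (simp only: J' of_nat_le_iff)
    then show "real ((l + m) choose J) - real (m choose J) \<le> real l * real (l + m) ^ J'" by simp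
  qed (use le in auto)
  also have "\<dots> \<le> (real l * ((1 + real l) * real m) ^ J') * (real J ^ J / real m ^ J)"
  proof (intro mult_right_mono mult_left_mono power_mono)
    have "real l * 1 \<le> real l * real m" using J by (intro mult_left_mono) auto
    then show "real (l + m) \<le> (1 + real l) * real m" by (simp add: algebra_simps)
  qed auto
  also have "\<dots> = real l * (1 + real l) ^ (J - 1) * real J ^ J / real m"
    using m by (simp add: J' power_mult_distrib)
  finally show ?thesis .
qed

lemma norm_one_minus_power_le:
  fixes x :: "'k::real_normed_field"
  assumes "norm x \<le> 1"
  shows "norm (1 - (1 - x) ^ e) \<le> norm x * (real e * 2 ^ e)"
proof -
  have "1 - (1 - x) ^ e = x * (\<Sum>i<e. (1 - x) ^ i)"
    using one_diff_power_eq[of "1 - x" e] by simp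
  moreover have "norm (\<Sum>i<e. (1 - x) ^ i) \<le> (\<Sum>i<e. 2 ^ e)"
  proof (rule sum_norm_le)
    fix i assume "i \<in> {..<e}"
    have "norm (1 - x) \<le> 2" using norm_triangle_ineq4[of 1 x] assms by simp
    then have "norm ((1 - x) ^ i) \<le> 2 ^ i" by (simp add: norm_power power_mono)
    also have "\<dots> \<le> 2 ^ e" using \<open>i \<in> {..<e}\<close> by simp
    finally show "norm ((1 - x) ^ i) \<le> 2 ^ e" .
  qed
  ultimately show ?thesis by (simp add: norm_mult mult_left_mono)
qed

lemma tendsto_zero_if_le_over_n:
  assumes "\<And>m. m0 \<le> m \<Longrightarrow> norm (x m) \<le> C / real m"
  shows "x \<longlonglongrightarrow> 0"
proof (rule Lim_null_comparison)
  show "eventually (\<lambda>m. norm (x m) \<le> C / real m) sequentially"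
    using assms eventually_sequentially by blast
qed (rule lim_const_over_n)

text \<open>
  A vector with coordinates \<open>c\<close> in a Jordan chain is the sequence \<open>newton_value c\<close>, on which
  \<open>I + N\<close> acts as the translation \<open>l \<mapsto> l + 1\<close>. With \<open>\<pi> t = (t choose J) / (m choose J)\<close>,
  the factor \<open>1 - (1 - \<pi> t) ^ e\<close> is close to \<open>0\<close> at fixed \<open>t\<close> and close to \<open>1\<close> at \<open>t = l + m\<close>,
  and so cuts off between \<open>y t\<close> and \<open>z (t - m)\<close>.
\<close>

lemma add_shift_steering:
  fixes y z :: "nat \<Rightarrow> 'k::real_normed_field"
  assumes y: "\<And>i. q \<le> i \<Longrightarrow> y i = 0" and z: "\<And>i. q \<le> i \<Longrightarrow> z i = 0"
  obtains R c where "J \<le> R" "q \<le> R" "\<And>m i. i < J \<or> R < i \<Longrightarrow> c m i = 0" "\<And>m. c m R \<noteq> 0"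
    "\<And>i. (\<lambda>m. c m i) \<longlonglongrightarrow> (0::'k)"
    "\<And>i. (\<lambda>m. (add_shift ^^ m) (\<lambda>i. y i + c m i) i) \<longlonglongrightarrow> z i"
proof -
  \<comment> \<open>\<open>K\<close> exceeds \<open>J\<close>, so that the correction vanishes at
    all \<open>t < J\<close> and its first \<open>J\<close> coefficients with it. It also exceeds
    \<open>q\<close>, so that at fixed \<open>t\<close> the cutoff decays faster than polynomials of
    degree \<open>q\<close> can grow with \<open>m\<close>.\<close>
  define K where "K = J + q + 1"
  have K: "0 < K" by (simp add: K_def)
  define of_coeffs :: "(nat \<Rightarrow> 'k) \<Rightarrow> 'k poly" where
    "of_coeffs x = (\<Sum>i<q. smult (x i) (binomial_poly i))" for x
  have of_coeffs: "poly (of_coeffs x) (of_nat t) = newton_value x t" if "\<And>i. q \<le> i \<Longrightarrow> x i = 0" for x t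
  proof -
    have "poly (of_coeffs x) (of_nat t) = (\<Sum>i<q. x i * of_nat (t choose i))"
      by (simp add: of_coeffs_def poly_sum poly_binomial_poly)
    also have "\<dots> = (\<Sum>i\<in>{..<q} \<inter> {..t}. x i * of_nat (t choose i))"
      by (intro sum.mono_neutral_right) auto
    also have "\<dots> = newton_value x t"
      unfolding newton_value_def using that by (intro sum.mono_neutral_left) (auto simp: not_less[symmetric])
    finally show ?thesis .
  qed
  have deg_of_coeffs: "degree (of_coeffs x) \<le> q" for x
    unfolding of_coeffs_def
    by (intro degree_sum_le order_trans[OF degree_smult_le]) (auto simp: degree_binomial_poly)
  define Y Z where "Y = of_coeffs y" and "Z = of_coeffs z"
  have Y: "poly Y (of_nat t) = newton_value y t" and Z: "poly Z (of_nat t) = newton_value z t" for t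
    using of_coeffs y z by (simp_all add: Y_def Z_def)
  define P where "P m = smult (1 / of_nat (m choose K)) (binomial_poly K :: 'k poly)" for m :: nat
  have P: "poly (P m) (of_nat t) = of_nat (t choose K) / of_nat (m choose K)" for m t
    by (simp add: P_def poly_binomial_poly)
  have normP: "norm (poly (P m) (of_nat t)) = real (t choose K) / real (m choose K)" for m t
    by (simp add: P norm_divide)
  \<comment> \<open>The exponent \<open>Suc q\<close> makes the cutoff error at \<open>l + m\<close>
    of order \<open>(1 / m) ^ Suc q\<close>, against polynomial values of order
    \<open>m ^ q\<close>.\<close>
  define V where "V m = (1 - (1 - P m) ^ Suc q) * (pcompose Z [:- of_nat m, 1:] - Y)" for m :: nat
  have pV: "poly (V m) x = (1 - (1 - poly (P m) x) ^ Suc q) * (poly Z (x - of_nat m) - poly Y x)" for m x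
    by (simp add: V_def poly_pcompose)
  \<comment> \<open>One more than the degree bound of \<open>V m\<close>, so that the coefficient at
    \<open>R\<close> can be chosen freely.\<close>
  define R where "R = K * Suc q + q + 1"
  have degV: "degree (V m) \<le> R - 1" for m
  proof -
    have "degree (P m) \<le> K"
      by (simp add: P_def degree_binomial_poly)
    then have "degree (1 - P m) \<le> K"
      by (intro degree_diff_le) auto
    then have "degree ((1 - P m) ^ Suc q) \<le> K * Suc q"
      using degree_power_le[of "1 - P m" "Suc q"] by (meson mult_le_mono1 order_trans)
    then have "degree (1 - (1 - P m) ^ Suc q) \<le> K * Suc q"
      by (intro degree_diff_le) auto
    moreover have "degree (pcompose Z [:- of_nat m, 1:] - Y) \<le> q"
      using deg_of_coeffs[of z] deg_of_coeffs[of y]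
      by (intro degree_diff_le) (simp_all add: Z_def Y_def degree_pcompose)
    ultimately show ?thesis
      unfolding V_def R_def by (intro order_trans[OF degree_mult_le]) simp
  qed
  obtain a where a: "\<And>m i. R - 1 < i \<Longrightarrow> a m i = 0" "\<And>m t. poly (V m) (of_nat t) = newton_value (a m) t"
    using ex_newton_value[OF degV] by metis
  \<comment> \<open>This term makes the coefficient at \<open>R\<close> nonzero without harm to the
    limits: \<open>4 ^ m\<close> outgrows \<open>(l + m) choose R\<close>, which is at most
    \<open>2 ^ (l + m)\<close>.\<close>
  define top :: "nat \<Rightarrow> nat \<Rightarrow> 'k" where "top m i = (if i = R then 1 / 4 ^ m else 0)" for m i
  define c where "c m i = a m i + top m i" for m i
  have top: "newton_value (top m) t = of_nat (t choose R) / 4 ^ m" for m t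
    by (simp add: newton_value_def top_def if_distrib if_distribR sum.delta cong: if_cong)
  have c: "newton_value (c m) t = poly (V m) (of_nat t) + of_nat (t choose R) / 4 ^ m" for m t
    by (simp add: c_def [abs_def] newton_value_add top a(2))
  obtain B1 where B1: "0 \<le> B1" "\<And>x. norm (poly Z x) \<le> B1 * (1 + norm x) ^ q"
    using poly_growth[OF deg_of_coeffs[of z]] by (auto simp: Z_def)
  obtain B2 where B2: "0 \<le> B2" "\<And>x. norm (poly Y x) \<le> B2 * (1 + norm x) ^ q"
    using poly_growth[OF deg_of_coeffs[of y]] by (auto simp: Y_def)
  have grow: "1 + norm (of_nat l - of_nat m :: 'k) \<le> (2 + real l) * real m"
    "1 + norm (of_nat (l + m) :: 'k) \<le> (2 + real l) * real m"
    "1 + norm (of_nat l :: 'k) \<le> (2 + real l) * real m" if "1 \<le> m" for l m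
  proof -
    have "real l * 1 \<le> real l * real m" using that by (intro mult_left_mono) auto
    then show "1 + norm (of_nat (l + m) :: 'k) \<le> (2 + real l) * real m"
      "1 + norm (of_nat l :: 'k) \<le> (2 + real l) * real m"
      using that norm_of_nat[of "l + m", where 'a='k] by (simp_all add: distrib_right)
    show "1 + norm (of_nat l - of_nat m :: 'k) \<le> (2 + real l) * real m"
      using that \<open>real l * 1 \<le> real l * real m\<close>
      using norm_triangle_ineq4[of "of_nat l :: 'k" "of_nat m"]
      by (simp add: distrib_right)
  qed
  have near: "(\<lambda>m. poly (V m) (of_nat l)) \<longlonglongrightarrow> 0" for l
  proof (rule tendsto_zero_if_le_over_n)
    fix m assume m: "max K l \<le> m"
    then have m1: "1 \<le> m" "K \<le> m" "l \<le> m" using K by auto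
    have "l choose K \<le> m choose K" using m1 by (intro binomial_right_mono)
    then have "norm (poly (P m) (of_nat l)) \<le> 1"
      using binomial_ge_power(1)[OF K m1(2)] by (simp add: normP)
    then have "norm (1 - (1 - poly (P m) (of_nat l)) ^ Suc q)
        \<le> norm (poly (P m) (of_nat l)) * (real (Suc q) * 2 ^ Suc q)"
      by (rule norm_one_minus_power_le)
    also have "\<dots> \<le> real (l choose K) * (real K ^ K / real m ^ K) * (real (Suc q) * 2 ^ Suc q)"
      using mult_left_mono[OF binomial_ge_power(2)[OF K m1(2)], of "real (l choose K)"]
      by (intro mult_right_mono) (auto simp: normP)
    finally have 1: "norm (1 - (1 - poly (P m) (of_nat l)) ^ Suc q)
      \<le> real (l choose K) * (real K ^ K / real m ^ K) * (real (Suc q) * 2 ^ Suc q)" .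
    have "norm (poly Z (of_nat l - of_nat m) - poly Y (of_nat l))
        \<le> B1 * (1 + norm (of_nat l - of_nat m :: 'k)) ^ q + B2 * (1 + norm (of_nat l :: 'k)) ^ q"
      using B1(2) B2(2) by (meson add_mono norm_triangle_ineq4 order_trans)
    also have "\<dots> \<le> B1 * ((2 + real l) * real m) ^ q + B2 * ((2 + real l) * real m) ^ q"
      using B1(1) B2(1) grow(1,3)[OF m1(1)] by (intro add_mono mult_left_mono power_mono) auto
    also have "\<dots> = (B1 + B2) * (2 + real l) ^ q * real m ^ q"
      unfolding power_mult_distrib by (simp add: algebra_simps)
    finally have 2: "norm (poly Z (of_nat l - of_nat m) - poly Y (of_nat l)) \<le> \<dots>" .
    have "norm (poly (V m) (of_nat l)) \<le> (real (l choose K) * (real K ^ K / real m ^ K) * (real (Suc q) * 2 ^ Suc q))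
        * ((B1 + B2) * (2 + real l) ^ q * real m ^ q)"
      unfolding pV norm_mult using 1 2 by (intro mult_mono) (auto simp: B1(1) B2(1))
    also have "\<dots> = real (l choose K) * real K ^ K * (real (Suc q) * 2 ^ Suc q) * ((B1 + B2) * (2 + real l) ^ q)
        * (real m ^ q / real m ^ K)" (is "_ = ?C * _")
      by simp
    also have "\<dots> \<le> ?C * (1 / real m)"
    proof (rule mult_left_mono)
      have "K = q + Suc J" by (simp add: K_def)
      then have "real m ^ q / real m ^ K = 1 / real m ^ Suc J"
        using m1 by (simp add: power_add)
      also have "\<dots> \<le> 1 / real m"
        using m1 self_le_power[of "real m" "Suc J"] by (intro divide_left_mono) auto
      finally show "real m ^ q / real m ^ K \<le> 1 / real m" .
      show "0 \<le> ?C" using B1(1) B2(1) by simp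
    qed
    finally show "norm (poly (V m) (of_nat l)) \<le> ?C / real m" by simp
  qed
  have far: "(\<lambda>m. poly (V m) (of_nat (l + m)) + poly Y (of_nat (l + m)) - poly Z (of_nat l)) \<longlonglongrightarrow> 0" for l
  proof (rule tendsto_zero_if_le_over_n)
    fix m assume m: "K \<le> m"
    then have m1: "1 \<le> m" using K by auto
    define C where "C = real l * (1 + real l) ^ (K - 1) * real K ^ K"
    have "1 - poly (P m) (of_nat (l + m)) = of_real (1 - real ((l + m) choose K) / real (m choose K))"
      by (simp only: P) simp
    then have "norm (1 - poly (P m) (of_nat (l + m))) \<le> C / real m"
      unfolding C_def using binomial_ratio_bound[OF K m, of l] by (metis norm_of_real)
    then have 1: "norm ((1 - poly (P m) (of_nat (l + m))) ^ Suc q) \<le> (C / real m) ^ Suc q"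
      unfolding norm_power by (intro power_mono) auto
    have "norm (poly Y (of_nat (l + m)) - poly Z (of_nat l))
        \<le> B2 * (1 + norm (of_nat (l + m) :: 'k)) ^ q + B1 * (1 + norm (of_nat l :: 'k)) ^ q"
      using B1(2) B2(2) by (meson add_mono norm_triangle_ineq4 order_trans)
    also have "\<dots> \<le> B2 * ((2 + real l) * real m) ^ q + B1 * ((2 + real l) * real m) ^ q"
      using B1(1) B2(1) grow(2,3)[OF m1] by (intro add_mono mult_left_mono power_mono) auto
    also have "\<dots> = (B1 + B2) * (2 + real l) ^ q * real m ^ q"
      unfolding power_mult_distrib by (simp add: algebra_simps)
    finally have 2: "norm (poly Y (of_nat (l + m)) - poly Z (of_nat l)) \<le> \<dots>" .
    have "poly (V m) (of_nat (l + m)) + poly Y (of_nat (l + m)) - poly Z (of_nat l)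
        = (1 - poly (P m) (of_nat (l + m))) ^ Suc q * (poly Y (of_nat (l + m)) - poly Z (of_nat l))"
      unfolding pV by (simp add: algebra_simps)
    then have "norm (poly (V m) (of_nat (l + m)) + poly Y (of_nat (l + m)) - poly Z (of_nat l))
        \<le> (C / real m) ^ Suc q * ((B1 + B2) * (2 + real l) ^ q * real m ^ q)"
      using 1 2 by (simp only: norm_mult) (intro mult_mono, auto simp: C_def)
    also have "\<dots> = C ^ Suc q * ((B1 + B2) * (2 + real l) ^ q) / real m"
      using m1 by (simp add: power_divide field_simps)
    finally show "norm (poly (V m) (of_nat (l + m)) + poly Y (of_nat (l + m)) - poly Z (of_nat l)) \<le> \<dots>" .
  qed
  have top_near: "(\<lambda>m. of_nat (l choose R) / 4 ^ m :: 'k) \<longlonglongrightarrow> 0" for l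
    using tendsto_mult[OF tendsto_const[of "of_nat (l choose R)"] LIMSEQ_power_zero[of "1/4 :: 'k"]]
    by (simp add: power_divide norm_divide)
  have top_far: "(\<lambda>m. of_nat ((l + m) choose R) / 4 ^ m :: 'k) \<longlonglongrightarrow> 0" for l
  proof (rule Lim_null_comparison)
    show "eventually (\<lambda>m. norm (of_nat ((l + m) choose R) / 4 ^ m :: 'k) \<le> 2 ^ l * (1/2) ^ m) sequentially"
    proof (rule always_eventually, rule allI)
      fix m
      have "real ((l + m) choose R) \<le> real (2 ^ (l + m))"
        using binomial_le_pow2 of_nat_le_iff by blast
      then have "real ((l + m) choose R) / 4 ^ m \<le> 2 ^ (l + m) / 4 ^ m"
        by (intro divide_right_mono) auto
      moreover have "(4::real) ^ m = 2 ^ m * 2 ^ m" by (simp flip: power_mult_distrib)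
      ultimately show "norm (of_nat ((l + m) choose R) / 4 ^ m :: 'k) \<le> 2 ^ l * (1/2) ^ m"
        by (simp add: norm_divide norm_power power_add power_divide)
    qed
    show "(\<lambda>m. 2 ^ l * (1/2) ^ m :: real) \<longlonglongrightarrow> 0"
      using tendsto_mult[OF tendsto_const[of "2 ^ l"] LIMSEQ_power_zero[of "1/2 :: real"]] by simp
  qed
  show thesis
  proof (rule that[of R c])
    have "K * 1 \<le> K * Suc q" by (intro mult_left_mono) auto
    then have KR: "K < R" by (simp add: R_def)
    then show "J \<le> R" "q \<le> R" by (auto simp: K_def)
    show "c m i = 0" if "i < J \<or> R < i" for m i
      using that
    proof
      assume "i < J"
      moreover have "newton_value (c m) l = 0" if "l < J" for l
      proof -
        have "l choose K = 0" "l choose R = 0" using that KR by (auto simp: K_def intro!: binomial_eq_0)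
        then have "poly (P m) (of_nat l) = 0" "of_nat (l choose R) = (0 :: 'k)"
          by (simp_all only: P of_nat_0 div_0)
        then show ?thesis by (simp add: c pV)
      qed
      ultimately show ?thesis using newton_value_eq_0D[of J "c m" i] by blast
    next
      assume "R < i"
      then show ?thesis using a(1)[of i m] by (simp add: c_def top_def)
    qed
    show "c m R \<noteq> 0" for m
      using a(1)[of R m] by (simp add: c_def top_def R_def)
    show "(\<lambda>m. c m i) \<longlonglongrightarrow> 0" for i
    proof (rule newton_value_tendstoD[where z = "\<lambda>_. 0"])
      show "(\<lambda>m. newton_value (c m) l) \<longlonglongrightarrow> newton_value (\<lambda>_. 0) l" for l
      proof -
        have "newton_value (\<lambda>_. 0) l = (0 :: 'k)" by (simp add: newton_value_def)
        then show ?thesis using tendsto_add[OF near top_near, of l l] by (simp add: c)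
      qed
    qed
    show "(\<lambda>m. (add_shift ^^ m) (\<lambda>i. y i + c m i) i) \<longlonglongrightarrow> z i" for i
    proof (rule newton_value_tendstoD)
      fix l
      have "newton_value ((add_shift ^^ m) (\<lambda>i. y i + c m i)) l
          = (poly (V m) (of_nat (l + m)) + poly Y (of_nat (l + m)) - poly Z (of_nat l))
            + of_nat ((l + m) choose R) / 4 ^ m + newton_value z l" for m
        by (simp only: newton_value_add_shift_funpow newton_value_add c Y[symmetric] Z[symmetric])
          (simp add: algebra_simps)
      then show "(\<lambda>m. newton_value ((add_shift ^^ m) (\<lambda>i. y i + c m i)) l) \<longlonglongrightarrow> newton_value z l"
        using tendsto_add[OF tendsto_add[OF far top_far] tendsto_const, of l l "newton_value z l"] by simp
    qed
  qed
qed

section \<open>Dominated functionals\<close>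

definition sublinear :: "(real \<Rightarrow> 'a::ab_group_add \<Rightarrow> 'a) \<Rightarrow> ('a \<Rightarrow> real) \<Rightarrow> bool"
  where "sublinear scl s \<longleftrightarrow>
    (\<forall>x y. s (x + y) \<le> s x + s y) \<and> (\<forall>c\<ge>0. \<forall>x. s (scl c x) = c * s x)"

text \<open>
  A minimal sublinear functional equals all its \<open>descend\<close> variants, and is therefore additive.
\<close>

definition descend :: "(real \<Rightarrow> 'a::ab_group_add \<Rightarrow> 'a) \<Rightarrow> ('a \<Rightarrow> real) \<Rightarrow> 'a \<Rightarrow> 'a \<Rightarrow> real"
  where "descend scl s x y = (INF t\<in>{0..}. s (y + scl t x) - t * s x)"

context
  fixes scl :: "real \<Rightarrow> 'a::ab_group_add \<Rightarrow> 'a"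
  assumes vs: "vector_space scl"
begin

interpretation vector_space scl by (rule vs)

lemma sublinear_add: "sublinear scl s \<Longrightarrow> s (x + y) \<le> s x + s y"
  and sublinear_scale: "sublinear scl s \<Longrightarrow> 0 \<le> c \<Longrightarrow> s (scl c x) = c * s x"
  by (simp_all add: sublinear_def)

lemma sublinear_0: "sublinear scl s \<Longrightarrow> s 0 = 0"
  using sublinear_scale[of s 0 0] by simp

lemma sublinear_minus: "sublinear scl s \<Longrightarrow> - s (- x) \<le> s x"
  using sublinear_add[of s x "- x"] sublinear_0[of s] by simp

lemma descend_bdd:
  assumes "sublinear scl s"
  shows "bdd_below ((\<lambda>t. s (y + scl t x) - t * s x) ` {0..})"
proof (rule bdd_belowI2)
  fix t :: real assume t: "t \<in> {0..}"
  have "s (scl t x) \<le> s (y + scl t x) + s (- y)"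
    using sublinear_add[OF assms, of "y + scl t x" "- y"] by simp
  then show "- s (- y) \<le> s (y + scl t x) - t * s x"
    using assms t by (simp add: sublinear_def)
qed

lemma descend_le: "sublinear scl s \<Longrightarrow> 0 \<le> t \<Longrightarrow> descend scl s x y \<le> s (y + scl t x) - t * s x"
  unfolding descend_def by (rule cINF_lower[OF descend_bdd]) auto

lemma descend_greatest: "(\<And>t. 0 \<le> t \<Longrightarrow> b \<le> s (y + scl t x) - t * s x) \<Longrightarrow> b \<le> descend scl s x y"
  unfolding descend_def by (rule cINF_greatest) auto

lemma descend_le_self: "sublinear scl s \<Longrightarrow> descend scl s x y \<le> s y"
  using descend_le[of s 0 x y] by simp

lemma sublinear_descend:
  assumes s: "sublinear scl s"
  shows "sublinear scl (descend scl s x)"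
  unfolding sublinear_def
proof (intro conjI allI impI)
  fix y z
  have "descend scl s x (y + z) - (s (z + scl u x) - u * s x) \<le> s (y + scl t x) - t * s x"
    if "0 \<le> t" "0 \<le> u" for t u
  proof -
    have "descend scl s x (y + z) \<le> s ((y + z) + scl (t + u) x) - (t + u) * s x"
      using that by (intro descend_le s) auto
    moreover have "s ((y + z) + scl (t + u) x) \<le> s (y + scl t x) + s (z + scl u x)"
      using sublinear_add[OF s, of "y + scl t x" "z + scl u x"] by (simp add: scale_left_distrib algebra_simps)
    ultimately show ?thesis by (simp add: algebra_simps)
  qed
  then have "descend scl s x (y + z) - (s (z + scl u x) - u * s x) \<le> descend scl s x y" if "0 \<le> u" for u
    using that by (intro descend_greatest) auto
  then have "descend scl s x (y + z) - descend scl s x y \<le> s (z + scl u x) - u * s x" if "0 \<le> u" for u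
    using that by (smt (verit))
  then have "descend scl s x (y + z) - descend scl s x y \<le> descend scl s x z"
    by (rule descend_greatest)
  then show "descend scl s x (y + z) \<le> descend scl s x y + descend scl s x z" by simp
next
  have le: "descend scl s x (scl c y) \<le> c * descend scl s x y" if c: "0 < c" for c y
  proof -
    have "descend scl s x (scl c y) / c \<le> s (y + scl t x) - t * s x" if "0 \<le> t" for t
    proof -
      have "descend scl s x (scl c y) \<le> s (scl c y + scl (c * t) x) - c * t * s x"
        using c that by (intro descend_le s) auto
      also have "scl c y + scl (c * t) x = scl c (y + scl t x)"
        by (simp add: scale_right_distrib)
      also have "s \<dots> - c * t * s x = c * (s (y + scl t x) - t * s x)"
        by (simp only: sublinear_scale[OF s less_imp_le[OF c]]) (simp add: right_diff_distrib)
      finally show ?thesis using c by (simp add: field_simps)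
    qed
    then have "descend scl s x (scl c y) / c \<le> descend scl s x y" by (rule descend_greatest)
    then show ?thesis using c by (simp add: field_simps)
  qed
  fix c :: real and y assume "0 \<le> c"
  show "descend scl s x (scl c y) = c * descend scl s x y"
  proof (cases "c = 0")
    case True
    have "descend scl s x 0 \<le> 0" using descend_le_self[OF s, of x 0] sublinear_0[OF s] by simp
    moreover have "0 \<le> descend scl s x 0"
      by (rule descend_greatest) (use s in \<open>simp add: sublinear_def\<close>)
    ultimately show ?thesis using True by simp
  next
    case False
    then have c: "0 < c" using \<open>0 \<le> c\<close> by simp
    have "descend scl s x (scl (inverse c) (scl c y)) \<le> inverse c * descend scl s x (scl c y)"
      using c by (intro le) simp
    then show ?thesis using le[OF c, of y] c by (simp add: field_simps)
  qed
qed

lemma minimal_sublinear_linear: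
  assumes s: "sublinear scl s" and min: "\<And>r. sublinear scl r \<Longrightarrow> (\<And>x. r x \<le> s x) \<Longrightarrow> r = s"
  shows "Vector_Spaces.linear scl (*) s"
proof -
  \<comment> \<open>By minimality; the value \<open>t = 1\<close> in the infimum then gives
    superadditivity.\<close>
  have "descend scl s x = s" for x
    by (intro min sublinear_descend s descend_le_self)
  then have ge: "s y + s x \<le> s (y + x)" for x y
    using descend_le[OF s, of 1 x y] by simp
  then have add: "s (x + y) = s x + s y" for x y
    using s by (simp add: sublinear_def antisym)
  have neg: "s (- x) = - s x" for x
    using add[of x "- x"] sublinear_0[OF s] by simp
  have "s (scl c x) = c * s x" for c x
  proof (cases "0 \<le> c")
    case True
    then show ?thesis using s by (simp add: sublinear_def)
  next
    case False
    then show ?thesis using sublinear_scale[OF s, of "- c" x] neg[of "scl c x"] by simp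
  qed
  then show ?thesis using add vs
    by (auto simp: Vector_Spaces.linear_iff vector_space_def algebra_simps)
qed

text \<open>Zorn's lemma for the reversed pointwise order. The infimum of a chain is finite because
  every member is at least \<open>- q (- x)\<close>, and subadditive because two members of a chain
  have a common lower one.\<close>

lemma ex_minimal_sublinear:
  assumes q: "sublinear scl q"
  obtains s where "sublinear scl s" "\<And>x. s x \<le> q x"
    "\<And>r. sublinear scl r \<Longrightarrow> (\<And>x. r x \<le> s x) \<Longrightarrow> r = s"
proof -
  define A where "A = {s. sublinear scl s \<and> (\<forall>x. s x \<le> q x)}"
  have low: "- q (- x) \<le> s x" if "s \<in> A" for s x
  proof -
    have "s (- x) \<le> q (- x)" "sublinear scl s" using that by (auto simp: A_def)
    then show ?thesis using sublinear_minus[of s x] by linarith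
  qed
  have "\<exists>m\<in>A. \<forall>a\<in>A. a \<le> m \<longrightarrow> a = m"
  proof (rule predicate_Zorn[where P = "\<lambda>x y. y \<le> x"])
    show "partial_order_on A (relation_of (\<lambda>x y. y \<le> x) A)"
      by (rule partial_order_on_relation_ofI) auto
  next
    fix C assume C: "C \<in> Chains (relation_of (\<lambda>x y. y \<le> x) A)"
    then have CA: "C \<subseteq> A" by (auto simp: Chains_def relation_of_def)
    have tot: "a \<le> b \<or> b \<le> a" if "a \<in> C" "b \<in> C" for a b
      using C that by (auto simp: Chains_def relation_of_def)
    show "\<exists>u\<in>A. \<forall>a\<in>C. u \<le> a"
    proof (cases "C = {}")
      case True
      then show ?thesis using q by (auto simp: A_def)
    next
      case False
      define u where "u x = (INF s\<in>C. s x)" for x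
      have bdd: "bdd_below ((\<lambda>s. s x) ` C)" for x
        using low CA by (intro bdd_belowI2[of _ "- q (- x)"]) auto
      have u_le: "u x \<le> s x" if "s \<in> C" for s x
        unfolding u_def using bdd that by (rule cINF_lower)
      have u_ge: "b \<le> u x" if "\<And>s. s \<in> C \<Longrightarrow> b \<le> s x" for b x
        unfolding u_def using False that by (rule cINF_greatest)
      have "sublinear scl u"
        unfolding sublinear_def
      proof (intro conjI allI impI)
        fix x y
        have "u (x + y) - t y \<le> s x" if st: "s \<in> C" "t \<in> C" for s t
        proof -
          obtain r where r: "r \<in> C" "r \<le> s" "r \<le> t" using tot st by blast
          have "u (x + y) \<le> r x + r y"
            using u_le[OF r(1), of "x + y"] sublinear_add[of r x y] CA r(1) by (auto simp: A_def)
          also have "\<dots> \<le> s x + t y" using r by (intro add_mono) (auto simp: le_fun_def)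
          finally show ?thesis by simp
        qed
        then have "u (x + y) - t y \<le> u x" if "t \<in> C" for t using that by (intro u_ge) auto
        then have "u (x + y) - u x \<le> t y" if "t \<in> C" for t using that by (smt (verit))
        then have "u (x + y) - u x \<le> u y" by (rule u_ge)
        then show "u (x + y) \<le> u x + u y" by simp
      next
        fix c :: real and x assume c: "0 \<le> c"
        have sc: "s (scl c x) = c * s x" if "s \<in> C" for s
          using CA that c by (auto simp: A_def sublinear_def)
        show "u (scl c x) = c * u x"
        proof (cases "c = 0")
          case True
          obtain s where "s \<in> C" using False by blast
          then have "u 0 \<le> 0" using u_le[of s 0] CA sublinear_0[of s] by (auto simp: A_def)
          moreover have "0 \<le> u 0"
          proof (rule u_ge)
            fix s assume "s \<in> C"
            then have "sublinear scl s" using CA by (auto simp: A_def)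
            then show "0 \<le> s 0" by (simp add: sublinear_0)
          qed
          ultimately show ?thesis using True by simp
        next
          case False
          with c have c: "0 < c" by simp
          have "u (scl c x) / c \<le> u x"
          proof (rule u_ge)
            fix s assume "s \<in> C"
            then show "u (scl c x) / c \<le> s x"
              using u_le[of s "scl c x"] sc[of s] c by (simp add: field_simps)
          qed
          moreover have "c * u x \<le> u (scl c x)"
            using u_le c by (intro u_ge) (simp add: sc)
          ultimately show ?thesis using c by (simp add: field_simps)
        qed
      qed
      moreover have "u x \<le> q x" for x
      proof -
        obtain s where s: "s \<in> C" using False by blast
        then have "s x \<le> q x" using CA by (auto simp: A_def)
        then show ?thesis using u_le[OF s, of x] by linarith
      qed
      ultimately have "u \<in> A" by (simp add: A_def)
      then show ?thesis using u_le by (auto simp: le_fun_def)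
    qed
  qed
  then obtain m where m: "m \<in> A" "\<And>a. a \<in> A \<Longrightarrow> a \<le> m \<Longrightarrow> a = m" by blast
  show thesis
  proof (rule that[of m])
    show "sublinear scl m" "m x \<le> q x" for x using m(1) by (auto simp: A_def)
    fix r assume "sublinear scl r" "\<And>x. r x \<le> m x"
    moreover from this have "r \<in> A" using m(1) by (auto simp: A_def intro: order_trans)
    ultimately show "r = m" using m(2) by (simp add: le_fun_def)
  qed
qed

text \<open>The minimal functional is sought below \<open>descend scl q e\<close> rather than below
  \<open>q\<close>. At \<open>- e\<close>, with \<open>t = 1\<close>, that functional is at most
  \<open>- q e\<close>, which forces the value \<open>q e\<close> at \<open>e\<close>.\<close>

lemma ex_dominated_functional:
  assumes q: "seminorm scl q"
  obtains g where "Vector_Spaces.linear scl (*) g" "\<And>x. \<bar>g x\<bar> \<le> q x" "g e = q e"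
proof -
  have sub: "sublinear scl q"
    using q by (auto simp: seminorm_def sublinear_def)
  obtain g where g: "sublinear scl g" "\<And>x. g x \<le> descend scl q e x"
    "\<And>r. sublinear scl r \<Longrightarrow> (\<And>x. r x \<le> g x) \<Longrightarrow> r = g"
    by (rule ex_minimal_sublinear[OF sublinear_descend[OF sub]]) blast
  have lin: "Vector_Spaces.linear scl (*) g"
    by (rule minimal_sublinear_linear[OF g(1,3)])
  have neg: "g (- x) = - g x" for x
  proof -
    have "g (scl (- 1) x) = - 1 * g x" using lin unfolding Vector_Spaces.linear_iff by blast
    then show ?thesis by simp
  qed
  have le: "g x \<le> q x" for x
    using g(2) descend_le_self[OF sub] order_trans by blast
  have qneg: "q (- x) = q x" for x
  proof -
    have "q (scl (- 1) x) = norm (- 1 :: real) * q x" using q unfolding seminorm_def by blast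
    then show ?thesis by simp
  qed
  show thesis
  proof (rule that[OF lin])
    show "\<bar>g x\<bar> \<le> q x" for x
      using le[of x] le[of "- x"] by (simp add: neg qneg abs_le_iff)
    have "g (- e) \<le> - q e"
      using g(2)[of "- e"] descend_le[OF sub, of 1 e "- e"] sublinear_0[OF sub] by simp
    then show "g e = q e" using le[of e] by (simp add: neg antisym)
  qed
qed

end

text \<open>The usual complexification \<open>g x - \<i> g (\<i> x)\<close> of a real functional
  \<open>g\<close>. The crude factor 2 in its bound is harmless because \<open>M\<close> is
  arbitrary.\<close>

lemma ex_dominated_functional_complex:
  fixes scl :: "complex \<Rightarrow> 'a::ab_group_add \<Rightarrow> 'a"
  assumes vs: "vector_space scl" and q: "seminorm scl q" and e: "0 < q e"
  obtains f M where "Vector_Spaces.linear scl (*) f" "\<And>x. norm (f x) \<le> M * q x" "f e = 1"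
proof -
  interpret vector_space scl by (rule vs)
  define rscl where "rscl c = scl (complex_of_real c)" for c
  have rvs: "vector_space rscl"
    by unfold_locales (simp_all add: rscl_def scale_left_distrib scale_right_distrib)
  have "seminorm rscl q" using q by (simp add: seminorm_def rscl_def)
  then obtain g where g: "Vector_Spaces.linear rscl (*) g" "\<And>x. \<bar>g x\<bar> \<le> q x" "g e = q e"
    by (rule ex_dominated_functional[OF rvs]) blast
  have g_add: "g (x + y) = g x + g y" and g_scale: "g (scl (complex_of_real c) x) = c * g x" for x y c
    using g(1) by (auto simp: Vector_Spaces.linear_iff rscl_def)
  define h where "h x = Complex (g x) (- g (scl \<i> x))" for x
  have h_add: "h (x + y) = h x + h y" for x y
    by (simp add: h_def g_add scale_right_distrib complex_eq_iff)
  have h_scale: "h (scl c x) = c * h x" for c x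
  proof -
    have 1: "scl c x = scl (complex_of_real (Re c)) x + scl (complex_of_real (Im c)) (scl \<i> x)"
      by (subst complex_eq[of c]) (simp add: scale_left_distrib mult.commute)
    have 2: "scl \<i> (scl c x) = scl (complex_of_real (Re c)) (scl \<i> x) + scl (complex_of_real (- Im c)) x"
      by (subst complex_eq[of c]) (simp add: scale_left_distrib algebra_simps)
    have "g (scl c x) = Re c * g x + Im c * g (scl \<i> x)" by (subst 1) (simp only: g_add g_scale)
    moreover have "g (scl \<i> (scl c x)) = Re c * g (scl \<i> x) + (- Im c) * g x"
      by (subst 2) (simp only: g_add g_scale)
    ultimately show ?thesis by (simp add: h_def complex_eq_iff algebra_simps)
  qed
  have h_le: "norm (h x) \<le> 2 * q x" for x
  proof -
    have "norm (h x) \<le> \<bar>g x\<bar> + \<bar>g (scl \<i> x)\<bar>" using cmod_le[of "h x"] by (simp add: h_def)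
    moreover have "q (scl \<i> x) = q x" using q by (simp add: seminorm_def)
    ultimately show ?thesis using g(2)[of x] g(2)[of "scl \<i> x"] by simp
  qed
  have he: "h e \<noteq> 0" using g(3) e by (simp add: h_def complex_eq_iff)
  show thesis
  proof (rule that[of "\<lambda>x. h x / h e" "2 / norm (h e)"])
    show "Vector_Spaces.linear scl (*) (\<lambda>x. h x / h e)"
      using vs by (simp add: Vector_Spaces.linear_iff h_add h_scale add_divide_distrib)
        (simp add: vector_space_def algebra_simps)
    show "norm (h x / h e) \<le> 2 / norm (h e) * q x" for x
      using h_le[of x] he by (simp add: norm_divide field_simps)
    show "h e / h e = 1" using he by simp
  qed
qed

section \<open>Hypercyclicity with respect to graded seminorms\<close>

text \<open>Topology is replaced by seminorms here. Hahn-Banach is an assumption, so that its real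
  and its complex form can both be supplied, and \<open>emb\<close> carries the scalars into the
  complex numbers, where polynomials split.\<close>

locale graded_seminorms = vector_space scl
  for scl :: "'k::real_normed_field \<Rightarrow> 'a::ab_group_add \<Rightarrow> 'a" +
  fixes p :: "nat \<Rightarrow> 'a \<Rightarrow> real" and emb :: "'k \<Rightarrow> complex"
  assumes seminorm_p: "seminorm scl (p n)"
    and p_Suc: "p n x \<le> p (Suc n) x"
    and p_separating: "(\<And>n. p n x = 0) \<Longrightarrow> x = 0"
    and p_complete: "(\<And>n e. 0 < e \<Longrightarrow> \<exists>N. \<forall>i\<ge>N. \<forall>j\<ge>N. p n (X i - X j) < e)
      \<Longrightarrow> \<exists>L. \<forall>n. (\<lambda>i. p n (X i - L)) \<longlonglongrightarrow> 0"
    and functional_exists: "seminorm scl q \<Longrightarrow> 0 < q e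
      \<Longrightarrow> \<exists>f M. Vector_Spaces.linear scl (*) f \<and> (\<forall>x. norm (f x) \<le> M * q x) \<and> f e = (1::'k)"
    and emb_add: "emb (c + d) = emb c + emb d"
    and emb_mult: "emb (c * d) = emb c * emb d"
    and emb_1: "emb 1 = 1"
    and norm_emb: "norm (emb c) = norm c"
begin

sublocale op: vector_space_pair scl scl ..

sublocale functional: vector_space_pair scl "(*) :: 'k \<Rightarrow> 'k \<Rightarrow> 'k"
  by unfold_locales (simp_all add: algebra_simps)

lemma p_nonneg [simp]: "0 \<le> p n x"
  and p_add: "p n (x + y) \<le> p n x + p n y"
  and p_scale [simp]: "p n (scl c x) = norm c * p n x"
  using seminorm_p[of n] by (simp_all add: seminorm_def)

lemma p_zero [simp]: "p n 0 = 0"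
  using p_scale[of n 0 0] by simp

lemma p_minus [simp]: "p n (- x) = p n x"
  using p_scale[of n "- 1" x] by simp

lemma p_minus_commute: "p n (x - y) = p n (y - x)"
  using p_minus[of n "x - y"] by simp

lemma p_diff: "p n (x - y) \<le> p n x + p n y"
  using p_add[of n x "- y"] by simp

lemma p_triangle: "p n (x - z) \<le> p n (x - y) + p n (y - z)"
  using p_add[of n "x - y" "y - z"] by simp

lemma p_sum: "p n (sum h S) \<le> (\<Sum>i\<in>S. p n (h i))"
proof (induction S rule: infinite_finite_induct)
  case (insert i S)
  then show ?case using p_add[of n "h i" "sum h S"] by simp
qed simp_all

lemma p_mono: "n \<le> m \<Longrightarrow> p n x \<le> p m x"
  by (rule lift_Suc_mono_le[of "\<lambda>n. p n x"]) (rule p_Suc)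

lemma linear_funpow: "Vector_Spaces.linear scl scl T \<Longrightarrow> Vector_Spaces.linear scl scl (T ^^ m)"
  by (induction m) (auto simp: Vector_Spaces.linear_iff)

lemma emb_0 [simp]: "emb 0 = 0"
  using emb_add[of 0 0] by simp

definition bounded_operator :: "('a \<Rightarrow> 'a) \<Rightarrow> bool"
  where "bounded_operator T \<longleftrightarrow> Vector_Spaces.linear scl scl T \<and> (\<forall>n. \<exists>m M. 0 \<le> M \<and> (\<forall>x. p n (T x) \<le> M * p m x))"

definition dense_orbit :: "('a \<Rightarrow> 'a) \<Rightarrow> 'a \<Rightarrow> bool"
  where "dense_orbit T u \<longleftrightarrow> (\<forall>y n e. 0 < e \<longrightarrow> (\<exists>m. p n ((T ^^ m) u - y) < e))"

definition poly_operator :: "'k poly \<Rightarrow> ('a \<Rightarrow> 'a) \<Rightarrow> 'a \<Rightarrow> 'a"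
  where "poly_operator P T x = (\<Sum>i\<le>degree P. scl (coeff P i) ((T ^^ i) x))"

lemma bounded_operator_funpow:
  assumes T: "bounded_operator T"
  shows "bounded_operator (T ^^ i)"
proof (induction i)
  case 0
  have "\<exists>m M. 0 \<le> M \<and> (\<forall>x. p n x \<le> M * p m x)" for n
    by (rule exI[of _ n], rule exI[of _ 1]) simp
  then show ?case by (simp add: bounded_operator_def linear_ident)
next
  case (Suc i)
  show ?case unfolding bounded_operator_def
  proof (intro conjI allI)
    show "Vector_Spaces.linear scl scl (T ^^ Suc i)" using T by (simp only: bounded_operator_def linear_funpow)
    fix n
    obtain m M where M: "0 \<le> M" "\<And>x. p n (T x) \<le> M * p m x"
      using T unfolding bounded_operator_def by blast
    obtain m' M' where M': "0 \<le> M'" "\<And>x. p m ((T ^^ i) x) \<le> M' * p m' x"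
      using Suc unfolding bounded_operator_def by blast
    have "p n ((T ^^ Suc i) x) \<le> (M * M') * p m' x" for x
      using M(2)[of "(T ^^ i) x"] mult_left_mono[OF M'(2)[of x] M(1)] by (simp add: mult.assoc)
    then show "\<exists>m M. 0 \<le> M \<and> (\<forall>x. p n ((T ^^ Suc i) x) \<le> M * p m x)"
      using M(1) M'(1) by (meson mult_nonneg_nonneg)
  qed
qed

lemma bounded_operator_scale:
  assumes T: "bounded_operator T"
  shows "bounded_operator (\<lambda>x. scl c (T x))"
  unfolding bounded_operator_def
proof (intro conjI allI)
  show "Vector_Spaces.linear scl scl (\<lambda>x. scl c (T x))"
    using T by (simp add: bounded_operator_def op.linear_compose_scale_right)
  fix n
  obtain m M where M: "0 \<le> M" "\<And>x. p n (T x) \<le> M * p m x"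
    using T unfolding bounded_operator_def by blast
  have "p n (scl c (T x)) \<le> (norm c * M) * p m x" for x
    using mult_left_mono[OF M(2)[of x], of "norm c"] by (simp add: mult.assoc)
  then show "\<exists>m M. 0 \<le> M \<and> (\<forall>x. p n (scl c (T x)) \<le> M * p m x)"
    using M(1) by (meson mult_nonneg_nonneg norm_ge_zero)
qed

lemma bounded_operator_add:
  assumes S: "bounded_operator S" and T: "bounded_operator T"
  shows "bounded_operator (\<lambda>x. S x + T x)"
  unfolding bounded_operator_def
proof (intro conjI allI)
  show "Vector_Spaces.linear scl scl (\<lambda>x. S x + T x)"
    using S T by (simp add: bounded_operator_def op.linear_compose_add)
  fix n
  obtain m M where M: "0 \<le> M" "\<And>x. p n (S x) \<le> M * p m x"
    using S unfolding bounded_operator_def by blast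
  obtain m' M' where M': "0 \<le> M'" "\<And>x. p n (T x) \<le> M' * p m' x"
    using T unfolding bounded_operator_def by blast
  have "p n (S x + T x) \<le> (M + M') * p (max m m') x" for x
  proof -
    have "p n (S x) \<le> M * p (max m m') x" "p n (T x) \<le> M' * p (max m m') x"
      using M(2)[of x] mult_left_mono[OF p_mono[of m "max m m'" x] M(1)]
        M'(2)[of x] mult_left_mono[OF p_mono[of m' "max m m'" x] M'(1)] by simp_all
    then show ?thesis using p_add[of n "S x" "T x"] by (simp add: distrib_right)
  qed
  then show "\<exists>m M. 0 \<le> M \<and> (\<forall>x. p n (S x + T x) \<le> M * p m x)"
    using M(1) M'(1) by (meson add_nonneg_nonneg)
qed

lemma bounded_operator_sum:
  assumes "\<And>i. i \<in> I \<Longrightarrow> bounded_operator (S i)"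
  shows "bounded_operator (\<lambda>x. \<Sum>i\<in>I. S i x)"
proof -
  have "bounded_operator (\<lambda>x. 0)"
    unfolding bounded_operator_def by (auto simp: op.linear_zero intro!: exI[of _ "0 :: real"])
  then show ?thesis
    using assms
    by (induction I rule: infinite_finite_induct) (simp_all add: bounded_operator_add)
qed

section \<open>Polynomials in an operator and their annihilators\<close>

lemma bounded_operator_poly: "bounded_operator T \<Longrightarrow> bounded_operator (poly_operator P T)"
  unfolding poly_operator_def [abs_def]
  by (intro bounded_operator_sum bounded_operator_scale bounded_operator_funpow)

lemma funpow_funpow_commute: "(T ^^ m) ((T ^^ i) x) = (T ^^ i) ((T ^^ m) x)"
  by (metis add.commute comp_apply funpow_add)

lemma poly_operator_commute:
  assumes "Vector_Spaces.linear scl scl T"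
  shows "(T ^^ m) (poly_operator P T x) = poly_operator P T ((T ^^ m) x)"
  using linear_funpow[OF assms, of m] unfolding poly_operator_def
  by (simp add: op.linear_sum op.linear_scale funpow_funpow_commute)

text \<open>The quotient seminorm of \<open>p n\<close> modulo \<open>Y\<close>. A functional
  dominated by it vanishes on \<open>Y\<close> and is bounded by a multiple of \<open>p n\<close>,
  which turns Hahn-Banach into a separation statement.\<close>

lemma dist_subspace_seminorm:
  fixes Y :: "'a set" and n :: nat
  assumes Y: "subspace Y"
  defines "d \<equiv> \<lambda>x. INF y\<in>Y. p n (x - y)"
  shows "seminorm scl d" "\<And>y. y \<in> Y \<Longrightarrow> d y = 0" "\<And>x. d x \<le> p n x"
    "\<And>x b. (\<And>y. y \<in> Y \<Longrightarrow> b \<le> p n (x - y)) \<Longrightarrow> b \<le> d x"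
proof -
  have bdd: "bdd_below ((\<lambda>y. p n (x - y)) ` Y)" for x
    by (rule bdd_belowI2[of _ 0]) simp
  have le: "d x \<le> p n (x - y)" if "y \<in> Y" for x y
    unfolding d_def using bdd that by (rule cINF_lower)
  show ge: "b \<le> d x" if "\<And>y. y \<in> Y \<Longrightarrow> b \<le> p n (x - y)" for x b
    unfolding d_def using subspace_0[OF Y] that by (intro cINF_greatest) auto
  show "d x \<le> p n x" for x
    using le[OF subspace_0[OF Y], of x] by simp
  have nn: "0 \<le> d x" for x by (rule ge) simp
  show d0: "d y = 0" if "y \<in> Y" for y
    using le[OF that, of y] nn[of y] by simp
  have scale_le: "d (scl c x) \<le> norm c * d x" if c: "c \<noteq> 0" for c x
  proof -
    have "d (scl c x) / norm c \<le> d x"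
    proof (rule ge)
      fix y assume "y \<in> Y"
      then have "d (scl c x) \<le> p n (scl c x - scl c y)"
        using Y by (intro le) (rule subspace_scale)
      also have "\<dots> = norm c * p n (x - y)"
        by (simp flip: scale_right_diff_distrib)
      finally show "d (scl c x) / norm c \<le> p n (x - y)"
        using c by (simp add: field_simps)
    qed
    then show ?thesis using c by (simp add: field_simps)
  qed
  show "seminorm scl d" unfolding seminorm_def
  proof (intro conjI allI)
    show "0 \<le> d x" for x by (rule nn)
    fix x y
    have "d (x + y) - p n (y - v) \<le> d x" if v: "v \<in> Y" for v
    proof (rule ge)
      fix w assume "w \<in> Y"
      then have "d (x + y) \<le> p n ((x + y) - (w + v))" using Y v by (intro le subspace_add)
      also have "\<dots> \<le> p n (x - w) + p n (y - v)"
        using p_add[of n "x - w" "y - v"] by (simp add: algebra_simps)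
      finally show "d (x + y) - p n (y - v) \<le> p n (x - w)" by simp
    qed
    then have "d (x + y) - d x \<le> p n (y - v)" if "v \<in> Y" for v using that by (smt (verit))
    then have "d (x + y) - d x \<le> d y" by (rule ge)
    then show "d (x + y) \<le> d x + d y" by simp
  next
    fix c x
    show "d (scl c x) = norm c * d x"
    proof (cases "c = 0")
      case True
      then show ?thesis using d0[OF subspace_0[OF Y]] by simp
    next
      case False
      then have "d (scl (inverse c) (scl c x)) \<le> norm (inverse c) * d (scl c x)"
        by (intro scale_le) simp
      then have "d x \<le> inverse (norm c) * d (scl c x)" using False by (simp add: norm_inverse)
      then have "norm c * d x \<le> d (scl c x)" using False by (simp add: field_simps)
      then show ?thesis using scale_le[OF False, of x] by simp
    qed
  qed
qed

text \<open>For real scalars this is the complexified dual.\<close>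

definition complex_functional :: "('a \<Rightarrow> complex) \<Rightarrow> bool"
  where "complex_functional \<psi> \<longleftrightarrow> (\<forall>x y. \<psi> (x + y) = \<psi> x + \<psi> y) \<and>
    (\<forall>c x. \<psi> (scl c x) = emb c * \<psi> x) \<and> (\<exists>n M. 0 \<le> M \<and> (\<forall>x. norm (\<psi> x) \<le> M * p n x))"

text \<open>\<open>Q\<close> in the transpose of \<open>T\<close>, applied to \<open>\<psi>\<close>.
  The complex coefficients act on values, so the space itself need not be complexified.\<close>

definition transpose_poly :: "complex poly \<Rightarrow> ('a \<Rightarrow> 'a) \<Rightarrow> ('a \<Rightarrow> complex) \<Rightarrow> 'a \<Rightarrow> complex"
  where "transpose_poly Q T \<psi> x = (\<Sum>i\<le>degree Q. coeff Q i * \<psi> ((T ^^ i) x))"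

lemma transpose_poly_eq:
  "degree Q \<le> N \<Longrightarrow> transpose_poly Q T \<psi> x = (\<Sum>i\<le>N. coeff Q i * \<psi> ((T ^^ i) x))"
  unfolding transpose_poly_def by (rule sum.mono_neutral_left) (auto simp: coeff_eq_0)

lemma transpose_poly_linear_factor:
  "transpose_poly ([:- a, 1:] * Q) T \<psi> x = transpose_poly Q T \<psi> (T x) - a * transpose_poly Q T \<psi> x"
proof -
  have "degree ([:- a, 1:] * Q) \<le> Suc (degree Q)"
    using degree_mult_le[of "[:- a, 1:]" Q] by simp
  then have "transpose_poly ([:- a, 1:] * Q) T \<psi> x
      = (\<Sum>i\<le>Suc (degree Q). coeff (pCons 0 Q - smult a Q) i * \<psi> ((T ^^ i) x))"
    by (subst transpose_poly_eq) (auto simp: algebra_simps)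
  also have "\<dots> = (\<Sum>i\<le>Suc (degree Q). coeff (pCons 0 Q) i * \<psi> ((T ^^ i) x))
      - a * (\<Sum>i\<le>Suc (degree Q). coeff Q i * \<psi> ((T ^^ i) x))"
    by (simp only: coeff_diff coeff_smult left_diff_distrib sum_subtractf sum_distrib_left mult.assoc)
  also have "(\<Sum>i\<le>Suc (degree Q). coeff (pCons 0 Q) i * \<psi> ((T ^^ i) x)) = transpose_poly Q T \<psi> (T x)"
    by (subst sum.atMost_Suc_shift) (simp add: transpose_poly_def funpow_swap1)
  finally show ?thesis
    by (simp only: transpose_poly_eq[of Q "Suc (degree Q)"] le_Suc_eq order_refl simp_thms)
qed

lemma complex_functional_transpose_poly:
  assumes T: "bounded_operator T" and \<psi>: "complex_functional \<psi>"
  shows "complex_functional (transpose_poly Q T \<psi>)"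
  unfolding complex_functional_def
proof (intro conjI allI)
  have lin: "Vector_Spaces.linear scl scl (T ^^ i)" for i
    using T by (simp add: bounded_operator_def linear_funpow)
  show "transpose_poly Q T \<psi> (x + y) = transpose_poly Q T \<psi> x + transpose_poly Q T \<psi> y" for x y
    using \<psi> by (simp add: transpose_poly_def complex_functional_def op.linear_add[OF lin] algebra_simps sum.distrib)
  show "transpose_poly Q T \<psi> (scl c x) = emb c * transpose_poly Q T \<psi> x" for c x
    using \<psi> by (simp add: transpose_poly_def complex_functional_def op.linear_scale[OF lin] algebra_simps sum_distrib_left)
  obtain n M where M: "0 \<le> M" "\<And>x. norm (\<psi> x) \<le> M * p n x"
    using \<psi> unfolding complex_functional_def by blast
  have "\<forall>i. \<exists>m K. 0 \<le> K \<and> (\<forall>x. p n ((T ^^ i) x) \<le> K * p m x)"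
    using bounded_operator_funpow[OF T] by (simp add: bounded_operator_def)
  then obtain m K where K: "\<And>i. 0 \<le> K i" "\<And>i x. p n ((T ^^ i) x) \<le> K i * p (m i) x"
    by metis
  define mm where "mm = Max (m ` {..degree Q})"
  have "norm (transpose_poly Q T \<psi> x) \<le> (\<Sum>i\<le>degree Q. norm (coeff Q i) * (M * K i)) * p mm x" for x
    unfolding transpose_poly_def sum_distrib_right
  proof (intro sum_norm_le)
    fix i assume i: "i \<in> {..degree Q}"
    then have "m i \<le> mm" by (simp add: mm_def)
    have "norm (\<psi> ((T ^^ i) x)) \<le> M * p n ((T ^^ i) x)" by (rule M)
    also have "\<dots> \<le> M * (K i * p (m i) x)" by (intro mult_left_mono K M)
    also have "\<dots> \<le> M * (K i * p mm x)" using \<open>m i \<le> mm\<close> by (intro mult_left_mono K M p_mono)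
    finally show "norm (coeff Q i * \<psi> ((T ^^ i) x)) \<le> norm (coeff Q i) * (M * K i) * p mm x"
      by (simp add: norm_mult mult_left_mono mult.assoc)
  qed
  moreover have "0 \<le> (\<Sum>i\<le>degree Q. norm (coeff Q i) * (M * K i))"
    using M(1) K(1) by (intro sum_nonneg) auto
  ultimately show "\<exists>n M. 0 \<le> M \<and> (\<forall>x. norm (transpose_poly Q T \<psi> x) \<le> M * p n x)" by blast
qed

text \<open>Strip off a root \<open>a\<close> of \<open>Q = [:- a, 1:] * R\<close>. If
  \<open>R\<close> in the transpose does not annihilate \<open>\<psi>\<close>, the result is an
  eigenfunctional for \<open>a\<close>; otherwise \<open>R\<close> takes the place of
  \<open>Q\<close> with smaller degree.\<close>

lemma ex_eigenfunctional:
  assumes T: "bounded_operator T"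
    and "Q \<noteq> 0" "complex_functional \<psi>" "\<psi> x0 \<noteq> 0" "\<And>x. transpose_poly Q T \<psi> x = 0"
  shows "\<exists>a \<phi> x1. complex_functional \<phi> \<and> \<phi> x1 \<noteq> 0 \<and> (\<forall>x. \<phi> (T x) = a * \<phi> x)"
  using assms(2-)
proof (induction "degree Q" arbitrary: Q rule: less_induct)
  case less
  show ?case
  proof (cases "degree Q = 0")
    case True
    then obtain c where c: "Q = [:c:]" by (metis degree_eq_zeroE)
    then have "c * \<psi> x0 = 0" using less.prems(4)[of x0] by (simp add: transpose_poly_def)
    then show ?thesis using less.prems(1,3) c by simp
  next
    case False
    then have "\<not> constant (poly Q)" by (simp add: constant_degree)
    then obtain a where "poly Q a = 0" using fundamental_theorem_of_algebra by blast
    then obtain R where R: "Q = [:- a, 1:] * R" by (auto simp: poly_eq_0_iff_dvd dvd_def)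
    then have R0: "R \<noteq> 0" using less.prems(1) by auto
    then have deg: "degree R < degree Q" unfolding R by (subst degree_mult_eq) auto
    show ?thesis
    proof (cases "\<exists>x1. transpose_poly R T \<psi> x1 \<noteq> 0")
      case True
      moreover have "transpose_poly R T \<psi> (T x) = a * transpose_poly R T \<psi> x" for x
        using less.prems(4)[of x] by (simp only: R transpose_poly_linear_factor right_minus_eq)
      ultimately show ?thesis
        using complex_functional_transpose_poly[OF T less.prems(2)] by blast
    next
      case False
      then show ?thesis using less.hyps[OF deg R0 less.prems(2,3)] by blast
    qed
  qed
qed

text \<open>Along the orbit \<open>\<phi>\<close> takes the values \<open>a ^ m * \<phi> u\<close>.
  These are bounded if \<open>norm a \<le> 1\<close> and stay away from 0 otherwise, whereas a dense
  orbit would approximate every value of \<open>\<phi>\<close>.\<close>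

lemma eigenfunctional_no_dense_orbit:
  assumes \<phi>: "complex_functional \<phi>" "\<phi> x1 \<noteq> 0" and eig: "\<And>x. \<phi> (T x) = a * \<phi> x"
  shows "\<not> dense_orbit T u"
proof
  assume dense: "dense_orbit T u"
  have pow: "\<phi> ((T ^^ m) u) = a ^ m * \<phi> u" for m
    by (induction m) (simp_all add: eig)
  have add: "\<phi> (x + y) = \<phi> x + \<phi> y" and scale: "\<phi> (scl c x) = emb c * \<phi> x" for x y c
    using \<phi>(1) by (simp_all add: complex_functional_def)
  have diff: "\<phi> (x - y) = \<phi> x - \<phi> y" for x y
    using add[of "x - y" y] by simp
  obtain n M where M: "0 \<le> M" "\<And>x. norm (\<phi> x) \<le> M * p n x"
    using \<phi>(1) unfolding complex_functional_def by blast
  have approx: "\<exists>m. norm (a ^ m * \<phi> u - \<phi> y) < e" if e: "0 < e" for y e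
  proof -
    obtain m where m: "p n ((T ^^ m) u - y) < e / (M + 1)"
      using dense e M(1) unfolding dense_orbit_def by (metis add_nonneg_pos divide_pos_pos zero_less_one)
    have "norm (a ^ m * \<phi> u - \<phi> y) \<le> M * p n ((T ^^ m) u - y)"
      using M(2)[of "(T ^^ m) u - y"] by (simp add: diff pow)
    also have "\<dots> \<le> (M + 1) * p n ((T ^^ m) u - y)" by (intro mult_right_mono) auto
    also have "\<dots> < e" using m M(1) by (simp add: field_simps)
    finally show ?thesis by blast
  qed
  have u0: "\<phi> u \<noteq> 0"
    using approx[of "norm (\<phi> x1)" x1] \<phi>(2) by auto
  show False
  proof (cases "norm a \<le> 1")
    case True
    define r where "r = (norm (\<phi> u) + 1) / norm (\<phi> x1)"
    then have "r * norm (\<phi> x1) = norm (\<phi> u) + 1" "0 \<le> r" using \<phi>(2) by simp_all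
    then have "norm (\<phi> (scl (of_real r) x1)) = norm (\<phi> u) + 1"
      by (simp add: scale norm_mult norm_emb)
    moreover obtain m where "norm (a ^ m * \<phi> u - \<phi> (scl (of_real r) x1)) < 1"
      using approx[of 1] by auto
    moreover have "norm (a ^ m * \<phi> u) \<le> norm (\<phi> u)"
      using True by (simp add: norm_mult norm_power mult_left_le_one_le power_le_one)
    ultimately show False
      using norm_triangle_ineq2[of "\<phi> (scl (of_real r) x1)" "a ^ m * \<phi> u"]
      by (simp add: norm_minus_commute)
  next
    case False
    have "\<phi> 0 = 0" using add[of 0 0] by simp
    then obtain m where "norm (a ^ m * \<phi> u) < norm (\<phi> u)"
      using approx[of "norm (\<phi> u)" 0] u0 by auto
    moreover have "1 \<le> norm a ^ m" using False by (intro one_le_power) simp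
    ultimately show False using u0 by (simp add: norm_mult norm_power)
  qed
qed

lemma poly_operator_dense_range:
  assumes T: "bounded_operator T" and u: "dense_orbit T u" and P: "P \<noteq> 0" and e: "0 < e"
  shows "\<exists>x. p n (poly_operator P T x - y) < e"
proof (rule ccontr)
  assume "\<not> ?thesis"
  then have far: "e \<le> p n (y - poly_operator P T x)" for x
    by (metis not_less p_minus_commute)
  define Y where "Y = range (poly_operator P T)"
  have linP: "Vector_Spaces.linear scl scl (poly_operator P T)"
    using bounded_operator_poly[OF T] by (simp add: bounded_operator_def)
  have Y: "subspace Y" unfolding Y_def
    by (rule op.linear_subspace_image[OF linP]) simp
  define d where "d x = (INF y\<in>Y. p n (x - y))" for x
  note d = dist_subspace_seminorm[OF Y, where n = n, folded d_def]
  have "e \<le> d y" using far by (intro d(4)) (auto simp: Y_def)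
  then have "0 < d y" using e by simp
  then obtain f M where f: "Vector_Spaces.linear scl (*) f" "\<And>x. norm (f x) \<le> M * d x" "f y = 1"
    using functional_exists[OF d(1)] by blast
  have f0: "f (poly_operator P T x) = 0" for x
    using f(2)[of "poly_operator P T x"] d(2) by (simp add: Y_def)
  have fn: "norm (f x) \<le> \<bar>M\<bar> * p n x" for x
  proof -
    have "0 \<le> d x" using d(1) by (simp add: seminorm_def)
    then have "M * d x \<le> \<bar>M\<bar> * p n x" using d(3)[of x] by (intro mult_mono) auto
    then show ?thesis using f(2)[of x] by simp
  qed
  define \<psi> where "\<psi> x = emb (f x)" for x
  have \<psi>: "complex_functional \<psi>"
    unfolding complex_functional_def using fn
    by (auto simp: \<psi>_def functional.linear_add[OF f(1)] functional.linear_scale[OF f(1)] emb_add emb_mult norm_emb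
        intro!: exI[of _ n] exI[of _ "\<bar>M\<bar>"])
  \<comment> \<open>The factorisation takes place for \<open>Q\<close>, since \<open>P\<close>
    itself need not split over the scalars.\<close>
  define Q where "Q = map_poly emb P"
  have coeffQ: "coeff Q i = emb (coeff P i)" for i
    by (simp add: Q_def coeff_map_poly)
  have "transpose_poly Q T \<psi> x = 0" for x
  proof -
    have emb_sum: "emb (sum h S) = (\<Sum>i\<in>S. emb (h i))" for h :: "nat \<Rightarrow> 'k" and S
      by (induction S rule: infinite_finite_induct) (simp_all add: emb_add)
    have "degree Q \<le> degree P" by (intro degree_le) (simp add: coeffQ coeff_eq_0)
    then have "transpose_poly Q T \<psi> x = (\<Sum>i\<le>degree P. emb (coeff P i * f ((T ^^ i) x)))"
      by (simp add: transpose_poly_eq coeffQ \<psi>_def emb_mult)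
    also have "\<dots> = emb (f (poly_operator P T x))"
      by (simp add: emb_sum poly_operator_def functional.linear_sum[OF f(1)] functional.linear_scale[OF f(1)])
    finally show ?thesis by (simp add: f0)
  qed
  moreover have "Q \<noteq> 0"
  proof
    assume "Q = 0"
    then have "norm (coeff P i) = 0" for i using coeffQ[of i] norm_emb[of "coeff P i"] by simp
    then show False using P by (simp add: poly_eq_iff)
  qed
  moreover have "\<psi> y \<noteq> 0" by (simp add: \<psi>_def f(3) emb_1)
  ultimately obtain a \<phi> x1 where "complex_functional \<phi>" "\<phi> x1 \<noteq> 0" "\<forall>x. \<phi> (T x) = a * \<phi> x"
    using ex_eigenfunctional[OF T _ \<psi>] by metis
  then show False using eigenfunctional_no_dense_orbit u by blast
qed

text \<open>\<open>P(T)\<close> commutes with \<open>T\<close>, so the orbit of \<open>P(T)u\<close>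
  is the image of a dense orbit under a continuous operator of dense range.\<close>

lemma dense_orbit_poly_operator:
  assumes T: "bounded_operator T" and u: "dense_orbit T u" and P: "P \<noteq> 0"
  shows "dense_orbit T (poly_operator P T u)"
  unfolding dense_orbit_def
proof (intro allI impI)
  fix y n and e :: real assume e: "0 < e"
  obtain x where x: "p n (poly_operator P T x - y) < e / 2"
    using poly_operator_dense_range[OF T u P] e by (meson half_gt_zero)
  have bP: "bounded_operator (poly_operator P T)" by (rule bounded_operator_poly[OF T])
  then have linP: "Vector_Spaces.linear scl scl (poly_operator P T)" by (simp add: bounded_operator_def)
  obtain k M where M: "0 \<le> M" "\<And>x. p n (poly_operator P T x) \<le> M * p k x"
    using bP unfolding bounded_operator_def by blast
  obtain m where m: "p k ((T ^^ m) u - x) < e / 2 / (M + 1)"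
    using u e M(1) unfolding dense_orbit_def by (metis add_nonneg_pos divide_pos_pos half_gt_zero zero_less_one)
  have "p n (poly_operator P T ((T ^^ m) u - x)) \<le> (M + 1) * p k ((T ^^ m) u - x)"
    using M(2)[of "(T ^^ m) u - x"] by (simp add: distrib_right add_increasing2)
  also have "\<dots> < e / 2" using m M(1) by (simp add: field_simps)
  finally have "p n ((T ^^ m) (poly_operator P T u) - poly_operator P T x) < e / 2"
    using T by (simp add: bounded_operator_def poly_operator_commute op.linear_diff[OF linP])
  then show "\<exists>m. p n ((T ^^ m) (poly_operator P T u) - y) < e"
    using x p_triangle[of n "(T ^^ m) (poly_operator P T u)" y "poly_operator P T x"]
    by (intro exI[of _ m]) linarith
qed

lemma dense_orbit_funpowD:
  assumes "dense_orbit T ((T ^^ j) x)"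
  shows "dense_orbit T x"
  using assms unfolding dense_orbit_def by (metis comp_apply funpow_add)

end

section \<open>Biorthogonal Hamel bases adapted to the seminorms\<close>

context graded_seminorms begin

text \<open>An entry consists of a vector, its functional, its level and the bound of the
  functional. Lists suit Gram-Schmidt, which only ever appends.\<close>

definition biorthogonal :: "('a \<times> ('a \<Rightarrow> 'k) \<times> nat \<times> real) list \<Rightarrow> bool"
  where "biorthogonal xs \<longleftrightarrow> (\<forall>i<length xs. case xs ! i of (e, f, lev, C) \<Rightarrow>
    Vector_Spaces.linear scl (*) f \<and> 0 < C \<and> (\<forall>x. norm (f x) \<le> C * p lev x) \<and>
    (\<forall>n<lev. p n e = 0) \<and> (\<forall>j<length xs. f (fst (xs ! j)) = (if j = i then 1 else 0)))"

text \<open>For a biorthogonal list this is the projection onto the common kernel of the functionals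
  along the span of the vectors.\<close>

definition residual :: "('a \<times> ('a \<Rightarrow> 'k) \<times> nat \<times> real) list \<Rightarrow> 'a \<Rightarrow> 'a"
  where "residual xs x = x - (\<Sum>i<length xs. scl (fst (snd (xs ! i)) x) (fst (xs ! i)))"

lemma biorthogonalD:
  assumes "biorthogonal xs" "i < length xs"
  shows "Vector_Spaces.linear scl (*) (fst (snd (xs ! i)))" "0 < snd (snd (snd (xs ! i)))"
    "norm (fst (snd (xs ! i)) x) \<le> snd (snd (snd (xs ! i))) * p (fst (snd (snd (xs ! i)))) x"
    "n < fst (snd (snd (xs ! i))) \<Longrightarrow> p n (fst (xs ! i)) = 0"
    "j < length xs \<Longrightarrow> fst (snd (xs ! i)) (fst (xs ! j)) = (if j = i then 1 else 0)"
  using assms(1)[unfolded biorthogonal_def, THEN spec, THEN mp, OF assms(2)]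
  by (simp_all add: case_prod_beta)

lemma linear_residual:
  assumes "biorthogonal xs"
  shows "Vector_Spaces.linear scl scl (residual xs)"
  unfolding residual_def [abs_def]
  by (intro op.linear_compose_sub op.linear_compose_sum ballI linear_ident)
    (auto simp: Vector_Spaces.linear_iff functional.linear_add[OF biorthogonalD(1)[OF assms]]
      functional.linear_scale[OF biorthogonalD(1)[OF assms]] scale_left_distrib vector_space_axioms)

lemma functional_residual:
  assumes "biorthogonal xs" "i < length xs"
  shows "fst (snd (xs ! i)) (residual xs x) = 0"
proof -
  note lin = biorthogonalD(1)[OF assms]
  have "fst (snd (xs ! i)) (residual xs x)
      = fst (snd (xs ! i)) x - (\<Sum>j<length xs. fst (snd (xs ! j)) x * fst (snd (xs ! i)) (fst (xs ! j)))"
    by (simp add: residual_def functional.linear_diff[OF lin] functional.linear_sum[OF lin]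
        functional.linear_scale[OF lin])
  also have "(\<Sum>j<length xs. fst (snd (xs ! j)) x * fst (snd (xs ! i)) (fst (xs ! j)))
      = (\<Sum>j<length xs. fst (snd (xs ! j)) x * (if j = i then 1 else 0))"
    using biorthogonalD(5)[OF assms] by (intro sum.cong) auto
  finally show ?thesis using assms(2) by (simp add: if_distrib sum.delta cong: if_cong)
qed

lemma residual_fst:
  assumes "biorthogonal xs" "j < length xs"
  shows "residual xs (fst (xs ! j)) = 0"
proof -
  have "(\<Sum>i<length xs. scl (fst (snd (xs ! i)) (fst (xs ! j))) (fst (xs ! i)))
      = (\<Sum>i<length xs. if i = j then fst (xs ! i) else 0)"
    using biorthogonalD(5)[OF assms(1) _ assms(2)] by (intro sum.cong) auto
  then show ?thesis using assms(2) by (simp add: residual_def sum.delta)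
qed

lemma diff_residual_in_span: "x - residual xs x \<in> span (fst ` set xs)"
  unfolding residual_def by (auto intro!: span_sum span_scale intro: span_base)

lemma p_residual_le:
  "p n (residual xs x) \<le> p n x + (\<Sum>i<length xs. norm (fst (snd (xs ! i)) x) * p n (fst (xs ! i)))"
  unfolding residual_def
  by (rule order_trans[OF p_diff add_left_mono[OF order_trans[OF p_sum]]]) simp

text \<open>The new vector \<open>e\<close> is the residual of \<open>a\<close>, and its level
  \<open>n\<close> is the first seminorm that does not vanish at it. The functional is dominated by
  \<open>q\<close>, that is \<open>p n\<close> after \<open>residual\<close>, so it kills the
  earlier vectors. It is bounded by \<open>p n\<close> because an earlier vector of level above
  \<open>n\<close> is invisible to \<open>p n\<close>, and every other one has a functional bounded
  by \<open>p n\<close>.\<close>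

lemma biorthogonal_snoc:
  assumes xs: "biorthogonal xs" and a: "a \<notin> span (fst ` set xs)"
  shows "\<exists>t. biorthogonal (xs @ [t]) \<and> span (fst ` set (xs @ [t])) = span (insert a (fst ` set xs))"
proof -
  define e where "e = residual xs a"
  have e0: "e \<noteq> 0"
    using a diff_residual_in_span[of a xs] by (auto simp: e_def)
  define n where "n = (LEAST n. p n e \<noteq> 0)"
  have ex: "\<exists>n. p n e \<noteq> 0" using e0 p_separating by blast
  have pn: "p n e \<noteq> 0" unfolding n_def using ex by (rule LeastI_ex)
  have pn0: "p m e = 0" if "m < n" for m
    using not_less_Least that unfolding n_def by blast
  define K where "K = 1 + (\<Sum>i<length xs. snd (snd (snd (xs ! i))) * p n (fst (xs ! i)))"
  have K: "1 \<le> K" using biorthogonalD(2)[OF xs] unfolding K_def by (auto intro!: sum_nonneg simp: less_imp_le)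
  define q where "q x = p n (residual xs x)" for x
  note lin = linear_residual[OF xs]
  have q: "seminorm scl q"
    using seminorm_p[of n] by (simp add: seminorm_def q_def op.linear_add[OF lin] op.linear_scale[OF lin])
  have res_e: "residual xs e = e"
    using functional_residual[OF xs] by (simp add: residual_def e_def)
  have q_e: "0 < q e" using pn p_nonneg[of n e] by (simp add: q_def res_e less_le)
  have q_le: "q x \<le> K * p n x" for x
  proof -
    have "norm (fst (snd (xs ! i)) x) * p n (fst (xs ! i))
        \<le> snd (snd (snd (xs ! i))) * p n (fst (xs ! i)) * p n x" if i: "i < length xs" for i
    proof (cases "n < fst (snd (snd (xs ! i)))")
      case True
      then show ?thesis using biorthogonalD(4)[OF xs i] by simp
    next
      case False
      have "norm (fst (snd (xs ! i)) x) \<le> snd (snd (snd (xs ! i))) * p (fst (snd (snd (xs ! i)))) x"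
        by (rule biorthogonalD(3)[OF xs i])
      also have "\<dots> \<le> snd (snd (snd (xs ! i))) * p n x"
        using False biorthogonalD(2)[OF xs i] by (intro mult_left_mono p_mono) auto
      finally have "norm (fst (snd (xs ! i)) x) * p n (fst (xs ! i))
          \<le> snd (snd (snd (xs ! i))) * p n x * p n (fst (xs ! i))"
        by (rule mult_right_mono) simp
      then show ?thesis by (simp add: mult_ac)
    qed
    then have "(\<Sum>i<length xs. norm (fst (snd (xs ! i)) x) * p n (fst (xs ! i)))
        \<le> (\<Sum>i<length xs. snd (snd (snd (xs ! i))) * p n (fst (xs ! i))) * p n x"
      unfolding sum_distrib_right by (intro sum_mono) simp
    then show ?thesis
      using p_residual_le[of n xs x] by (simp add: q_def K_def distrib_right)
  qed
  obtain f M where f: "Vector_Spaces.linear scl (*) f" "\<And>x. norm (f x) \<le> M * q x" "f e = 1"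
    using functional_exists[OF q q_e] by blast
  define C where "C = (\<bar>M\<bar> + 1) * K"
  have C: "0 < C" unfolding C_def using K by (intro mult_pos_pos) auto
  have f_le: "norm (f x) \<le> C * p n x" for x
  proof -
    have "M * q x \<le> (\<bar>M\<bar> + 1) * q x" by (intro mult_right_mono) (auto simp: q_def)
    also have "\<dots> \<le> (\<bar>M\<bar> + 1) * (K * p n x)" by (intro mult_left_mono q_le) auto
    finally show ?thesis using f(2)[of x] by (simp add: C_def mult.assoc)
  qed
  have f_0: "f (fst (xs ! j)) = 0" if "j < length xs" for j
    using f(2)[of "fst (xs ! j)"] residual_fst[OF xs that] by (simp add: q_def)
  have f_e: "fst (snd (xs ! j)) e = 0" if "j < length xs" for j
    unfolding e_def by (rule functional_residual[OF xs that])
  define t where "t = (e, f, n, C)"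
  have "biorthogonal (xs @ [t])"
    unfolding biorthogonal_def
  proof (intro allI impI)
    fix i assume i: "i < length (xs @ [t])"
    show "case (xs @ [t]) ! i of (e, f, lev, C) \<Rightarrow>
      Vector_Spaces.linear scl (*) f \<and> 0 < C \<and> (\<forall>x. norm (f x) \<le> C * p lev x) \<and>
      (\<forall>n<lev. p n e = 0) \<and> (\<forall>j<length (xs @ [t]). f (fst ((xs @ [t]) ! j)) = (if j = i then 1 else 0))"
    proof (cases "i < length xs")
      case True
      then show ?thesis using biorthogonalD[OF xs True] f_e[OF True]
        by (auto simp: case_prod_beta nth_append t_def less_Suc_eq)
    next
      case False
      then have "i = length xs" using i by simp
      then show ?thesis using f C f_le f_0 pn0 by (auto simp: nth_append t_def)
    qed
  qed
  moreover have "span (fst ` set (xs @ [t])) = span (insert a (fst ` set xs))"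
  proof -
    have d: "a - e \<in> span (fst ` set xs)" unfolding e_def by (rule diff_residual_in_span)
    have "span (insert e (fst ` set xs)) = span (insert a (fst ` set xs))"
      using d span_neg[OF d] by (intro eq_span_insert_eq) simp_all
    then show ?thesis by (simp add: t_def)
  qed
  ultimately show ?thesis by blast
qed

lemma finite_biorthogonal:
  assumes "finite B"
  shows "\<exists>xs. biorthogonal xs \<and> span (fst ` set xs) = span B"
  using assms
proof (induction B)
  case empty
  show ?case by (rule exI[of _ "[]"]) (simp add: biorthogonal_def)
next
  case (insert b B)
  then obtain xs where xs: "biorthogonal xs" "span (fst ` set xs) = span B" by blast
  have eq: "span (insert b (fst ` set xs)) = span (insert b B)"
    using xs(2) by (simp add: span_insert)
  show ?case
  proof (cases "b \<in> span (fst ` set xs)")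
    case True
    then show ?thesis using xs(1) eq span_redundant by metis
  next
    case False
    then show ?thesis using biorthogonal_snoc[OF xs(1)] eq by metis
  qed
qed

text \<open>A finite-dimensional subspace is closed: \<open>residual\<close> is continuous and
  vanishes on it, hence vanishes everywhere if it is dense. The whole space would then be
  finite-dimensional, against \<open>D\<close>.\<close>

lemma dense_span_infinite:
  assumes dense: "\<And>x n e. 0 < e \<Longrightarrow> \<exists>y\<in>span B. p n (x - y) < e"
    and inf: "infinite D" "independent D"
  shows "infinite B"
proof
  assume "finite B"
  then obtain xs where xs: "biorthogonal xs" "span (fst ` set xs) = span B"
    using finite_biorthogonal by blast
  note lin = linear_residual[OF xs(1)]
  have res0: "residual xs y = 0" if "y \<in> span B" for y
  proof (rule op.linear_eq_0_on_span[OF lin])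
    show "residual xs z = 0" if "z \<in> fst ` set xs" for z
    proof -
      from that obtain t where t: "z = fst t" "t \<in> set xs" by (rule imageE)
      from t(2) obtain i where "i < length xs" "xs ! i = t" unfolding in_set_conv_nth by (elim exE conjE)
      with t(1) have "i < length xs" "z = fst (xs ! i)" by simp_all
      then show ?thesis using residual_fst[OF xs(1)] by simp
    qed
  qed (use that xs(2) in simp)
  have "residual xs x = 0" for x
  proof (rule p_separating)
    fix n
    define L where "L = Max (insert n ((\<lambda>i. fst (snd (snd (xs ! i)))) ` {..<length xs}))"
    define K where "K = 1 + (\<Sum>i<length xs. snd (snd (snd (xs ! i))) * p n (fst (xs ! i)))"
    have K: "1 \<le> K"
      using biorthogonalD(2)[OF xs(1)] unfolding K_def by (auto intro!: sum_nonneg simp: less_imp_le)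
    have le: "p n (residual xs y) \<le> K * p L y" for y
    proof -
      have "norm (fst (snd (xs ! i)) y) * p n (fst (xs ! i))
          \<le> snd (snd (snd (xs ! i))) * p n (fst (xs ! i)) * p L y" if i: "i < length xs" for i
      proof -
        have "fst (snd (snd (xs ! i))) \<le> L" unfolding L_def using i by (intro Max_ge) auto
        then have "norm (fst (snd (xs ! i)) y) \<le> snd (snd (snd (xs ! i))) * p L y"
          using biorthogonalD(2,3)[OF xs(1) i] by (meson less_imp_le mult_left_mono order_trans p_mono)
        then have "norm (fst (snd (xs ! i)) y) * p n (fst (xs ! i))
            \<le> snd (snd (snd (xs ! i))) * p L y * p n (fst (xs ! i))"
          by (rule mult_right_mono) simp
        then show ?thesis by (simp add: mult_ac)
      qed
      then have "(\<Sum>i<length xs. norm (fst (snd (xs ! i)) y) * p n (fst (xs ! i)))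
          \<le> (\<Sum>i<length xs. snd (snd (snd (xs ! i))) * p n (fst (xs ! i))) * p L y"
        unfolding sum_distrib_right by (intro sum_mono) simp
      moreover have "p n y \<le> p L y" unfolding L_def by (intro p_mono Max_ge) auto
      ultimately show ?thesis
        using p_residual_le[of n xs y] by (simp add: K_def distrib_right)
    qed
    have "p n (residual xs x) \<le> d" if d: "0 < d" for d
    proof -
      obtain y where y: "y \<in> span B" "p L (x - y) < d / K"
        using dense[of "d / K" L x] d K by auto
      have "residual xs x = residual xs (x - y)"
        using res0[OF y(1)] by (simp add: op.linear_diff[OF lin])
      then have "p n (residual xs x) \<le> K * p L (x - y)" using le[of "x - y"] by simp
      also have "\<dots> \<le> d" using y(2) K by (simp add: field_simps)
      finally show ?thesis .
    qed
    then have "p n (residual xs x) \<le> 0" by (rule field_le_epsilon[of _ 0, simplified])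
    then show "p n (residual xs x) = 0" using p_nonneg[of n "residual xs x"] by linarith
  qed
  then have "x \<in> span (fst ` set xs)" for x
    using diff_residual_in_span[of x xs] by simp
  then have "D \<subseteq> span (fst ` set xs)" by blast
  then show False
    using independent_span_bound[of "fst ` set xs" D] inf by simp
qed

end

locale graded_basis = graded_seminorms scl p emb
  for scl :: "'k::real_normed_field \<Rightarrow> 'a::ab_group_add \<Rightarrow> 'a" and p emb +
  fixes e :: "nat \<Rightarrow> 'a" and f :: "nat \<Rightarrow> 'a \<Rightarrow> 'k" and lev :: "nat \<Rightarrow> nat" and C :: "nat \<Rightarrow> real"
  assumes linear_f: "Vector_Spaces.linear scl (*) (f k)"
    and f_e: "f k (e j) = (if j = k then 1 else 0)"
    and C_pos: "0 < C k"
    and f_bound: "norm (f k x) \<le> C k * p (lev k) x"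
    and p_e: "n < lev k \<Longrightarrow> p n (e k) = 0"
    and dense_span: "0 < d \<Longrightarrow> \<exists>y\<in>span (range e). p n (x - y) < d"

lemma (in graded_seminorms) ex_graded_basis:
  assumes B: "countable B" "independent B"
    and dense: "\<And>x n d. 0 < d \<Longrightarrow> \<exists>y\<in>span B. p n (x - y) < d"
    and inf: "infinite D" "independent D"
  obtains e f lev C where "graded_basis scl p emb e f lev C" "span (range e) = span B"
proof -
  define a where "a = from_nat_into B"
  have bij: "bij_betw a UNIV B"
    unfolding a_def by (rule bij_betw_from_nat_into[OF B(1) dense_span_infinite[OF dense inf]])
  then have inj: "inj a" and ran: "range a = B" by (auto simp: bij_betw_def)
  have a_new: "a N \<notin> span (a ` {..<N})" for N
  proof
    assume "a N \<in> span (a ` {..<N})"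
    moreover have "a ` {..<N} \<subseteq> B - {a N}" using inj ran by (auto simp: inj_def)
    ultimately have "a N \<in> span (B - {a N})" using span_mono by blast
    then show False using B(2) ran unfolding dependent_def by blast
  qed
  define ok where "ok N xs \<longleftrightarrow> biorthogonal xs \<and> length xs = N \<and> span (fst ` set xs) = span (a ` {..<N})"
    for N xs
  have "\<exists>X. \<forall>N. ok N (X N) \<and> (\<exists>t. X (Suc N) = X N @ [t])"
  proof (rule dependent_nat_choice)
    show "\<exists>xs. ok 0 xs" by (rule exI[of _ "[]"]) (simp add: ok_def biorthogonal_def)
    fix xs N assume "ok N xs"
    then have xs: "biorthogonal xs" "length xs = N" "span (fst ` set xs) = span (a ` {..<N})"
      by (auto simp: ok_def)
    then obtain t where t: "biorthogonal (xs @ [t])"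
      "span (fst ` set (xs @ [t])) = span (insert (a N) (fst ` set xs))"
      using biorthogonal_snoc a_new by metis
    have "span (insert (a N) (fst ` set xs)) = span (a ` {..<Suc N})"
      using xs(3) by (simp add: lessThan_Suc span_insert)
    then have "ok (Suc N) (xs @ [t])"
      using t xs(2) by (simp add: ok_def)
    then show "\<exists>ys. ok (Suc N) ys \<and> (\<exists>t. ys = xs @ [t])" by blast
  qed
  then obtain X where X: "\<And>N. ok N (X N)" "\<And>N. \<exists>t. X (Suc N) = X N @ [t]" by blast
  have bi: "biorthogonal (X N)" and len: "length (X N) = N"
    and sp: "span (fst ` set (X N)) = span (a ` {..<N})" for N
    using X(1)[of N] by (auto simp: ok_def)
  \<comment> \<open>The lists only grow, so entry \<open>k\<close> is the same in all of them once
    it is present.\<close>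
  define x where "x k = X (Suc k) ! k" for k
  have nth: "X N ! k = x k" if "k < N" for N k
    using that
  proof (induction N)
    case (Suc N)
    obtain t where "X (Suc N) = X N @ [t]" using X(2) by blast
    then show ?case using Suc len[of N] by (cases "k = N") (auto simp: nth_append x_def)
  qed simp
  define e f lev C where "e k = fst (x k)" and "f k = fst (snd (x k))"
    and "lev k = fst (snd (snd (x k)))" and "C k = snd (snd (snd (x k)))" for k
  have set_X: "fst ` set (X N) = e ` {..<N}" for N
  proof -
    have "X N = map x [0..<N]" by (rule nth_equalityI) (simp_all add: len nth)
    then show ?thesis by (simp add: image_image e_def atLeast0LessThan)
  qed
  have span_e: "span (range e) = span B"
  proof (rule antisym)
    have "e k \<in> span B" for k
    proof -
      have "e k \<in> fst ` set (X (Suc k))" unfolding set_X by simp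
      then have "e k \<in> span (a ` {..<Suc k})" unfolding sp[symmetric] by (rule span_base)
      then show ?thesis using span_mono[of "a ` {..<Suc k}" B] ran by blast
    qed
    then show "span (range e) \<subseteq> span B" by (intro span_minimal) auto
    have "a k \<in> span (range e)" for k
    proof -
      have "a k \<in> span (a ` {..<Suc k})" by (rule span_base) simp
      then have "a k \<in> span (e ` {..<Suc k})" using sp[of "Suc k"] by (simp only: set_X)
      then show ?thesis using span_mono[of "e ` {..<Suc k}" "range e"] by blast
    qed
    then show "span B \<subseteq> span (range e)" unfolding ran[symmetric] by (intro span_minimal) auto
  qed
  have "graded_basis scl p emb e f lev C"
  proof (intro graded_basis.intro graded_basis_axioms.intro graded_seminorms_axioms)
    fix k
    have k: "k < length (X (Suc k))" by (simp add: len)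
    note D = biorthogonalD[OF bi k, folded x_def]
    show "Vector_Spaces.linear scl (*) (f k)" "0 < C k"
      using D(1,2) by (simp_all add: f_def C_def)
    show "norm (f k x) \<le> C k * p (lev k) x" for x
      using D(3) by (simp add: f_def C_def lev_def)
    show "p n (e k) = 0" if "n < lev k" for n
      using D(4) that by (simp add: lev_def e_def)
    fix j
    define N where "N = Suc (max j k)"
    have jk: "j < length (X N)" "k < length (X N)" "j < N" "k < N" by (simp_all add: len N_def)
    show "f k (e j) = (if j = k then 1 else 0)"
      using biorthogonalD(5)[OF bi jk(2,1)] by (simp add: nth jk f_def e_def)
  next
    show "\<exists>y\<in>span (range e). p n (x - y) < d" if "0 < d" for d n x
      using dense[OF that] by (simp add: span_e)
  qed
  then show thesis using span_e by (rule that)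
qed

section \<open>Limits of finite stages\<close>

context graded_seminorms begin

definition converges :: "(nat \<Rightarrow> 'a) \<Rightarrow> 'a \<Rightarrow> bool"
  where "converges y x \<longleftrightarrow> (\<forall>n. (\<lambda>i. p n (y i - x)) \<longlonglongrightarrow> 0)"

lemma converges_const: "converges (\<lambda>i. x) x"
  by (simp add: converges_def)

lemma converges_add:
  assumes "converges y x" "converges y' x'"
  shows "converges (\<lambda>i. y i + y' i) (x + x')"
  unfolding converges_def
proof
  fix n
  have "(\<lambda>i. p n (y i - x) + p n (y' i - x')) \<longlonglongrightarrow> 0"
    using tendsto_add[of "\<lambda>i. p n (y i - x)" 0 _ "\<lambda>i. p n (y' i - x')" 0] assms
    by (simp add: converges_def)
  then show "(\<lambda>i. p n (y i + y' i - (x + x'))) \<longlonglongrightarrow> 0"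
  proof (rule Lim_null_comparison[rotated], intro always_eventually allI)
    fix i
    show "norm (p n (y i + y' i - (x + x'))) \<le> p n (y i - x) + p n (y' i - x')"
      using p_add[of n "y i - x" "y' i - x'"] by (simp add: algebra_simps)
  qed
qed

lemma converges_scale:
  assumes "converges y x"
  shows "converges (\<lambda>i. scl c (y i)) (scl c x)"
  unfolding converges_def
proof
  fix n
  have "(\<lambda>i. norm c * p n (y i - x)) \<longlonglongrightarrow> norm c * 0"
    using assms by (intro tendsto_intros) (simp add: converges_def)
  then show "(\<lambda>i. p n (scl c (y i) - scl c x)) \<longlonglongrightarrow> 0"
    by (simp flip: scale_right_diff_distrib)
qed

lemma converges_p:
  assumes "converges y x"
  shows "(\<lambda>i. p n (y i)) \<longlonglongrightarrow> p n x"
proof (rule LIM_zero_cancel, rule Lim_null_comparison)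
  show "\<forall>\<^sub>F i in sequentially. norm (p n (y i) - p n x) \<le> p n (y i - x)"
  proof (intro always_eventually allI)
    fix i
    show "norm (p n (y i) - p n x) \<le> p n (y i - x)"
      using p_add[of n "y i - x" x] p_add[of n "x - y i" "y i"] p_minus_commute[of n x "y i"]
      by (simp add: abs_le_iff)
  qed
  show "(\<lambda>i. p n (y i - x)) \<longlonglongrightarrow> 0" using assms by (simp add: converges_def)
qed

lemma converges_unique:
  assumes "converges y x" "converges y x'"
  shows "x = x'"
proof -
  have "p n (x - x') = 0" for n
  proof (rule LIMSEQ_unique)
    show "(\<lambda>i. p n ((y i - x') + scl (- 1) (y i - x))) \<longlonglongrightarrow> 0"
    proof (rule Lim_null_comparison, intro always_eventually allI)
      show "norm (p n ((y i - x') + scl (- 1) (y i - x))) \<le> p n (y i - x') + p n (y i - x)" for i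
        using p_add[of n "y i - x'" "scl (- 1) (y i - x)"] by (simp del: scale_minus_left)
      show "(\<lambda>i. p n (y i - x') + p n (y i - x)) \<longlonglongrightarrow> 0"
        using tendsto_add[of "\<lambda>i. p n (y i - x')" 0 _ "\<lambda>i. p n (y i - x)" 0] assms
        by (simp add: converges_def)
    qed
    show "(\<lambda>i. p n ((y i - x') + scl (- 1) (y i - x))) \<longlonglongrightarrow> p n (x - x')"
      by simp
  qed
  then have "x - x' = 0" by (rule p_separating)
  then show ?thesis by simp
qed

text \<open>Extension by density and completeness. \<open>T\<close> is linear everywhere only
  because a linear map is prescribed on a basis; its values off \<open>E\<close> are
  discarded.\<close>

lemma bounded_extension:
  assumes E: "subspace E" and dense: "\<And>x n d. 0 < d \<Longrightarrow> \<exists>y\<in>E. p n (x - y) < d"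
    and T: "Vector_Spaces.linear scl scl T"
    and bd: "\<And>n. \<exists>m M. 0 \<le> M \<and> (\<forall>x\<in>E. p n (T x) \<le> M * p m x)"
  shows "\<exists>T'. bounded_operator T' \<and> (\<forall>x\<in>E. T' x = T x)"
proof -
  have approx: "\<exists>y. (\<forall>i. y i \<in> E) \<and> converges y x" for x
  proof -
    have "\<forall>i. \<exists>y. y \<in> E \<and> p i (x - y) < 1 / real (Suc i)"
      using dense by (metis of_nat_0_less_iff zero_less_Suc zero_less_divide_1_iff)
    then obtain y where y: "\<And>i. y i \<in> E" "\<And>i. p i (x - y i) < 1 / real (Suc i)" by metis
    have "converges y x" unfolding converges_def
    proof
      fix n
      show "(\<lambda>i. p n (y i - x)) \<longlonglongrightarrow> 0"
      proof (rule Lim_null_comparison)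
        show "\<forall>\<^sub>F i in sequentially. norm (p n (y i - x)) \<le> 1 / real (Suc i)"
        proof (rule eventually_sequentiallyI)
          fix i assume "n \<le> i"
          then show "norm (p n (y i - x)) \<le> 1 / real (Suc i)"
            using p_mono[of n i "y i - x"] y(2)[of i] by (simp add: p_minus_commute[of _ x])
        qed
        show "(\<lambda>i. 1 / real (Suc i)) \<longlonglongrightarrow> 0" by (rule LIMSEQ_Suc[OF lim_1_over_n])
      qed
    qed
    then show ?thesis using y(1) by blast
  qed
  have T0: "converges (\<lambda>i. T (y i)) 0" if y: "\<And>i. y i \<in> E" "converges y 0" for y
    unfolding converges_def
  proof
    fix n
    obtain m M where M: "0 \<le> M" "\<And>x. x \<in> E \<Longrightarrow> p n (T x) \<le> M * p m x"
      using bd by blast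
    have "(\<lambda>i. M * p m (y i)) \<longlonglongrightarrow> M * 0"
      using converges_p[OF y(2), of m] by (intro tendsto_intros) simp
    then show "(\<lambda>i. p n (T (y i) - 0)) \<longlonglongrightarrow> 0"
      by (intro Lim_null_comparison[of "\<lambda>i. p n (T (y i) - 0)" "\<lambda>i. M * p m (y i)"] always_eventually allI)
        (simp_all add: M(2) y(1))
  qed
  \<comment> \<open>One limit for all sequences approaching \<open>x\<close>: this makes the
    extension well defined and lets sums and multiples be computed with any approximating
    sequences.\<close>
  have "\<exists>L. \<forall>y. (\<forall>i. y i \<in> E) \<and> converges y x \<longrightarrow> converges (\<lambda>i. T (y i)) L" for x
  proof -
    obtain y where y: "\<And>i. y i \<in> E" "converges y x" using approx by blast
    have "\<exists>N. \<forall>i\<ge>N. \<forall>j\<ge>N. p n (T (y i) - T (y j)) < d" if d: "0 < d" for n d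
    proof -
      obtain m M where M: "0 \<le> M" "\<And>x. x \<in> E \<Longrightarrow> p n (T x) \<le> M * p m x"
        using bd by blast
      have "0 < d / (M + 1) / 2" using d M(1) by simp
      then obtain N where N: "\<And>i. N \<le> i \<Longrightarrow> p m (y i - x) < d / (M + 1) / 2"
        using y(2) unfolding converges_def lim_sequentially by (simp add: dist_real_def) meson
      have "p n (T (y i) - T (y j)) < d" if "N \<le> i" "N \<le> j" for i j
      proof -
        have "p n (T (y i) - T (y j)) \<le> M * p m (y i - y j)"
          using M(2)[OF subspace_diff[OF E y(1) y(1)], of i j] by (simp add: op.linear_diff[OF T])
        also have "\<dots> \<le> (M + 1) * p m (y i - y j)" by (intro mult_right_mono) auto
        also have "p m (y i - y j) < d / (M + 1)"
        proof -
          have "p m (y i - y j) \<le> p m (y i - x) + p m (y j - x)"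
            using p_triangle[of m "y i" "y j" x] by (simp add: p_minus_commute[of m x])
          also have "\<dots> < d / (M + 1) / 2 + d / (M + 1) / 2"
            using N that by (intro add_strict_mono) auto
          also have "\<dots> = d / (M + 1)" by (rule field_sum_of_halves)
          finally show ?thesis .
        qed
        then have "(M + 1) * p m (y i - y j) < d" using M(1) by (simp add: field_simps)
        finally show ?thesis .
      qed
      then show ?thesis by blast
    qed
    then obtain L where L: "\<forall>n. (\<lambda>i. p n (T (y i) - L)) \<longlonglongrightarrow> 0"
      using p_complete[of "\<lambda>i. T (y i)"] by blast
    have "converges (\<lambda>i. T (w i)) L" if w: "\<And>i. w i \<in> E" "converges w x" for w
    proof -
      have "converges (\<lambda>i. w i + scl (- 1) (y i)) (x + scl (- 1) x)"
        by (intro converges_add converges_scale w y)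
      then have "converges (\<lambda>i. w i - y i) 0" by simp
      then have "converges (\<lambda>i. T (w i - y i)) 0"
        by (intro T0 subspace_diff E w y)
      then have "converges (\<lambda>i. T (w i - y i) + T (y i)) (0 + L)"
        using L by (intro converges_add) (simp_all add: converges_def)
      then show ?thesis by (simp add: op.linear_diff[OF T])
    qed
    then show ?thesis by blast
  qed
  then obtain T' where T': "\<And>x y. (\<And>i. y i \<in> E) \<Longrightarrow> converges y x \<Longrightarrow> converges (\<lambda>i. T (y i)) (T' x)"
    by metis
  have eq: "T' x = T x" if "x \<in> E" for x
    using converges_unique T'[of "\<lambda>i. x" x] that converges_const by blast
  have "bounded_operator T'" unfolding bounded_operator_def
  proof (intro conjI allI)
    have "T' (x + x') = T' x + T' x'" for x x'
    proof -
      obtain y y' where y: "\<And>i. y i \<in> E" "converges y x" "\<And>i. y' i \<in> E" "converges y' x'"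
        using approx by metis
      have "converges (\<lambda>i. T (y i + y' i)) (T' (x + x'))"
        by (intro T' converges_add y subspace_add E)
      moreover have "converges (\<lambda>i. T (y i) + T (y' i)) (T' x + T' x')"
        by (intro T' converges_add y)
      ultimately show ?thesis by (simp add: op.linear_add[OF T] converges_unique)
    qed
    moreover have "T' (scl c x) = scl c (T' x)" for c x
    proof -
      obtain y where y: "\<And>i. y i \<in> E" "converges y x" using approx by metis
      have "converges (\<lambda>i. T (scl c (y i))) (T' (scl c x))"
        by (intro T' converges_scale y subspace_scale E)
      moreover have "converges (\<lambda>i. scl c (T (y i))) (scl c (T' x))"
        by (intro T' converges_scale y)
      ultimately show ?thesis by (simp add: op.linear_scale[OF T] converges_unique)
    qed
    ultimately show "Vector_Spaces.linear scl scl T'"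
      by (simp add: Vector_Spaces.linear_iff vector_space_axioms)
    fix n
    obtain m M where M: "0 \<le> M" "\<And>x. x \<in> E \<Longrightarrow> p n (T x) \<le> M * p m x"
      using bd by blast
    have "p n (T' x) \<le> M * p m x" for x
    proof -
      obtain y where y: "\<And>i. y i \<in> E" "converges y x" using approx by metis
      show ?thesis
      proof (rule LIMSEQ_le)
        show "(\<lambda>i. p n (T (y i))) \<longlonglongrightarrow> p n (T' x)" by (intro converges_p T' y)
        show "(\<lambda>i. M * p m (y i)) \<longlonglongrightarrow> M * p m x" by (intro tendsto_intros converges_p y)
        show "\<exists>N. \<forall>i\<ge>N. p n (T (y i)) \<le> M * p m (y i)" using M(2) y(1) by blast
      qed
    qed
    then show "\<exists>m M. 0 \<le> M \<and> (\<forall>x. p n (T' x) \<le> M * p m x)" using M(1) by blast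
  qed
  then show ?thesis using eq by blast
qed

end

section \<open>Operators given by their columns\<close>

context graded_basis begin

abbreviation E :: "'a set" where "E \<equiv> span (range e)"

lemmas f_add = functional.linear_add[OF linear_f]
  and f_scale = functional.linear_scale[OF linear_f]
  and f_sum = functional.linear_sum[OF linear_f]
  and f_0 [simp] = functional.linear_0[OF linear_f]

lemma e_in_E [simp]: "e k \<in> E"
  by (rule span_base) simp

lemma inj_e: "inj e"
proof (rule injI)
  fix j k assume "e j = e k"
  then have "f k (e j) = f k (e k)" by simp
  then show "j = k" by (simp add: f_e split: if_splits)
qed

lemma independent_e: "independent (range e)"
  unfolding dependent_def
proof
  assume "\<exists>a\<in>range e. a \<in> span (range e - {a})"
  then obtain k where k: "e k \<in> span (range e - {e k})" by blast
  have "f k (e k) = 0"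
    by (rule functional.linear_eq_0_on_span[OF linear_f _ k]) (auto simp: f_e)
  then show False by (simp add: f_e)
qed

lemma span_e_expand:
  assumes "x \<in> span (e ` {..<N})"
  shows "x = (\<Sum>k<N. scl (f k x) (e k))"
  using assms
proof (induction rule: span_induct_alt)
  case base
  then show ?case by simp
next
  case (step c y z)
  then obtain j where j: "j < N" "y = e j" by blast
  have "scl c y = (\<Sum>k<N. if k = j then scl c (e k) else 0)"
    using j by (simp add: sum.delta)
  also have "\<dots> = (\<Sum>k<N. scl (c * f k (e j)) (e k))"
    by (intro sum.cong) (auto simp: f_e)
  finally have "scl c y + z = (\<Sum>k<N. scl (c * f k (e j)) (e k) + scl (f k z) (e k))"
    using step(2) by (simp add: sum.distrib)
  also have "\<dots> = (\<Sum>k<N. scl (f k (scl c y + z)) (e k))"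
    by (simp add: j(2) f_add f_scale scale_left_distrib)
  finally show ?case .
qed

lemma E_finite:
  assumes "x \<in> E"
  obtains N where "x \<in> span (e ` {..<N})"
  using assms
proof (induction arbitrary: thesis rule: span_induct_alt)
  case base
  then show ?case using span_zero by blast
next
  case (step c y z)
  obtain N where N: "z \<in> span (e ` {..<N})" using step.IH by blast
  obtain j where j: "y = e j" using step(1) by blast
  have "z \<in> span (e ` {..<max N (Suc j)})"
    using N by (meson image_mono lessThan_subset_iff max.cobounded1 span_mono subsetD)
  moreover have "y \<in> span (e ` {..<max N (Suc j)})" unfolding j by (rule span_base) simp
  ultimately show ?case by (intro step.prems[of "max N (Suc j)"] span_add span_scale)
qed

lemma E_eq_0I:
  assumes "x \<in> E" "\<And>k. f k x = 0"
  shows "x = 0"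
proof -
  obtain N where "x \<in> span (e ` {..<N})" using E_finite assms(1) by blast
  then show ?thesis using span_e_expand[of x N] assms(2) by simp
qed

lemma ex_linear_on_family:
  assumes "inj h" "independent (range h)"
  obtains A where "Vector_Spaces.linear scl scl A" "\<And>i. A (h i) = t i"
proof -
  obtain A where "Vector_Spaces.linear scl scl A" "\<forall>x\<in>range h. A x = t (inv h x)"
    using op.linear_independent_extend[OF assms(2), of "\<lambda>x. t (inv h x)"] by blast
  then show thesis using assms(1) by (intro that[of A]) auto
qed

lemma linear_maps_span:
  assumes T: "Vector_Spaces.linear scl scl T" and "x \<in> span B" and "\<And>b. b \<in> B \<Longrightarrow> T b \<in> span D"
  shows "T x \<in> span D"
  using assms(2)
proof (induction rule: span_induct_alt)
  case base
  then show ?case by (simp add: op.linear_0[OF T] span_zero)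
next
  case (step c y z)
  then show ?case using assms(3)
    by (simp add: op.linear_add[OF T] op.linear_scale[OF T] span_add span_scale)
qed

lemma linear_maps_E:
  "Vector_Spaces.linear scl scl T \<Longrightarrow> (\<And>k. T (e k) \<in> E) \<Longrightarrow> x \<in> E \<Longrightarrow> T x \<in> E"
  by (rule linear_maps_span) auto

text \<open>On \<open>E\<close> the operator \<open>T - c I\<close> is the sum of the rank one maps
  with functional \<open>f k\<close> and vector \<open>s k\<close>, and \<open>p n\<close> of the
  \<open>k\<close>-th term is at most \<open>C k * p n (s k) * p (lev k) x\<close>. Smallness makes
  the constants summable, and the level condition lets one seminorm replace all
  \<open>p (lev k)\<close> that occur.\<close>

lemma columns_bounded:
  fixes T :: "'a \<Rightarrow> 'a" and c :: 'k
  defines "s \<equiv> \<lambda>k. T (e k) - scl c (e k)"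
  assumes T: "Vector_Spaces.linear scl scl T"
    and levels: "\<And>n. \<exists>m. \<forall>k. p n (s k) \<noteq> 0 \<longrightarrow> lev k \<le> m"
    and small: "\<And>n. \<exists>k0. \<forall>k\<ge>k0. C k * p n (s k) \<le> (1/2) ^ k"
  shows "\<exists>m M. 0 \<le> M \<and> (\<forall>x\<in>E. p n (T x) \<le> M * p m x)"
proof -
  obtain m where m: "\<And>k. p n (s k) \<noteq> 0 \<Longrightarrow> lev k \<le> m" using levels by blast
  obtain k0 where k0: "\<And>k. k0 \<le> k \<Longrightarrow> C k * p n (s k) \<le> (1/2) ^ k" using small by blast
  define M where "M = norm c + ((\<Sum>k<k0. C k * p n (s k)) + 2)"
  have nn: "0 \<le> C k * p n (s k)" for k using C_pos[of k] by simp
  have sum_le: "(\<Sum>k<N. C k * p n (s k)) \<le> (\<Sum>k<k0. C k * p n (s k)) + 2" for N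
  proof -
    have "(\<Sum>k<N. C k * p n (s k)) \<le> (\<Sum>k<N. (if k < k0 then C k * p n (s k) else 0) + (1/2) ^ k)"
      using k0 nn by (intro sum_mono) auto
    also have "\<dots> = (\<Sum>k<N. if k < k0 then C k * p n (s k) else 0) + (\<Sum>k<N. (1/2) ^ k)"
      by (rule sum.distrib)
    also have "(\<Sum>k<N. if k < k0 then C k * p n (s k) else 0) = (\<Sum>k\<in>{..<N} \<inter> {..<k0}. C k * p n (s k))"
      by (subst sum.inter_restrict) auto
    also have "\<dots> \<le> (\<Sum>k<k0. C k * p n (s k))"
      using nn by (intro sum_mono2) auto
    also have "(\<Sum>k<N. (1/2) ^ k :: real) \<le> 2"
      using sum_gp_strict[of "1/2 :: real" N] by simp
    finally show ?thesis by simp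
  qed
  have "p n (T x) \<le> M * p (max n m) x" if x: "x \<in> E" for x
  proof -
    obtain N where N: "x \<in> span (e ` {..<N})" using E_finite x by blast
    have "T x = T (\<Sum>k<N. scl (f k x) (e k))" using span_e_expand[OF N] by simp
    also have "\<dots> = (\<Sum>k<N. scl (f k x) (scl c (e k) + s k))"
      by (simp add: op.linear_sum[OF T] op.linear_scale[OF T] s_def)
    also have "\<dots> = scl c (\<Sum>k<N. scl (f k x) (e k)) + (\<Sum>k<N. scl (f k x) (s k))"
      by (simp add: scale_right_distrib sum.distrib scale_sum_right mult.commute)
    finally have "T x = scl c x + (\<Sum>k<N. scl (f k x) (s k))"
      using span_e_expand[OF N] by simp
    then have "p n (T x) \<le> norm c * p n x + (\<Sum>k<N. norm (f k x) * p n (s k))"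
      using p_add[of n "scl c x" "\<Sum>k<N. scl (f k x) (s k)"] p_sum[of n "\<lambda>k. scl (f k x) (s k)" "{..<N}"]
      by simp
    also have "\<dots> \<le> norm c * p (max n m) x + (\<Sum>k<N. C k * p n (s k)) * p (max n m) x"
    proof (intro add_mono mult_left_mono p_mono)
      show "(\<Sum>k<N. norm (f k x) * p n (s k)) \<le> (\<Sum>k<N. C k * p n (s k)) * p (max n m) x"
        unfolding sum_distrib_right
      proof (intro sum_mono)
        fix k
        show "norm (f k x) * p n (s k) \<le> C k * p n (s k) * p (max n m) x"
        proof (cases "p n (s k) = 0")
          case False
          have "norm (f k x) \<le> C k * p (lev k) x" by (rule f_bound)
          also have "\<dots> \<le> C k * p (max n m) x"
            using m[OF False] C_pos[of k] by (intro mult_left_mono p_mono) auto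
          finally have "norm (f k x) * p n (s k) \<le> C k * p (max n m) x * p n (s k)"
            by (rule mult_right_mono) simp
          then show ?thesis by (simp add: mult_ac)
        qed simp
      qed
    qed simp_all
    also have "\<dots> \<le> M * p (max n m) x"
      using mult_right_mono[OF sum_le, of "p (max n m) x" N] by (simp add: M_def distrib_right)
    finally show ?thesis .
  qed
  moreover have "0 \<le> M" unfolding M_def using nn by (simp add: sum_nonneg)
  ultimately show ?thesis by blast
qed

lemma funpow_in_E:
  assumes "\<And>x. x \<in> E \<Longrightarrow> T x \<in> E" "x \<in> E"
  shows "(T ^^ i) x \<in> E"
  using assms by (induction i) auto

lemma funpow_eq_on_E:
  assumes "\<And>x. x \<in> E \<Longrightarrow> S x = T x" "\<And>x. x \<in> E \<Longrightarrow> T x \<in> E" "x \<in> E"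
  shows "(S ^^ i) x = (T ^^ i) x"
  using assms funpow_in_E[of T x] by (induction i) auto

text \<open>Orbits of vectors of \<open>E\<close> stay in \<open>E\<close>, where the operator and
  its extension agree; so it suffices to check density and cyclicity there.\<close>

lemma hypercyclic_extension:
  assumes T: "Vector_Spaces.linear scl scl T" and TE: "\<And>k. T (e k) \<in> E" and u: "u \<in> E"
    and bd: "\<And>n. \<exists>m M. 0 \<le> M \<and> (\<forall>x\<in>E. p n (T x) \<le> M * p m x)"
    and dense: "\<And>y n d. y \<in> E \<Longrightarrow> 0 < d \<Longrightarrow> \<exists>m. p n ((T ^^ m) u - y) < d"
    and cyclic: "\<And>x. x \<in> E \<Longrightarrow> x \<noteq> 0 \<Longrightarrow> \<exists>j P. P \<noteq> 0 \<and> (T ^^ j) x = poly_operator P T u"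
  shows "\<exists>T'. bounded_operator T' \<and> T' ` E \<subseteq> E \<and> (\<forall>x\<in>E - {0}. dense_orbit T' x)"
proof -
  obtain T' where T': "bounded_operator T'" "\<And>x. x \<in> E \<Longrightarrow> T' x = T x"
    using bounded_extension[OF subspace_span dense_span T bd] by blast
  note inE = linear_maps_E[OF T TE]
  have pow: "(T' ^^ i) x = (T ^^ i) x" if "x \<in> E" for x i
    using that by (intro funpow_eq_on_E T' inE)
  have "dense_orbit T' u"
    unfolding dense_orbit_def
  proof (intro allI impI)
    fix y n and d :: real assume d: "0 < d"
    obtain y' where y': "y' \<in> E" "p n (y - y') < d / 2"
      using dense_span[of "d / 2" n y] d by auto
    obtain m where "p n ((T ^^ m) u - y') < d / 2" using dense[OF y'(1), of "d / 2" n] d by auto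
    then show "\<exists>m. p n ((T' ^^ m) u - y) < d"
      using y'(2) p_triangle[of n "(T ^^ m) u" y y'] p_minus_commute[of n y y']
      by (intro exI[of _ m]) (simp add: pow[OF u])
  qed
  then have "dense_orbit T' x" if x: "x \<in> E" "x \<noteq> 0" for x
  proof -
    obtain j P where "P \<noteq> 0" "(T ^^ j) x = poly_operator P T u" using cyclic[OF x] by blast
    then have "(T' ^^ j) x = poly_operator P T' u"
      by (simp add: pow[OF x(1)] poly_operator_def pow[OF u])
    then have "dense_orbit T' ((T' ^^ j) x)"
      using dense_orbit_poly_operator[OF T'(1) \<open>dense_orbit T' u\<close> \<open>P \<noteq> 0\<close>] by simp
    then show ?thesis by (rule dense_orbit_funpowD)
  qed
  moreover have "T' ` E \<subseteq> E" using T'(2) inE by auto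
  ultimately show ?thesis using T'(1) by blast
qed

text \<open>A finite piece of the orbit of \<open>u\<close> meets finitely many basis vectors, so it
  is eventually that of the limit operator. A target hit in stage \<open>s\<close> is disturbed in
  stage \<open>t > s\<close> by at most \<open>(1/2) ^ t\<close>. Targets must recur arbitrarily
  late, since stage \<open>s\<close> controls \<open>p n\<close> only for
  \<open>n \<le> s\<close>.\<close>

lemma stage_limit:
  assumes T: "\<And>s. Vector_Spaces.linear scl scl (T s)" and TE: "\<And>s k. T s (e k) \<in> E"
    and stable: "\<And>k. \<exists>s0. \<forall>s\<ge>s0. T s (e k) = T s0 (e k)" and u: "u \<in> E"
    and hit: "\<And>s. p s ((T (Suc s) ^^ m s) u - z s) \<le> (1/2) ^ s"
    and keep: "\<And>s i. i < s \<Longrightarrow> p s ((T (Suc s) ^^ m i) u - (T s ^^ m i) u) \<le> (1/2) ^ s"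
    and z: "\<And>y n d s0. y \<in> E \<Longrightarrow> 0 < d \<Longrightarrow> \<exists>s\<ge>s0. p n (z s - y) < d"
  obtains S where "Vector_Spaces.linear scl scl S" "\<And>k. \<exists>s0. \<forall>s\<ge>s0. T s (e k) = S (e k)"
    "\<And>x. x \<in> E \<Longrightarrow> \<exists>s0. \<forall>s\<ge>s0. T s x = S x"
    "\<And>y n d. y \<in> E \<Longrightarrow> 0 < d \<Longrightarrow> \<exists>i. p n ((S ^^ i) u - y) < d"
proof -
  obtain s0 where s0: "\<And>k s. s0 k \<le> s \<Longrightarrow> T s (e k) = T (s0 k) (e k)"
    using stable by metis
  obtain S where S: "Vector_Spaces.linear scl scl S" "\<And>k. S (e k) = T (s0 k) (e k)"
    using ex_linear_on_family[OF inj_e independent_e, of "\<lambda>k. T (s0 k) (e k)"] by blast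
  have ev: "\<exists>t. \<forall>s\<ge>t. T s x = S x" if "x \<in> E" for x
    using that
  proof (induction rule: span_induct_alt)
    case base
    then show ?case using op.linear_0[OF T] op.linear_0[OF S(1)] by auto
  next
    case (step c y z)
    then obtain k t where k: "y = e k" and t: "\<And>s. t \<le> s \<Longrightarrow> T s z = S z" by blast
    have "T s (scl c y + z) = S (scl c y + z)" if "max t (s0 k) \<le> s" for s
    proof -
      have "T s (e k) = S (e k)" "T s z = S z" using that s0[of k s] t by (simp_all add: S(2))
      then show ?thesis
        by (simp only: op.linear_add[OF T] op.linear_add[OF S(1)] op.linear_scale[OF T]
            op.linear_scale[OF S(1)] k)
    qed
    then show ?case by blast
  qed
  have SE: "S x \<in> E" if "x \<in> E" for x
    using linear_maps_E[OF S(1) _ that] by (simp add: S(2) TE)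
  have ev_pow: "\<exists>t. \<forall>s\<ge>t. (T s ^^ i) u = (S ^^ i) u" for i
  proof (induction i)
    case (Suc i)
    then obtain t where t: "\<And>s. t \<le> s \<Longrightarrow> (T s ^^ i) u = (S ^^ i) u" by blast
    obtain t' where t': "\<And>s. t' \<le> s \<Longrightarrow> T s ((S ^^ i) u) = S ((S ^^ i) u)"
      using ev[OF funpow_in_E[of S u i]] SE u by blast
    have "(T s ^^ Suc i) u = (S ^^ Suc i) u" if "max t t' \<le> s" for s
      using that t t' by simp
    then show ?case by blast
  qed auto
  \<comment> \<open>The bound is the partial geometric sum of the initial error and \<open>r\<close>
    later disturbances.\<close>
  have dev: "p s ((T (Suc s + r) ^^ m s) u - z s) \<le> (1/2) ^ s * (2 - (1/2) ^ r)" for s r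
  proof (induction r)
    case 0
    then show ?case using hit[of s] by simp
  next
    case (Suc r)
    have "p s ((T (Suc (Suc s + r)) ^^ m s) u - (T (Suc s + r) ^^ m s) u)
        \<le> p (Suc s + r) ((T (Suc (Suc s + r)) ^^ m s) u - (T (Suc s + r) ^^ m s) u)"
      by (rule p_mono) simp
    also have "\<dots> \<le> (1/2) ^ (Suc s + r)" by (rule keep) simp
    finally have "p s ((T (Suc (Suc s + r)) ^^ m s) u - z s)
        \<le> (1/2) ^ (Suc s + r) + (1/2) ^ s * (2 - (1/2) ^ r)"
      using Suc.IH p_triangle[of s "(T (Suc (Suc s + r)) ^^ m s) u" "z s" "(T (Suc s + r) ^^ m s) u"]
      by linarith
    then show ?case by (simp add: power_add algebra_simps)
  qed
  have near: "p s ((S ^^ m s) u - z s) \<le> 2 * (1/2) ^ s" for s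
  proof -
    obtain t where t: "\<And>s'. t \<le> s' \<Longrightarrow> (T s' ^^ m s) u = (S ^^ m s) u" using ev_pow by blast
    have "p s ((S ^^ m s) u - z s) \<le> (1/2) ^ s * (2 - (1/2) ^ t)"
      using dev[of s t] t[of "Suc s + t"] by simp
    also have "\<dots> \<le> (1/2) ^ s * 2" by (intro mult_left_mono) auto
    finally show ?thesis by simp
  qed
  have "\<exists>i. p n ((S ^^ i) u - y) < d" if y: "y \<in> E" and d: "0 < d" for y n d
  proof -
    have "(\<lambda>s. 2 * (1/2) ^ s :: real) \<longlonglongrightarrow> 0"
      using tendsto_mult[OF tendsto_const[of 2] LIMSEQ_power_zero[of "1/2 :: real"]] by simp
    then have "\<forall>\<^sub>F s in sequentially. 2 * (1/2) ^ s < d / 2"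
      by (rule order_tendstoD(2)) (use d in simp)
    then obtain s1 where s1: "\<And>s. s1 \<le> s \<Longrightarrow> 2 * (1/2) ^ s < d / 2"
      unfolding eventually_sequentially by blast
    obtain s where s: "max s1 n \<le> s" "p n (z s - y) < d / 2"
      using z[OF y, of "d / 2" "max s1 n" n] d by auto
    have "p n ((S ^^ m s) u - z s) < d / 2"
      using near[of s] p_mono[of n s "(S ^^ m s) u - z s"] s1[of s] s(1) by simp
    then have "p n ((S ^^ m s) u - y) < d"
      using s(2) p_triangle[of n "(S ^^ m s) u" y "z s"] by simp
    then show ?thesis by blast
  qed
  then show thesis
    by (intro that[OF S(1) ev[OF e_in_E] ev]) auto
qed

end

section \<open>Bases of bounded level\<close>

context graded_seminorms begin

section \<open>Cyclic subspaces and null sequences\<close>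

lemma poly_operator_eq:
  "degree P \<le> N \<Longrightarrow> poly_operator P T x = (\<Sum>i\<le>N. scl (coeff P i) ((T ^^ i) x))"
  unfolding poly_operator_def by (rule sum.mono_neutral_left) (auto simp: coeff_eq_0)

lemma poly_operator_add: "poly_operator (P + Q) T x = poly_operator P T x + poly_operator Q T x"
proof -
  define N where "N = max (degree P) (degree Q)"
  have "degree P \<le> N" "degree Q \<le> N" "degree (P + Q) \<le> N"
    by (auto simp: N_def degree_add_le)
  then show ?thesis
    by (simp add: poly_operator_eq scale_left_distrib sum.distrib)
qed

lemma poly_operator_smult: "poly_operator (smult c P) T x = scl c (poly_operator P T x)"
proof -
  have "degree (smult c P) \<le> degree P" by (rule degree_smult_le)
  then show ?thesis
    by (simp add: poly_operator_eq[of _ "degree P"] scale_sum_right)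
qed

lemma poly_operator_pCons_0:
  assumes "Vector_Spaces.linear scl scl T"
  shows "poly_operator (pCons 0 P) T x = T (poly_operator P T x)"
proof -
  have "degree (pCons 0 P) \<le> Suc (degree P)" by (rule degree_pCons_le)
  then have "poly_operator (pCons 0 P) T x = (\<Sum>i\<le>Suc (degree P). scl (coeff (pCons 0 P) i) ((T ^^ i) x))"
    by (rule poly_operator_eq)
  also have "\<dots> = (\<Sum>i\<le>degree P. scl (coeff P i) (T ((T ^^ i) x)))"
    by (subst sum.atMost_Suc_shift) simp
  finally show ?thesis
    by (simp add: poly_operator_def op.linear_sum[OF assms] op.linear_scale[OF assms])
qed

lemma subspace_poly_operators: "subspace (range (\<lambda>P. poly_operator P T u))"
proof (rule subspaceI)
  show "0 \<in> range (\<lambda>P. poly_operator P T u)"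
  proof -
    have "poly_operator 0 T u = 0" by (simp add: poly_operator_def)
    then show ?thesis by (metis rangeI)
  qed
  fix x y c
  assume "x \<in> range (\<lambda>P. poly_operator P T u)"
  then obtain P where P: "x = poly_operator P T u" by blast
  then have "scl c x = poly_operator (smult c P) T u" by (simp add: poly_operator_smult)
  then show "scl c x \<in> range (\<lambda>P. poly_operator P T u)" by blast
  assume "y \<in> range (\<lambda>P. poly_operator P T u)"
  then obtain Q where "y = poly_operator Q T u" by blast
  then have "x + y = poly_operator (P + Q) T u" using P by (simp add: poly_operator_add)
  then show "x + y \<in> range (\<lambda>P. poly_operator P T u)" by blast
qed

lemma poly_operators_closed:
  assumes "Vector_Spaces.linear scl scl T" "x \<in> range (\<lambda>P. poly_operator P T u)"
  shows "T x \<in> range (\<lambda>P. poly_operator P T u)"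
proof -
  obtain P where "x = poly_operator P T u" using assms(2) by blast
  then have "T x = poly_operator (pCons 0 P) T u" using poly_operator_pCons_0[OF assms(1)] by simp
  then show ?thesis by blast
qed

lemma poly_operators_base: "u \<in> range (\<lambda>P. poly_operator P T u)"
proof -
  have "poly_operator 1 T u = u" by (simp add: poly_operator_def)
  then show ?thesis by (metis rangeI)
qed

lemma converges_0_scale:
  assumes "c \<longlonglongrightarrow> 0"
  shows "converges (\<lambda>m. scl (c m) x) 0"
  unfolding converges_def
proof
  fix n
  have "(\<lambda>m. norm (c m) * p n x) \<longlonglongrightarrow> 0 * p n x"
    using assms by (intro tendsto_intros) (rule tendsto_norm_zero)
  then show "(\<lambda>m. p n (scl (c m) x - 0)) \<longlonglongrightarrow> 0" by simp
qed

lemma converges_0_sum: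
  assumes "\<And>j. j \<in> I \<Longrightarrow> converges (\<lambda>m. x m j) 0"
  shows "converges (\<lambda>m. \<Sum>j\<in>I. x m j) 0"
  using assms
proof (induction I rule: infinite_finite_induct)
  case (insert j I)
  then have "converges (\<lambda>m. x m j + (\<Sum>j\<in>I. x m j)) (0 + 0)"
    by (intro converges_add) auto
  then show ?case using insert(1,2) by simp
qed (simp_all add: converges_const)

lemma converges_0_diff:
  assumes "converges x 0" "converges y 0"
  shows "converges (\<lambda>m. x m - y m) 0"
  using converges_add[OF assms(1) converges_scale[OF assms(2), of "- 1"]] by simp

lemma converges_0_eventually:
  assumes "converges x 0" "0 < d"
  shows "\<forall>\<^sub>F m in sequentially. p n (x m) < d"
  using converges_p[OF assms(1), of n] assms(2) by (intro order_tendstoD(2)) auto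

lemma span_family_expand:
  fixes g :: "nat \<Rightarrow> 'a"
  assumes "x \<in> span (range g)"
  shows "\<exists>q c. (\<forall>i\<ge>q. c i = 0) \<and> (\<forall>R\<ge>q. x = (\<Sum>i\<le>R. scl (c i) (g i)))"
  using assms
proof (induction rule: span_induct_alt)
  case base
  then show ?case by (intro exI[of _ 0] exI[of _ "\<lambda>_. 0"]) simp
next
  case (step a y z)
  then obtain q c where c: "\<forall>i\<ge>q. c i = 0" "\<And>R. q \<le> R \<Longrightarrow> z = (\<Sum>i\<le>R. scl (c i) (g i))" by blast
  obtain j where j: "y = g j" using step(1) by blast
  define b where "b i = (if i = j then a else 0) + c i" for i
  have "scl a y + z = (\<Sum>i\<le>R. scl (b i) (g i))" if "max q (Suc j) \<le> R" for R
  proof -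
    have "(\<Sum>i\<le>R. scl (b i) (g i)) = (\<Sum>i\<le>R. if i = j then scl a (g i) else 0) + (\<Sum>i\<le>R. scl (c i) (g i))"
      by (simp add: b_def scale_left_distrib sum.distrib if_distrib[of "\<lambda>t. scl t _"] cong: if_cong)
    then show ?thesis using that c(2)[of R] j by (simp add: sum.delta)
  qed
  moreover have "b i = 0" if "max q (Suc j) \<le> i" for i
    using that c(1) by (auto simp: b_def)
  ultimately show ?case by blast
qed

definition id_plus :: "('a \<Rightarrow> 'a) \<Rightarrow> 'a \<Rightarrow> 'a"
  where "id_plus N x = x + N x"

lemma linear_id_plus: "Vector_Spaces.linear scl scl N \<Longrightarrow> Vector_Spaces.linear scl scl (id_plus N)"
  by (auto simp: Vector_Spaces.linear_iff id_plus_def scale_right_distrib algebra_simps)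

end

section \<open>Jordan chains adapted to the basis\<close>

context graded_basis begin

text \<open>A dimension count: for \<open>m \<ge> n\<close> the vectors
  \<open>h 0, ..., h (m - 1)\<close> span a space containing \<open>m\<close> independent vectors,
  so they are distinct and independent.\<close>

lemma independent_family:
  assumes low: "\<And>i. i < n \<Longrightarrow> e i \<in> span (h ` {..<n})" and high: "\<And>i. n \<le> i \<Longrightarrow> h i = e i"
  shows "inj h" "independent (range h)"
proof -
  have main: "inj_on h {..<m} \<and> independent (h ` {..<m})" if m: "n \<le> m" for m
  proof -
    have "e i \<in> span (h ` {..<m})" if "i < m" for i
    proof (cases "i < n")
      case True
      have "span (h ` {..<n}) \<subseteq> span (h ` {..<m})" using m by (intro span_mono image_mono) auto
      then show ?thesis using low[OF True] by blast
    next
      case False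
      then have "e i = h i" using high[of i] by simp
      then show ?thesis using that by (simp add: span_base)
    qed
    then have sub: "e ` {..<m} \<subseteq> span (h ` {..<m})" by blast
    have ind: "independent (e ` {..<m})" using independent_e by (rule independent_mono) auto
    have ce: "card (e ` {..<m}) = m" using inj_e by (simp add: card_image inj_on_subset)
    have bound: "m \<le> card H" if "finite H" "e ` {..<m} \<subseteq> span H" for H
      using independent_span_bound[OF that(1) ind that(2)] ce by simp
    have cH: "card (h ` {..<m}) = m"
      using bound[OF _ sub] card_image_le[of "{..<m}" h] by simp
    have "inj_on h {..<m}" by (rule eq_card_imp_inj_on) (simp_all add: cH)
    moreover have "independent (h ` {..<m})"
    proof
      assume "dependent (h ` {..<m})"
      then obtain a where a: "a \<in> h ` {..<m}" "a \<in> span (h ` {..<m} - {a})"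
        unfolding dependent_def by blast
      have "span (h ` {..<m}) = span (h ` {..<m} - {a})"
        using span_redundant[OF a(2)] a(1) by (simp add: insert_absorb)
      then have "m \<le> card (h ` {..<m} - {a})" using sub by (intro bound) simp_all
      moreover have "card (h ` {..<m} - {a}) < card (h ` {..<m})"
        by (rule psubset_card_mono) (use a(1) in auto)
      ultimately show False using cH by simp
    qed
    ultimately show ?thesis ..
  qed
  show "inj h"
  proof (rule injI)
    fix x y assume "h x = h y"
    then show "x = y"
      using main[of "max n (Suc (max x y))"] by (auto dest!: inj_onD[of h _ x y])
  qed
  show "independent (range h)"
    unfolding independent_explicit_finite_subsets
  proof (intro allI impI ballI)
    fix S w v assume S: "S \<subseteq> range h" "finite S" "(\<Sum>v\<in>S. scl (w v) v) = 0" "v \<in> S"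
    obtain I where I: "finite I" "S = h ` I" using finite_subset_image[OF S(2,1)] by blast
    obtain m where "\<forall>i\<in>I. i < m" using I(1) finite_nat_set_iff_bounded by blast
    then have "S \<subseteq> h ` {..<max n m}" unfolding I(2) by fastforce
    then show "w v = 0" using main[of "max n m"] independentD[of "h ` {..<max n m}" S w v] S by simp
  qed
qed

text \<open>\<open>g\<close> is an infinite Jordan chain of \<open>N\<close>. Beyond
  \<open>n\<close> it consists of multiples of the original basis vectors, so only a finite block is
  ever rearranged. The nonzero coordinate at \<open>n - 1\<close> makes \<open>e 0\<close> a cyclic
  vector of \<open>N\<close> on that block.\<close>

definition jordan_state :: "('a \<Rightarrow> 'a) \<Rightarrow> (nat \<Rightarrow> 'a) \<Rightarrow> nat \<Rightarrow> bool"
  where "jordan_state N g n \<longleftrightarrow> Vector_Spaces.linear scl scl N \<and> N (g 0) = 0 \<and>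
    (\<forall>i. N (g (Suc i)) = g i) \<and> span (g ` {..<n}) = span (e ` {..<n}) \<and>
    (\<forall>i\<ge>n. \<exists>c. c \<noteq> 0 \<and> g i = scl c (e i)) \<and> 0 < n \<and>
    (\<exists>x. x (n - 1) \<noteq> 0 \<and> e 0 = (\<Sum>i<n. scl (x i) (g i)))"

context
  fixes N g n
  assumes st: "jordan_state N g n"
begin

lemma linear_N: "Vector_Spaces.linear scl scl N"
  and N_g0: "N (g 0) = 0" and N_gSuc: "N (g (Suc i)) = g i"
  and span_g_n: "span (g ` {..<n}) = span (e ` {..<n})"
  and n_pos: "0 < n"
  using st by (auto simp: jordan_state_def)

lemma g_high: "n \<le> i \<Longrightarrow> \<exists>c. c \<noteq> 0 \<and> g i = scl c (e i)"
  using st by (auto simp: jordan_state_def)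

lemma N_pow_g: "(N ^^ i) (g j) = (if i \<le> j then g (j - i) else 0)"
proof (induction i)
  case (Suc i)
  show ?case
  proof (cases "i < j")
    case True
    then have "j - i = Suc (j - Suc i)" by simp
    then show ?thesis using Suc True by (simp add: N_gSuc)
  next
    case False
    then show ?thesis using Suc by (auto simp: N_g0 op.linear_0[OF linear_N])
  qed
qed simp

lemma span_g:
  assumes "n \<le> m"
  shows "span (g ` {..<m}) = span (e ` {..<m})"
proof -
  have "g i \<in> span (e ` {..<m})" if "i < m" for i
  proof (cases "i < n")
    case True
    then have "g i \<in> span (e ` {..<n})" using span_g_n span_base[of "g i" "g ` {..<n}"] by blast
    then show ?thesis using span_mono[of "e ` {..<n}" "e ` {..<m}"] assms by (auto simp: image_mono)
  next
    case False
    then obtain c where "g i = scl c (e i)" using g_high[of i] by auto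
    then show ?thesis using that by (simp add: span_scale span_base)
  qed
  moreover have "e i \<in> span (g ` {..<m})" if "i < m" for i
  proof (cases "i < n")
    case True
    then have "e i \<in> span (g ` {..<n})" using span_g_n span_base[of "e i" "e ` {..<n}"] by blast
    then show ?thesis using span_mono[of "g ` {..<n}" "g ` {..<m}"] assms by (auto simp: image_mono)
  next
    case False
    then obtain c where c: "c \<noteq> 0" "g i = scl c (e i)" using g_high[of i] by auto
    then have "e i = scl (inverse c) (g i)" by simp
    then show ?thesis using that by (simp only: ) (intro span_scale span_base, simp)
  qed
  ultimately show ?thesis by (simp only: span_eq) blast
qed

lemma span_range_g: "span (range g) = E"
proof (rule antisym)
  show "span (range g) \<subseteq> E"
  proof (rule span_minimal)
    have "g i \<in> span (e ` {..<max n (Suc i)})" for i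
      using span_g[of "max n (Suc i)"] span_base[of "g i" "g ` {..<max n (Suc i)}"] by auto
    then show "range g \<subseteq> E" using span_mono[of "e ` {..<_}" "range e"] by blast
  qed simp
  show "E \<subseteq> span (range g)"
  proof (rule span_minimal)
    have "e i \<in> span (g ` {..<max n (Suc i)})" for i
      using span_g[of "max n (Suc i)"] span_base[of "e i" "e ` {..<max n (Suc i)}"] by auto
    then show "range e \<subseteq> span (range g)" using span_mono[of "g ` {..<_}" "range g"] by blast
  qed simp
qed

lemma g_in_E: "g i \<in> E"
  using span_range_g span_base[of "g i" "range g"] by simp

lemma N_in_E: "x \<in> E \<Longrightarrow> N x \<in> E"
proof -
  assume x: "x \<in> E"
  have "N (g i) \<in> span (range g)" for i
    by (cases i) (auto simp: N_g0 N_gSuc span_zero intro: span_base)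
  then have "N x \<in> span (range g)"
    using x by (intro linear_maps_span[OF linear_N, of x "range g"]) (auto simp: span_range_g)
  then show ?thesis by (simp add: span_range_g)
qed

text \<open>Applying \<open>N\<close> to \<open>e 0\<close> exactly \<open>n - 1 - j\<close> times
  moves the coordinate \<open>x (n - 1)\<close> to \<open>g j\<close> and leaves only earlier chain
  vectors besides, which allows solving for \<open>g j\<close>.\<close>

lemma orbit_spans:
  assumes "j < n"
  shows "g j \<in> span ((\<lambda>i. (N ^^ i) (e 0)) ` {..<n})"
  using assms
proof (induction j rule: less_induct)
  case (less j)
  obtain x where x: "x (n - 1) \<noteq> 0" "e 0 = (\<Sum>i<n. scl (x i) (g i))"
    using st by (auto simp: jordan_state_def)
  define k where "k = n - 1 - j"
  have nk: "n = k + Suc j" using less.prems by (simp add: k_def)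
  have "(N ^^ k) (e 0) = (\<Sum>i<n. scl (x i) ((N ^^ k) (g i)))"
    by (subst x(2)) (simp add: op.linear_sum[OF linear_funpow[OF linear_N]] op.linear_scale[OF linear_funpow[OF linear_N]])
  also have "\<dots> = (\<Sum>i<k + Suc j. if k \<le> i then scl (x i) (g (i - k)) else 0)"
    by (intro sum.cong) (simp_all add: N_pow_g nk)
  also have "\<dots> = (\<Sum>i=k..<k + Suc j. scl (x i) (g (i - k)))"
    by (rule sum.mono_neutral_cong_right) auto
  also have "\<dots> = (\<Sum>t<Suc j. scl (x (k + t)) (g t))"
    using sum.shift_bounds_nat_ivl[of "\<lambda>i. scl (x i) (g (i - k))" 0 k "Suc j"]
    by (simp add: atLeast0LessThan add.commute)
  finally have "(N ^^ k) (e 0) = (\<Sum>t<j. scl (x (k + t)) (g t)) + scl (x (n - 1)) (g j)"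
    using nk by simp
  then have "scl (x (n - 1)) (g j) = (N ^^ k) (e 0) - (\<Sum>t<j. scl (x (k + t)) (g t))" by simp
  moreover have "(N ^^ k) (e 0) - (\<Sum>t<j. scl (x (k + t)) (g t)) \<in> span ((\<lambda>i. (N ^^ i) (e 0)) ` {..<n})"
    using less nk by (intro span_diff span_sum span_scale) (auto intro: span_base)
  ultimately have "scl (x (n - 1)) (g j) \<in> span ((\<lambda>i. (N ^^ i) (e 0)) ` {..<n})"
    by (simp only: )
  from span_scale[OF this, of "inverse (x (n - 1))"] show ?case using x(1) by simp
qed

lemma e_in_orbit_span:
  assumes "j < n"
  shows "e j \<in> span ((\<lambda>i. (N ^^ i) (e 0)) ` {..<n})"
proof -
  have "e j \<in> span (g ` {..<n})" using span_g_n span_base[of "e j" "e ` {..<n}"] assms by blast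
  moreover have "span (g ` {..<n}) \<subseteq> span ((\<lambda>i. (N ^^ i) (e 0)) ` {..<n})"
    using orbit_spans by (intro span_minimal) auto
  ultimately show ?thesis by blast
qed

lemma id_plus_pow_g_sum:
  assumes "\<And>i. R < i \<Longrightarrow> c i = 0"
  shows "(id_plus N ^^ m) (\<Sum>i\<le>R. scl (c i) (g i)) = (\<Sum>i\<le>R. scl ((add_shift ^^ m) c i) (g i))
    \<and> (\<forall>i>R. (add_shift ^^ m) c i = 0)"
proof (induction m)
  case 0
  then show ?case using assms by simp
next
  case (Suc m)
  define b where "b = (add_shift ^^ m) c"
  have b: "\<And>i. R < i \<Longrightarrow> b i = 0" using Suc by (simp add: b_def)
  have "N (\<Sum>i\<le>R. scl (b i) (g i)) = (\<Sum>i\<le>R. scl (b i) (N (g i)))"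
    by (simp add: op.linear_sum[OF linear_N] op.linear_scale[OF linear_N])
  also have "\<dots> = (\<Sum>i\<le>Suc R. scl (b i) (N (g i)))" using b by simp
  also have "\<dots> = (\<Sum>i\<le>R. scl (b (Suc i)) (g i))"
    by (subst sum.atMost_Suc_shift) (simp add: N_g0 N_gSuc)
  finally have "id_plus N (\<Sum>i\<le>R. scl (b i) (g i)) = (\<Sum>i\<le>R. scl (add_shift b i) (g i))"
    by (simp add: id_plus_def add_shift_def scale_left_distrib sum.distrib)
  moreover have "add_shift b i = 0" if "R < i" for i
    using that b by (simp add: add_shift_def)
  ultimately show ?case using Suc by (simp add: b_def)
qed

end


text \<open>
  With \<open>A (N\<^sup>i u) = N\<^sup>i v\<close> for \<open>i < n\<close> and \<open>A = 0\<close> on the later basis vectors, where \<open>v\<close> is so far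
  out in the chain that \<open>A\<close> squares to \<open>0\<close>, the conjugate \<open>(I - A) N (I + A)\<close> agrees with \<open>N\<close> on
  \<open>N\<^sup>i u\<close> for \<open>i + 1 < n\<close>. Hence each column changes in finitely many stages only.
\<close>

lemma jordan_stage:
  assumes st: "jordan_state N g n" and z: "z \<in> E" and d: "0 < d"
  obtains N' g' n' m where "jordan_state N' g' n'" "n < n'"
    "\<And>i. Suc i < n \<Longrightarrow> N' ((N ^^ i) (e 0)) = N ((N ^^ i) (e 0))"
    "\<And>k. n < k \<Longrightarrow> N' (e k) = N (e k)"
    "\<And>k. k \<le> n \<Longrightarrow> C k * p k (N' (e k) - N (e k)) \<le> d"
    "\<And>j. j \<le> M \<Longrightarrow> p s ((id_plus N' ^^ j) (e 0) - (id_plus N ^^ j) (e 0)) \<le> d"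
    "p s ((id_plus N' ^^ m) (e 0) - z) \<le> d"
proof -
  let ?u = "e 0"
  note N = linear_N[OF st] and npos = n_pos[OF st]
  note Npow = linear_funpow[OF N]
  note NE = N_in_E[OF st] and gE = g_in_E[OF st]
  \<comment> \<open>The basis on which \<open>A\<close> is prescribed: the orbit of \<open>u\<close>
    under \<open>N\<close> replaces the first \<open>n\<close> basis vectors.\<close>
  define h where "h i = (if i < n then (N ^^ i) ?u else e i)" for i
  have h_low: "h i = (N ^^ i) ?u" if "i < n" for i using that by (simp add: h_def)
  have h_high: "h i = e i" if "n \<le> i" for i using that by (simp add: h_def)
  have h_img: "h ` {..<n} = (\<lambda>i. (N ^^ i) ?u) ` {..<n}" by (intro image_cong) (auto simp: h_def)
  have low: "e i \<in> span (h ` {..<n})" if "i < n" for i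
    unfolding h_img using e_in_orbit_span[OF st that] .
  note fam = independent_family[OF low h_high]
  have hE: "h i \<in> E" for i
    using funpow_in_E[of N ?u i] NE by (simp add: h_def)
  have span_h: "span (range h) = E"
  proof (rule antisym)
    show "span (range h) \<subseteq> E" using hE by (intro span_minimal) auto
    have "e i \<in> span (range h)" for i
    proof (cases "i < n")
      case True
      then show ?thesis using low[OF True] span_mono[of "h ` {..<n}" "range h"] by blast
    next
      case False
      then have "e i = h i" using h_high[of i] by simp
      then show ?thesis by (simp only: span_base rangeI)
    qed
    then show "E \<subseteq> span (range h)" by (intro span_minimal) auto
  qed
  obtain x where x: "x (n - 1) \<noteq> 0" "?u = (\<Sum>i<n. scl (x i) (g i))"
    using st by (auto simp: jordan_state_def)
  obtain q0 zc where zc: "\<And>i. q0 \<le> i \<Longrightarrow> zc i = 0" "\<And>R. q0 \<le> R \<Longrightarrow> z = (\<Sum>i\<le>R. scl (zc i) (g i))"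
    using span_family_expand[of z g] z span_range_g[OF st] by auto
  define q where "q = max n q0"
  define y where "y i = (if i < n then x i else 0)" for i
  obtain R c where R: "2 * n \<le> R" "q \<le> R"
    and c: "\<And>m i. i < 2 * n \<or> R < i \<Longrightarrow> c m i = 0" "\<And>m. c m R \<noteq> 0"
      "\<And>i. (\<lambda>m. c m i) \<longlonglongrightarrow> (0::'k)"
      "\<And>i. (\<lambda>m. (add_shift ^^ m) (\<lambda>i. y i + c m i) i) \<longlonglongrightarrow> zc i"
    \<comment> \<open>The correction starts at \<open>2 * n\<close>, so that up to \<open>n\<close>
      applications of \<open>N\<close> keep it within the chain from \<open>n\<close> on, where
      \<open>A\<close> vanishes.\<close>
    using add_shift_steering[of q y zc "2 * n"] zc(1) by (auto simp: y_def q_def)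
  have u_sum: "?u = (\<Sum>i\<le>R. scl (y i) (g i))"
  proof -
    have "(\<Sum>i<n. scl (x i) (g i)) = (\<Sum>i\<le>R. scl (y i) (g i))"
      using R npos by (intro sum.mono_neutral_cong_left) (auto simp: y_def)
    then show ?thesis using x(2) by simp
  qed
  define v where "v m = (\<Sum>j\<le>R. scl (c m j) (g j))" for m
  \<comment> \<open>The map \<open>A m\<close> is a combination of fixed maps \<open>AA j\<close>
    with the coefficients \<open>c m j\<close>, so it tends to 0 pointwise along with them.\<close>
  have "\<exists>A. Vector_Spaces.linear scl scl A \<and> (\<forall>i. A (h i) = (if i < n then (N ^^ i) (g j) else 0))" for j
    using ex_linear_on_family[OF fam, of "\<lambda>i. if i < n then (N ^^ i) (g j) else 0"] by blast
  then obtain AA where AA: "\<And>j. Vector_Spaces.linear scl scl (AA j)"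
    "\<And>j i. AA j (h i) = (if i < n then (N ^^ i) (g j) else 0)"
    by metis
  define A where "A m t = (\<Sum>j\<le>R. scl (c m j) (AA j t))" for m t
  have A: "Vector_Spaces.linear scl scl (A m)" for m
    unfolding A_def by (intro op.linear_compose_sum ballI op.linear_compose_scale_right AA)
  have A_h: "A m (h i) = (if i < n then (N ^^ i) (v m) else 0)" for m i
    by (simp add: A_def AA(2) v_def op.linear_sum[OF Npow] op.linear_scale[OF Npow])
  \<comment> \<open>\<open>F\<close> contains the image of \<open>A m\<close>. It starts at
    \<open>Suc n\<close> rather than \<open>n\<close>, so that \<open>A m\<close> vanishes on
    \<open>F\<close> and also on its image under \<open>N\<close>.\<close>
  define F where "F = span (g ` {Suc n..})"
  have FE: "t \<in> E" if "t \<in> F" for t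
    using that span_mono[of "g ` {Suc n..}" "range g"] by (auto simp: F_def span_range_g[OF st])
  have v_pow: "(N ^^ i) (v m) \<in> span (g ` {n..})" and v_pow': "i < n \<Longrightarrow> (N ^^ i) (v m) \<in> F"
    if "i \<le> n" for i m
  proof -
    have "(N ^^ i) (v m) = (\<Sum>j\<le>R. scl (c m j) ((N ^^ i) (g j)))"
      by (simp add: v_def op.linear_sum[OF Npow] op.linear_scale[OF Npow])
    moreover have "scl (c m j) ((N ^^ i) (g j)) \<in> span (g ` {2 * n - i..})" for j
    proof (cases "j < 2 * n")
      case True
      then show ?thesis using c(1)[of j m] by (simp add: span_zero)
    next
      case False
      then have "(N ^^ i) (g j) = g (j - i)" "2 * n - i \<le> j - i"
        using that by (auto simp: N_pow_g[OF st])
      then show ?thesis by (simp add: span_scale span_base)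
    qed
    ultimately have *: "(N ^^ i) (v m) \<in> span (g ` {2 * n - i..})"
      by (simp add: span_sum)
    then show "(N ^^ i) (v m) \<in> span (g ` {n..})"
      using span_mono[of "g ` {2 * n - i..}" "g ` {n..}"] that by (auto simp: image_mono)
    show "(N ^^ i) (v m) \<in> F" if "i < n"
      using * span_mono[of "g ` {2 * n - i..}" "g ` {Suc n..}"] that by (auto simp: image_mono F_def)
  qed
  have A_kill: "A m t = 0" if "t \<in> span (g ` {n..})" for m t
  proof (rule op.linear_eq_0_on_span[OF A _ that])
    fix b assume "b \<in> g ` {n..}"
    then obtain i where i: "n \<le> i" "b = g i" by auto
    then obtain a where "b = scl a (h i)" using g_high[OF st i(1)] h_high[of i] by auto
    then show "A m b = 0" using i by (simp add: op.linear_scale[OF A] A_h)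
  qed
  have Fn: "t \<in> span (g ` {n..})" if "t \<in> F" for t
    using that span_mono[of "g ` {Suc n..}" "g ` {n..}"] by (auto simp: F_def image_mono)
  have NF: "N t \<in> span (g ` {n..})" if "t \<in> F" for t
    using that unfolding F_def
  proof (rule linear_maps_span[OF N])
    fix b assume "b \<in> g ` {Suc n..}"
    then obtain i where "n \<le> i" "b = g (Suc i)" by (auto simp: image_iff) (metis Suc_le_D Suc_le_mono)
    then show "N b \<in> span (g ` {n..})" by (simp add: N_gSuc[OF st] span_base)
  qed
  have A_F: "A m t \<in> F" if "t \<in> E" for m t
    unfolding F_def
  proof (rule linear_maps_span[OF A])
    show "t \<in> span (range h)" using that by (simp add: span_h)
    fix b assume "b \<in> range h"
    then show "A m b \<in> span (g ` {Suc n..})"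
      using v_pow' by (auto simp: A_h span_zero F_def)
  qed
  have AA0: "A m (A m t) = 0" if "t \<in> E" for m t
    using A_kill Fn A_F[OF that] by blast
  \<comment> \<open>Since \<open>A m\<close> squares to 0 on \<open>E\<close>, this is the inverse
    of \<open>I + A m\<close> there.\<close>
  define B where "B m t = t - A m t" for m t
  have B: "Vector_Spaces.linear scl scl (B m)" for m
    unfolding B_def by (intro op.linear_compose_sub linear_ident A)
  have AE: "A m t \<in> E" if "t \<in> E" for m t using FE A_F[OF that] .
  have B_inv: "B m t + A m (B m t) = t" if "t \<in> E" for m t
    by (simp add: B_def op.linear_diff[OF A] AA0[OF that])
  define N' where "N' m t = B m (N (t + A m t))" for m t
  have N': "Vector_Spaces.linear scl scl (N' m)" for m
    using op.linear_add[OF N] op.linear_scale[OF N] op.linear_add[OF A] op.linear_scale[OF A]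
      op.linear_add[OF B] op.linear_scale[OF B]
    by (simp add: N'_def Vector_Spaces.linear_iff vector_space_axioms algebra_simps)
  have N'_B: "N' m (B m t) = B m (N t)" if "t \<in> E" for m t
    by (simp add: N'_def B_inv[OF that])
  define T where "T = id_plus N"
  have T: "Vector_Spaces.linear scl scl (T ^^ j)" for j
    unfolding T_def by (intro linear_funpow linear_id_plus N)
  have TE: "(T ^^ j) t \<in> E" if "t \<in> E" for j t
    by (rule funpow_in_E) (auto simp: T_def id_plus_def that intro: span_add NE)
  have conj: "(id_plus (N' m) ^^ j) (B m t) = B m ((T ^^ j) t)" if "t \<in> E" for m j t
  proof (induction j)
    case (Suc j)
    have "id_plus (N' m) (B m w) = B m (T w)" if "w \<in> E" for w
      by (simp only: id_plus_def N'_B[OF that] T_def op.linear_add[OF B])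
    then show ?case using Suc TE[OF that, of j] by simp
  qed simp
  have vE: "v m \<in> E" for m unfolding v_def by (intro span_sum span_scale gE)
  have h0: "h 0 = ?u" using npos by (simp add: h_def)
  have A_u: "A m ?u = v m" for m using A_h[of m 0] npos by (simp add: h0)
  have A_v: "A m (v m) = 0" for m using A_kill v_pow[of 0] by simp
  \<comment> \<open>\<open>B m\<close> intertwines \<open>N\<close> with \<open>N' m\<close> and
    maps \<open>u + v\<close> to \<open>u\<close>; so the new orbit of \<open>u\<close> is the image
    under \<open>B m\<close> of the old orbit of \<open>u + v\<close>, which is the one that has
    been steered.\<close>
  have u_B: "?u = B m (?u + v m)" for m
    by (simp add: B_def op.linear_add[OF A] A_u A_v)
  have uv_sum: "?u + v m = (\<Sum>i\<le>R. scl (y i + c m i) (g i))" for m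
    by (subst u_sum) (simp add: v_def scale_left_distrib sum.distrib)
  have orbit: "(id_plus (N' m) ^^ j) ?u = B m ((T ^^ j) (?u + v m))" for m j
    using conj[of "?u + v m" j m] u_B[of m] by (simp add: span_add vE)
  define g' where "g' m i = B m (g i)" for m i
  have g'_high: "g' m i = g i" if "n \<le> i" for m i
    using A_kill[of "g i" m] that by (simp add: g'_def B_def span_base)
  have state: "jordan_state (N' m) (g' m) (Suc R)" for m
    unfolding jordan_state_def
  proof (intro conjI allI impI)
    show "Vector_Spaces.linear scl scl (N' m)" by (rule N')
    show "N' m (g' m 0) = 0"
      by (simp add: g'_def N'_B gE N_g0[OF st] op.linear_0[OF B])
    show "N' m (g' m (Suc i)) = g' m i" for i
      by (simp add: g'_def N'_B gE N_gSuc[OF st])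
    show "\<exists>a. a \<noteq> 0 \<and> g' m i = scl a (e i)" if "Suc R \<le> i" for i
      using g_high[OF st, of i] g'_high[of i m] that R by auto
    show "0 < Suc R" by simp
    show "\<exists>x. x (Suc R - 1) \<noteq> 0 \<and> ?u = (\<Sum>i<Suc R. scl (x i) (g' m i))"
    proof (intro exI[of _ "\<lambda>i. y i + c m i"] conjI)
      show "y (Suc R - 1) + c m (Suc R - 1) \<noteq> 0"
        using c(2) R npos by (simp add: y_def)
      have "?u = B m (\<Sum>i\<le>R. scl (y i + c m i) (g i))"
        using u_B[of m] by (simp only: uv_sum)
      then show "?u = (\<Sum>i<Suc R. scl (y i + c m i) (g' m i))"
        by (simp add: op.linear_sum[OF B] op.linear_scale[OF B] g'_def lessThan_Suc_atMost)
    qed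
    \<comment> \<open>\<open>B m\<close> changes a chain vector only by elements of the span of
      \<open>g n, ..., g R\<close>, which \<open>B m\<close> fixes; hence the old and the new block
      span the same space.\<close>
    have A_g: "A m (g i) \<in> span (g ` {n..R})" for i
    proof (rule linear_maps_span[OF A])
      show "g i \<in> span (range h)" using gE by (simp add: span_h)
      fix b assume "b \<in> range h"
      then obtain k where k: "b = h k" by blast
      have "(N ^^ k) (v m) \<in> span (g ` {n..R})" if "k < n"
      proof -
        have "(N ^^ k) (v m) = (\<Sum>j\<le>R. scl (c m j) ((N ^^ k) (g j)))"
          by (simp add: v_def op.linear_sum[OF Npow] op.linear_scale[OF Npow])
        moreover have "scl (c m j) ((N ^^ k) (g j)) \<in> span (g ` {n..R})" if "j \<le> R" for j
        proof (cases "j < 2 * n")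
          case True
          then show ?thesis using c(1)[of j m] by (simp add: span_zero)
        next
          case False
          then have "(N ^^ k) (g j) = g (j - k)" "n \<le> j - k" "j - k \<le> R"
            using that \<open>k < n\<close> by (auto simp: N_pow_g[OF st])
          then show ?thesis by (simp add: span_scale span_base)
        qed
        ultimately show ?thesis by (simp only: ) (intro span_sum, simp)
      qed
      then show "A m b \<in> span (g ` {n..R})" by (simp add: k A_h span_zero)
    qed
    have sub: "span (g ` {n..R}) \<subseteq> span (g' m ` {..<Suc R})"
    proof (intro span_minimal subspace_span subsetI)
      fix b assume "b \<in> g ` {n..R}"
      then obtain i where "n \<le> i" "i \<le> R" "b = g i" by auto
      then have "b = g' m i" "i < Suc R" using g'_high[of i m] by auto
      then show "b \<in> span (g' m ` {..<Suc R})" by (simp add: span_base)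
    qed
    have "span (g' m ` {..<Suc R}) = span (g ` {..<Suc R})"
    proof (rule antisym)
      show "span (g' m ` {..<Suc R}) \<subseteq> span (g ` {..<Suc R})"
      proof (intro span_minimal subspace_span subsetI)
        fix b assume "b \<in> g' m ` {..<Suc R}"
        then obtain i where i: "i < Suc R" "b = g i - A m (g i)" by (auto simp: g'_def B_def)
        have "span (g ` {n..R}) \<subseteq> span (g ` {..<Suc R})" by (intro span_mono image_mono) auto
        then have "A m (g i) \<in> span (g ` {..<Suc R})" using A_g[of i] by blast
        moreover have "g i \<in> span (g ` {..<Suc R})" using i(1) by (simp add: span_base)
        ultimately show "b \<in> span (g ` {..<Suc R})" unfolding i(2) by (intro span_diff)
      qed
      show "span (g ` {..<Suc R}) \<subseteq> span (g' m ` {..<Suc R})"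
      proof (intro span_minimal subspace_span subsetI)
        fix b assume "b \<in> g ` {..<Suc R}"
        then obtain i where i: "i < Suc R" "b = g' m i + A m (g i)" by (auto simp: g'_def B_def)
        have "A m (g i) \<in> span (g' m ` {..<Suc R})" using A_g[of i] sub by blast
        moreover have "g' m i \<in> span (g' m ` {..<Suc R})" using i(1) by (simp add: span_base)
        ultimately show "b \<in> span (g' m ` {..<Suc R})" unfolding i(2) by (intro span_add)
      qed
    qed
    then show "span (g' m ` {..<Suc R}) = span (e ` {..<Suc R})"
      using span_g[OF st, of "Suc R"] R by simp
  qed
  have same_orbit: "N' m ((N ^^ i) ?u) = N ((N ^^ i) ?u)" if i: "Suc i < n" for i m
  proof -
    have "N ((N ^^ i) ?u + A m ((N ^^ i) ?u)) = (N ^^ Suc i) ?u + (N ^^ Suc i) (v m)"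
      using A_h[of m i] h_low[of i] i by (simp add: op.linear_add[OF N])
    moreover have "A m ((N ^^ Suc i) ?u) = (N ^^ Suc i) (v m)"
      using A_h[of m "Suc i"] h_low[OF i] i by simp
    moreover have "A m ((N ^^ Suc i) (v m)) = 0"
      using A_kill v_pow[of "Suc i" m] i by simp
    ultimately show ?thesis
      by (simp only: N'_def B_def op.linear_add[OF A]) simp
  qed
  have same_high: "N' m (e k) = N (e k)" if k: "n < k" for k m
  proof -
    have "A m (e k) = 0" using A_h[of m k] h_high[of k] k by simp
    moreover have "A m (N (e k)) = 0"
    proof -
      obtain i where i: "k = Suc i" "n \<le> i" using k by (cases k) auto
      obtain a where a: "a \<noteq> 0" "g k = scl a (e k)" using g_high[OF st, of k] k by auto
      have "scl a (A m (N (e k))) = A m (N (g k))"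
        by (simp add: a(2) op.linear_scale[OF A] op.linear_scale[OF N])
      also have "\<dots> = 0" using A_kill[of "g i" m] i by (simp add: N_gSuc[OF st] span_base)
      finally show ?thesis using a(1) by simp
    qed
    ultimately show ?thesis by (simp add: N'_def B_def)
  qed
  have conv_LA: "converges (\<lambda>m. L (A m t)) 0" if L: "Vector_Spaces.linear scl scl L" for L t
  proof -
    have "converges (\<lambda>m. \<Sum>j\<le>R. scl (c m j) (L (AA j t))) 0"
      by (intro converges_0_sum converges_0_scale c(3))
    then show ?thesis by (simp add: A_def op.linear_sum[OF L] op.linear_scale[OF L])
  qed
  have conv_A: "converges (\<lambda>m. A m t) 0" for t
    using conv_LA[OF linear_ident, of t] .
  \<comment> \<open>Both the map and its argument vary with \<open>m\<close>. The bilinear expansion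
    has fixed vectors and products of null sequences as coefficients.\<close>
  have conv_Aw: "converges (\<lambda>m. A m (\<Sum>j\<le>R. scl (b m j) (w j))) 0"
    if b: "\<And>j. (\<lambda>m. b m j) \<longlonglongrightarrow> 0" for b w
  proof -
    have "converges (\<lambda>m. \<Sum>j\<le>R. \<Sum>i\<le>R. scl (b m j * c m i) (AA i (w j))) 0"
      using tendsto_mult[OF b c(3)] by (intro converges_0_sum converges_0_scale) simp
    moreover have "A m (\<Sum>j\<le>R. scl (b m j) (w j)) = (\<Sum>j\<le>R. \<Sum>i\<le>R. scl (b m j * c m i) (AA i (w j)))" for m
      by (simp only: op.linear_sum[OF A] op.linear_scale[OF A]) (simp add: A_def scale_sum_right)
    ultimately show ?thesis by simp
  qed
  have conv1: "converges (\<lambda>m. N' m (e k) - N (e k)) 0" for k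
  proof -
    have "N' m (e k) - N (e k) = N (A m (e k)) - A m (N (e k))" for m
    proof -
      have "A m (N (A m (e k))) = 0" using A_kill NF A_F[of "e k" m] by simp
      then show ?thesis by (simp add: N'_def B_def op.linear_add[OF N] op.linear_add[OF A])
    qed
    then show ?thesis using converges_0_diff[OF conv_LA[OF N] conv_A] by simp
  qed
  have conv2: "converges (\<lambda>m. (id_plus (N' m) ^^ j) ?u - (T ^^ j) ?u) 0" for j
  proof -
    have Tv: "(T ^^ j) (v m) = (\<Sum>i\<le>R. scl (c m i) ((T ^^ j) (g i)))" for m
      by (simp add: v_def op.linear_sum[OF T] op.linear_scale[OF T])
    have "converges (\<lambda>m. (T ^^ j) (v m)) 0"
      unfolding Tv by (intro converges_0_sum converges_0_scale c(3))
    moreover have "converges (\<lambda>m. A m ((T ^^ j) (v m))) 0"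
      unfolding Tv by (rule conv_Aw[OF c(3)])
    ultimately have "converges (\<lambda>m. (T ^^ j) (v m) - A m ((T ^^ j) ?u) - A m ((T ^^ j) (v m))) 0"
      using conv_A by (intro converges_0_diff)
    moreover have "(id_plus (N' m) ^^ j) ?u - (T ^^ j) ?u
        = (T ^^ j) (v m) - A m ((T ^^ j) ?u) - A m ((T ^^ j) (v m))" for m
      by (simp add: orbit B_def op.linear_add[OF T] op.linear_add[OF A])
    ultimately show ?thesis by simp
  qed
  have conv3: "converges (\<lambda>m. (id_plus (N' m) ^^ m) ?u - z) 0"
  proof -
    define b where "b m i = (add_shift ^^ m) (\<lambda>i. y i + c m i) i - zc i" for m i
    have b: "(\<lambda>m. b m i) \<longlonglongrightarrow> 0" for i
      using tendsto_diff[OF c(4) tendsto_const, of i "zc i"] by (simp add: b_def)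
    define w where "w m = (\<Sum>i\<le>R. scl (b m i) (g i))" for m
    have Tm: "(T ^^ m) (?u + v m) = w m + z" for m
    proof -
      have "y i + c m i = 0" if "R < i" for i
        using c(1) that R npos by (simp add: y_def)
      then have "(T ^^ m) (?u + v m) = (\<Sum>i\<le>R. scl ((add_shift ^^ m) (\<lambda>i. y i + c m i) i) (g i))"
        using id_plus_pow_g_sum[OF st, of R "\<lambda>i. y i + c m i" m] by (simp add: T_def uv_sum)
      moreover have "z = (\<Sum>i\<le>R. scl (zc i) (g i))" using zc(2) R by (simp add: q_def)
      ultimately show ?thesis
        by (simp add: w_def b_def scale_left_diff_distrib sum_subtractf)
    qed
    have "converges (\<lambda>m. w m) 0"
      unfolding w_def by (intro converges_0_sum converges_0_scale b)
    moreover have "converges (\<lambda>m. A m (w m)) 0"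
      unfolding w_def by (rule conv_Aw[OF b])
    ultimately have "converges (\<lambda>m. w m - A m (w m) - A m z) 0"
      using conv_A by (intro converges_0_diff)
    moreover have "(id_plus (N' m) ^^ m) ?u - z = w m - A m (w m) - A m z" for m
      by (simp add: orbit Tm B_def op.linear_add[OF A])
    ultimately show ?thesis by simp
  qed
  have "\<forall>\<^sub>F m in sequentially. \<forall>k\<in>{..n}. p k (N' m (e k) - N (e k)) < d / C k"
    using d C_pos by (intro eventually_ball_finite ballI converges_0_eventually conv1) auto
  moreover have "\<forall>\<^sub>F m in sequentially. \<forall>j\<in>{..M}. p s ((id_plus (N' m) ^^ j) ?u - (T ^^ j) ?u) < d"
    using d by (intro eventually_ball_finite ballI converges_0_eventually conv2) auto
  moreover have "\<forall>\<^sub>F m in sequentially. p s ((id_plus (N' m) ^^ m) ?u - z) < d"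
    using d by (intro converges_0_eventually conv3)
  ultimately have "\<forall>\<^sub>F m in sequentially. (\<forall>k\<in>{..n}. p k (N' m (e k) - N (e k)) < d / C k)
      \<and> (\<forall>j\<in>{..M}. p s ((id_plus (N' m) ^^ j) ?u - (T ^^ j) ?u) < d)
      \<and> p s ((id_plus (N' m) ^^ m) ?u - z) < d"
    by (intro eventually_conj)
  then obtain m where m: "\<And>k. k \<le> n \<Longrightarrow> p k (N' m (e k) - N (e k)) < d / C k"
    "\<And>j. j \<le> M \<Longrightarrow> p s ((id_plus (N' m) ^^ j) ?u - (T ^^ j) ?u) < d"
    "p s ((id_plus (N' m) ^^ m) ?u - z) < d"
    unfolding eventually_sequentially by force
  show thesis
  proof (rule that[OF state[of m], of m])
    show "n < Suc R" using R npos by simp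
    show "C k * p k (N' m (e k) - N (e k)) \<le> d" if "k \<le> n" for k
      using m(1)[OF that] C_pos[of k] by (simp add: field_simps)
  qed (use same_orbit same_high m(2,3) in \<open>auto simp: T_def intro: less_imp_le\<close>)
qed


lemma ex_initial_jordan_state:
  obtains N g where "jordan_state N g 1" "\<And>k. C k * p k (N (e k)) \<le> (1/2) ^ Suc k"
proof -
  \<comment> \<open>Weights of a backward shift. The exponent \<open>k + 2\<close> is the bound
    required of column \<open>Suc k\<close>, and adding 1 keeps the denominator positive even if the
    seminorm vanishes.\<close>
  define \<zeta> where "\<zeta> k = (1/2) ^ (k + 2) / (C (Suc k) * p (Suc k) (e k) + 1)" for k
  have den: "0 < C (Suc k) * p (Suc k) (e k) + 1" for k
    using C_pos[of "Suc k"] by (simp add: add_nonneg_pos)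
  have \<zeta>: "0 < \<zeta> k" for k unfolding \<zeta>_def using den[of k] by (intro divide_pos_pos) simp_all
  have \<zeta>_le: "C (Suc k) * p (Suc k) (e k) * \<zeta> k \<le> (1/2) ^ (k + 2)" for k
  proof -
    have "C (Suc k) * p (Suc k) (e k) * \<zeta> k \<le> (C (Suc k) * p (Suc k) (e k) + 1) * \<zeta> k"
      using \<zeta>[of k] by (intro mult_right_mono) auto
    also have "\<dots> = (1/2) ^ (k + 2)" unfolding \<zeta>_def times_divide_eq_right using den[of k]
      by (intro nonzero_mult_div_cancel_left) simp
    finally show ?thesis .
  qed
  obtain N where N: "Vector_Spaces.linear scl scl N"
    "\<And>k. N (e k) = (if k = 0 then 0 else scl (of_real (\<zeta> (k - 1))) (e (k - 1)))"
    using ex_linear_on_family[OF inj_e independent_e,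
        of "\<lambda>k. if k = 0 then 0 else scl (of_real (\<zeta> (k - 1))) (e (k - 1))"] by blast
  define w where "w i = (\<Prod>j<i. \<zeta> j)" for i
  have w: "0 < w i" for i unfolding w_def using \<zeta> by (intro prod_pos) auto
  define g where "g i = scl (of_real (inverse (w i))) (e i)" for i
  have g0: "g 0 = e 0" by (simp add: g_def w_def)
  show thesis
  proof (rule that[of N g])
    show "jordan_state N g 1" unfolding jordan_state_def
    proof (intro conjI allI impI N(1))
      show "N (g 0) = 0" by (simp add: g0 N(2))
      show "N (g (Suc i)) = g i" for i
      proof -
        have "inverse (w (Suc i)) * \<zeta> i = inverse (w i)"
          using \<zeta>[of i] w[of i] by (simp add: w_def)
        then have "of_real (inverse (w (Suc i))) * of_real (\<zeta> i) = (of_real (inverse (w i)) :: 'k)"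
          by (metis of_real_mult)
        then show ?thesis by (simp only: g_def op.linear_scale[OF N(1)] N(2)) simp
      qed
      show "span (g ` {..<1}) = span (e ` {..<1})" by (simp add: lessThan_Suc g0)
      show "\<exists>c. c \<noteq> 0 \<and> g i = scl c (e i)" for i
        using w[of i] by (intro exI[of _ "of_real (inverse (w i))"]) (simp add: g_def)
      show "\<exists>x. x (1 - 1) \<noteq> 0 \<and> e 0 = (\<Sum>i<1. scl (x i) (g i))"
        by (intro exI[of _ "\<lambda>_. 1"]) (simp add: g0)
    qed simp
    show "C k * p k (N (e k)) \<le> (1/2) ^ Suc k" for k
    proof (cases k)
      case (Suc j)
      then show ?thesis using \<zeta>_le[of j] \<zeta>[of j] by (simp add: N(2) mult_ac)
    qed (simp add: N(2))
  qed
qed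

lemma hypercyclic_bounded_levels:
  fixes z :: "nat \<Rightarrow> 'a"
  assumes levels: "\<And>k. lev k \<le> L"
    and zE: "\<And>s. z s \<in> E"
    and z: "\<And>y n d s0. y \<in> E \<Longrightarrow> 0 < d \<Longrightarrow> \<exists>s\<ge>s0. p n (z s - y) < d"
  shows "\<exists>T. bounded_operator T \<and> T ` E \<subseteq> E \<and> (\<forall>x\<in>E - {0}. dense_orbit T x)"
proof -
  let ?u = "e 0"
  \<comment> \<open>Column \<open>k\<close> has the total budget \<open>(1/2) ^ k\<close>, of which
    half is spent initially and \<open>(1/2) ^ (k + s + 2)\<close> at most in stage
    \<open>s\<close>. The component \<open>M\<close> bounds the times up to which the orbit must be
    preserved.\<close>
  define ok where "ok s \<sigma> \<longleftrightarrow> (case \<sigma> of (N, g, n, M) \<Rightarrow> jordan_state N g n \<and> s < n \<and>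
    (\<forall>k. C k * p k (N (e k)) \<le> (1/2) ^ k * (1 - (1/2) ^ Suc s)))"
    for s :: nat and \<sigma> :: "('a \<Rightarrow> 'a) \<times> (nat \<Rightarrow> 'a) \<times> nat \<times> nat"
  define step where "step s \<sigma> \<sigma>' \<longleftrightarrow> (case \<sigma> of (N, g, n, M) \<Rightarrow> case \<sigma>' of (N', g', n', M') \<Rightarrow>
      n < n' \<and> M \<le> M' \<and> (\<forall>i. Suc i < n \<longrightarrow> N' ((N ^^ i) ?u) = N ((N ^^ i) ?u)) \<and>
      (\<forall>j\<le>M. p s ((id_plus N' ^^ j) ?u - (id_plus N ^^ j) ?u) \<le> (1/2) ^ s) \<and>
      (\<exists>m\<le>M'. p s ((id_plus N' ^^ m) ?u - z s) \<le> (1/2) ^ s))"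
    for s :: nat and \<sigma> \<sigma>' :: "('a \<Rightarrow> 'a) \<times> (nat \<Rightarrow> 'a) \<times> nat \<times> nat"
  have "\<exists>\<Sigma>. \<forall>s. ok s (\<Sigma> s) \<and> step s (\<Sigma> s) (\<Sigma> (Suc s))"
  proof (rule dependent_nat_choice)
    obtain N g where "jordan_state N g 1" "\<And>k. C k * p k (N (e k)) \<le> (1/2) ^ Suc k"
      by (rule ex_initial_jordan_state) blast
    then have "ok 0 (N, g, 1, 0)" by (simp add: ok_def)
    then show "\<exists>\<sigma>. ok 0 \<sigma>" by blast
  next
    fix \<sigma> s assume ok: "ok s \<sigma>"
    obtain N g n M where \<sigma>: "\<sigma> = (N, g, n, M)" by (cases \<sigma>) auto
    have st: "jordan_state N g n" and sn: "s < n"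
      and col: "\<And>k. C k * p k (N (e k)) \<le> (1/2) ^ k * (1 - (1/2) ^ Suc s)"
      using ok by (auto simp: ok_def \<sigma>)
    \<comment> \<open>Only columns \<open>k \<le> n\<close> change, so this one constant respects
      the budget of each of them as well as the orbit tolerance \<open>(1/2) ^ s\<close>.\<close>
    define d :: real where "d = (1/2) ^ (n + s + 2)"
    have d: "0 < d" by (simp add: d_def)
    have d_le: "d \<le> (1/2) ^ s" unfolding d_def by (rule power_decreasing) auto
    obtain N' g' n' m where N': "jordan_state N' g' n'" "n < n'"
      "\<And>i. Suc i < n \<Longrightarrow> N' ((N ^^ i) ?u) = N ((N ^^ i) ?u)"
      "\<And>k. n < k \<Longrightarrow> N' (e k) = N (e k)"
      "\<And>k. k \<le> n \<Longrightarrow> C k * p k (N' (e k) - N (e k)) \<le> d"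
      "\<And>j. j \<le> M \<Longrightarrow> p s ((id_plus N' ^^ j) ?u - (id_plus N ^^ j) ?u) \<le> d"
      "p s ((id_plus N' ^^ m) ?u - z s) \<le> d"
      using jordan_stage[OF st zE d, of M s s] by blast
    have "C k * p k (N' (e k)) \<le> (1/2) ^ k * (1 - (1/2) ^ Suc (Suc s))" for k
    proof -
      have "C k * p k (N' (e k) - N (e k)) \<le> (1/2) ^ k * (1/2) ^ Suc (Suc s)"
      proof (cases "k \<le> n")
        case True
        have "d \<le> (1/2) ^ (k + Suc (Suc s))"
          unfolding d_def using True by (intro power_decreasing) auto
        then show ?thesis using N'(5)[OF True] by (simp add: power_add)
      qed (simp add: N'(4))
      moreover have "p k (N' (e k)) \<le> p k (N' (e k) - N (e k)) + p k (N (e k))"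
        using p_add[of k "N' (e k) - N (e k)" "N (e k)"] by simp
      then have "C k * p k (N' (e k)) \<le> C k * p k (N' (e k) - N (e k)) + C k * p k (N (e k))"
        using C_pos[of k] by (simp flip: distrib_left)
      ultimately have "C k * p k (N' (e k)) \<le> (1/2) ^ k * (1/2) ^ Suc (Suc s) + (1/2) ^ k * (1 - (1/2) ^ Suc s)"
        using col[of k] by linarith
      then show ?thesis by (simp add: algebra_simps)
    qed
    then have "ok (Suc s) (N', g', n', max M m)"
      using N'(1,2) sn by (simp add: ok_def)
    moreover have "step s \<sigma> (N', g', n', max M m)"
      using N'(2,3,6,7) d_le by (auto simp: step_def \<sigma> intro: order_trans intro!: exI[of _ m])
    ultimately show "\<exists>\<sigma>'. ok (Suc s) \<sigma>' \<and> step s \<sigma> \<sigma>'" by blast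
  qed
  then obtain \<Sigma> where \<Sigma>: "\<And>s. ok s (\<Sigma> s)" "\<And>s. step s (\<Sigma> s) (\<Sigma> (Suc s))" by blast
  define N g n M where "N s = fst (\<Sigma> s)" and "g s = fst (snd (\<Sigma> s))"
    and "n s = fst (snd (snd (\<Sigma> s)))" and "M s = snd (snd (snd (\<Sigma> s)))" for s
  have st: "jordan_state (N s) (g s) (n s)" and sn: "s < n s"
    and col: "C k * p k (N s (e k)) \<le> (1/2) ^ k * (1 - (1/2) ^ Suc s)" for s k
    using \<Sigma>(1)[of s] by (auto simp: ok_def N_def g_def n_def M_def split: prod.splits)
  have n_less: "n s < n (Suc s)" and M_le: "M s \<le> M (Suc s)"
    and same: "Suc i < n s \<Longrightarrow> N (Suc s) ((N s ^^ i) ?u) = N s ((N s ^^ i) ?u)"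
    and keep: "j \<le> M s \<Longrightarrow> p s ((id_plus (N (Suc s)) ^^ j) ?u - (id_plus (N s) ^^ j) ?u) \<le> (1/2) ^ s"
    and hit: "\<exists>m\<le>M (Suc s). p s ((id_plus (N (Suc s)) ^^ m) ?u - z s) \<le> (1/2) ^ s" for s i j
    using \<Sigma>(2)[of s] by (auto simp: step_def N_def g_def n_def M_def split: prod.splits)
  have linN: "Vector_Spaces.linear scl scl (N s)" for s by (rule linear_N[OF st])
  have NE: "x \<in> E \<Longrightarrow> N s x \<in> E" for s x by (rule N_in_E[OF st])
  have n_mono: "n s \<le> n t" if "s \<le> t" for s t
    by (rule lift_Suc_mono_le[of n, OF _ that]) (rule less_imp_le[OF n_less])
  have M_mono: "M s \<le> M t" if "s \<le> t" for s t
    by (rule lift_Suc_mono_le[of M, OF M_le that])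
  have orbit: "(N t ^^ i) ?u = (N s ^^ i) ?u" if "s \<le> t" "i < n s" for s t i
    using that
  proof (induction t rule: dec_induct)
    case (step t)
    have "(N (Suc t) ^^ i) ?u = (N t ^^ i) ?u" if "i < n t" for i
      using that by (induction i) (auto simp: same)
    then show ?case using step n_mono[of s t] by auto
  qed simp
  \<comment> \<open>\<open>e k\<close> lies in the span of the first \<open>n k\<close> orbit
    vectors of \<open>u\<close>. From stage \<open>Suc k\<close> on, the strict growth of
    \<open>n\<close> gives \<open>Suc i < n t\<close> for all their indices \<open>i\<close>, so
    later stages leave \<open>N\<close> unchanged on them.\<close>
  have stable_N: "N t (e k) = N (Suc k) (e k)" if "Suc k \<le> t" for t k
    using that
  proof (induction t rule: dec_induct)
    case (step t)
    have "N (Suc t) y = N t y" if "y \<in> span ((\<lambda>i. (N k ^^ i) ?u) ` {..<n k})" for y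
    proof (rule op.linear_eq_on_span[OF linN linN _ that])
      fix b assume "b \<in> (\<lambda>i. (N k ^^ i) ?u) ` {..<n k}"
      then obtain i where i: "i < n k" "b = (N k ^^ i) ?u" by blast
      have "b = (N t ^^ i) ?u" using orbit[of k t i] i step by simp
      moreover have "Suc i < n t"
        using i(1) n_less[of k] n_mono[of "Suc k" t] step by linarith
      ultimately show "N (Suc t) b = N t b" using same by simp
    qed
    then show ?case using step e_in_orbit_span[OF st, of k k] sn[of k] by simp
  qed simp
  define T where "T s = id_plus (N s)" for s
  have T: "Vector_Spaces.linear scl scl (T s)" for s
    unfolding T_def by (intro linear_id_plus linN)
  have stable: "\<exists>s0. \<forall>s\<ge>s0. T s (e k) = T s0 (e k)" for k
  proof (intro exI allI impI)
    fix s assume "Suc k \<le> s"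
    from stable_N[OF this] show "T s (e k) = T (Suc k) (e k)" by (simp only: T_def id_plus_def)
  qed
  have TE: "T s (e k) \<in> E" for s k
    by (simp add: T_def id_plus_def span_add NE)
  obtain m where m: "\<And>s. m s \<le> M (Suc s)" "\<And>s. p s ((T (Suc s) ^^ m s) ?u - z s) \<le> (1/2) ^ s"
    using hit unfolding T_def by metis
  have keep': "p s ((T (Suc s) ^^ m i) ?u - (T s ^^ m i) ?u) \<le> (1/2) ^ s" if "i < s" for s i
    unfolding T_def using m(1)[of i] M_mono[of "Suc i" s] that by (intro keep) simp
  obtain S where S: "Vector_Spaces.linear scl scl S"
    "\<And>k. \<exists>s0. \<forall>s\<ge>s0. T s (e k) = S (e k)" "\<And>x. x \<in> E \<Longrightarrow> \<exists>s0. \<forall>s\<ge>s0. T s x = S x"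
    "\<And>y n d. y \<in> E \<Longrightarrow> 0 < d \<Longrightarrow> \<exists>i. p n ((S ^^ i) ?u - y) < d"
    using stage_limit[OF T TE stable e_in_E m(2) keep' z] by blast
  have SE: "S (e k) \<in> E" for k
  proof -
    obtain s0 where "\<forall>s\<ge>s0. T s (e k) = S (e k)" using S(2) by blast
    then have "S (e k) = T s0 (e k)" by simp
    then show ?thesis by (simp add: TE)
  qed
  have small: "C k * p k (S (e k) - scl 1 (e k)) \<le> (1/2) ^ k" for k
  proof -
    obtain s0 where "\<forall>s\<ge>s0. T s (e k) = S (e k)" using S(2) by blast
    then have "S (e k) = e k + N s0 (e k)" by (metis T_def id_plus_def order_refl)
    then have "C k * p k (S (e k) - scl 1 (e k)) \<le> (1/2) ^ k * (1 - (1/2) ^ Suc s0)"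
      using col[of k s0] by simp
    also have "\<dots> \<le> (1/2) ^ k * 1" by (intro mult_left_mono) auto
    finally show ?thesis by simp
  qed
  have bd: "\<exists>m M. 0 \<le> M \<and> (\<forall>x\<in>E. p n (S x) \<le> M * p m x)" for n
  proof (rule columns_bounded[OF S(1), of 1])
    show "\<exists>m. \<forall>k. p n (S (e k) - scl 1 (e k)) \<noteq> 0 \<longrightarrow> lev k \<le> m" for n
      using levels by blast
    show "\<exists>k0. \<forall>k\<ge>k0. C k * p n (S (e k) - scl 1 (e k)) \<le> (1/2) ^ k" for n
    proof (intro exI[of _ n] allI impI)
      fix k assume "n \<le> k"
      then have "C k * p n (S (e k) - scl 1 (e k)) \<le> C k * p k (S (e k) - scl 1 (e k))"
        using C_pos[of k] by (intro mult_left_mono p_mono) auto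
      then show "C k * p n (S (e k) - scl 1 (e k)) \<le> (1/2) ^ k" using small[of k] by linarith
    qed
  qed
  \<comment> \<open>Since \<open>N y = S y - y\<close> along the stable part of the orbit, the
    vectors \<open>N^i u\<close> lie in the cyclic subspace of \<open>S\<close>; together they span
    \<open>E\<close>.\<close>
  have cyclic: "\<exists>j P. P \<noteq> 0 \<and> (S ^^ j) x = poly_operator P S ?u" if x: "x \<in> E" "x \<noteq> 0" for x
  proof -
    define V where "V = range (\<lambda>P. poly_operator P S ?u)"
    have V: "subspace V" unfolding V_def by (rule subspace_poly_operators)
    have "(N s ^^ i) ?u \<in> V" if "i < n s" for s i
      using that
    proof (induction i)
      case 0
      then show ?case by (simp add: V_def poly_operators_base)
    next
      case (Suc i)
      define y where "y = (N s ^^ i) ?u"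
      have yE: "y \<in> E" unfolding y_def by (rule funpow_in_E) (simp_all add: NE)
      obtain s0 where s0: "\<And>t. s0 \<le> t \<Longrightarrow> T t y = S y" using S(3)[OF yE] by blast
      define t where "t = max s s0"
      have "S y = y + N t y" using s0[of t] by (simp add: t_def T_def id_plus_def)
      moreover have "N t y = (N s ^^ Suc i) ?u"
        using orbit[of s t i] orbit[of s t "Suc i"] Suc.prems by (simp add: y_def t_def)
      ultimately have "(N s ^^ Suc i) ?u = S y - y" by simp
      moreover have "y \<in> V" using Suc by (simp add: y_def)
      then have "S y \<in> V" "y \<in> V" using poly_operators_closed[OF S(1)] by (auto simp: V_def)
      ultimately show ?case using subspace_diff[OF V] by simp
    qed
    then have sub: "span ((\<lambda>i. (N s ^^ i) ?u) ` {..<n s}) \<subseteq> V" for s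
      using V by (intro span_minimal) auto
    have "e k \<in> V" for k
      using e_in_orbit_span[OF st sn[of k]] sub[of k] by blast
    then have "E \<subseteq> V" using V by (intro span_minimal) auto
    then obtain P where P: "x = poly_operator P S ?u" using x(1) by (auto simp: V_def)
    moreover have "P \<noteq> 0" using P x(2) by (auto simp: poly_operator_def)
    ultimately show ?thesis by (intro exI[of _ 0] exI[of _ P]) simp
  qed
  show ?thesis
    by (rule hypercyclic_extension[OF S(1) SE e_in_E bd S(4) cyclic])
qed

end

section \<open>Bases of unbounded level\<close>

locale two_chains = graded_basis scl p emb e f lev C
  for scl :: "'k::real_normed_field \<Rightarrow> 'a::ab_group_add \<Rightarrow> 'a" and p emb e f lev C +
  fixes \<alpha> \<beta> :: "nat \<Rightarrow> nat"
  assumes inj_\<alpha>: "inj \<alpha>" and inj_\<beta>: "inj \<beta>"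
    and disjoint: "range \<alpha> \<inter> range \<beta> = {}" and cover: "range \<alpha> \<union> range \<beta> = UNIV"
    and finite_\<beta>: "finite {j. lev (\<beta> j) \<le> L}"
    and levels_\<alpha>: "\<exists>M. \<forall>k. lev (\<alpha> (Suc k)) \<le> L \<longrightarrow> lev (\<alpha> k) \<le> M"
begin

definition a :: "nat \<Rightarrow> 'a" where "a k = e (\<alpha> k)"
definition b :: "nat \<Rightarrow> 'a" where "b j = e (\<beta> j)"
abbreviation fa :: "nat \<Rightarrow> 'a \<Rightarrow> 'k" where "fa k \<equiv> f (\<alpha> k)"
abbreviation fb :: "nat \<Rightarrow> 'a \<Rightarrow> 'k" where "fb j \<equiv> f (\<beta> j)"

lemma \<alpha>_neq_\<beta>: "\<alpha> k \<noteq> \<beta> j" "\<beta> j \<noteq> \<alpha> k"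
  using disjoint by (auto simp: disjoint_iff)

lemma coords [simp]:
  "fa k (a j) = (if j = k then 1 else 0)" "fa k (b j) = 0"
  "fb k (a j) = 0" "fb k (b j) = (if j = k then 1 else 0)"
  using inj_\<alpha> inj_\<beta> \<alpha>_neq_\<beta> by (auto simp: a_def b_def f_e inj_eq)

lemma index_cases: obtains (a) k where "i = \<alpha> k" | (b) j where "i = \<beta> j"
  using cover by (metis UNIV_I Un_iff rangeE)

lemma range_e_eq: "range e = range a \<union> range b"
proof -
  have "e ` (range \<alpha> \<union> range \<beta>) = range a \<union> range b"
    by (auto simp: a_def b_def image_iff)
  then show ?thesis by (simp add: cover)
qed

lemma a_in_E [simp]: "a k \<in> E" and b_in_E [simp]: "b j \<in> E"
  by (simp_all add: a_def b_def)

lemma far_b: "\<exists>r. \<forall>j\<ge>r. p n (b j) = 0"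
proof -
  obtain r where "\<forall>j\<in>{j. lev (\<beta> j) \<le> n}. j < r"
    using finite_\<beta>[of n] finite_nat_set_iff_bounded by blast
  then have "n < lev (\<beta> j)" if "r \<le> j" for j using that by (force simp: not_le[symmetric])
  then show ?thesis using p_e by (auto simp: b_def)
qed

lemma p_zero_span:
  assumes "x \<in> span S" "\<And>y. y \<in> S \<Longrightarrow> p n y = 0"
  shows "p n x = 0"
  using assms(1)
proof (induction rule: span_induct_alt)
  case (step c y z)
  have "p n (scl c y + z) \<le> 0"
    using p_add[of n "scl c y" z] step assms(2)[of y] by simp
  then show ?case using p_nonneg[of n "scl c y + z"] by linarith
qed simp

text \<open>\<open>D\<close> is \<open>{..<n}\<close> in the finite stages and \<open>UNIV\<close>
  in the limit, so both share the same facts.\<close>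

definition chain_state :: "('a \<Rightarrow> 'a) \<Rightarrow> nat set \<Rightarrow> bool"
  where "chain_state T D \<longleftrightarrow> Vector_Spaces.linear scl scl T \<and> (\<forall>j. T (b (Suc j)) = b j) \<and> T (b 0) = a 0 \<and>
    (\<forall>k. k \<notin> D \<longrightarrow> T (a k) = 0) \<and>
    (\<forall>k\<in>D. \<exists>\<eta> \<rho>. \<eta> \<noteq> 0 \<and> \<rho> \<in> span (range b) \<and> T (a k) = scl \<eta> (a (Suc k)) + \<rho>)"

lemma fa_span_b: "x \<in> span (range b) \<Longrightarrow> fa k x = 0"
  by (rule functional.linear_eq_0_on_span[OF linear_f]) auto

lemma span_b_E: "x \<in> span (range b) \<Longrightarrow> x \<in> E"
  using span_mono[of "range b" "range e"] by (auto simp: range_e_eq)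

section \<open>Coordinates along the chains, injectivity and cyclicity\<close>

context
  fixes T D
  assumes st: "chain_state T D"
begin

lemma linear_T: "Vector_Spaces.linear scl scl T"
  and T_bSuc: "T (b (Suc j)) = b j" and T_b0: "T (b 0) = a 0"
  and T_a_notin: "k \<notin> D \<Longrightarrow> T (a k) = 0"
  using st by (auto simp: chain_state_def)

lemma T_a_in: "k \<in> D \<Longrightarrow> \<exists>\<eta> \<rho>. \<eta> \<noteq> 0 \<and> \<rho> \<in> span (range b) \<and> T (a k) = scl \<eta> (a (Suc k)) + \<rho>"
  using st by (auto simp: chain_state_def)

lemmas T_pow_linear = linear_funpow[OF linear_T]

lemma T_a_in_E: "T (a k) \<in> E"
proof (cases "k \<in> D")
  case True
  then obtain \<eta> \<rho> where "\<rho> \<in> span (range b)" "T (a k) = scl \<eta> (a (Suc k)) + \<rho>"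
    using T_a_in by blast
  then show ?thesis using span_b_E by (simp add: span_add span_scale)
qed (simp add: T_a_notin span_zero)

lemma T_b_in_E: "T (b j) \<in> E"
  by (cases j) (simp_all add: T_bSuc T_b0)

lemma T_e_in_E: "T (e i) \<in> E"
  using T_a_in_E T_b_in_E by (cases i rule: index_cases) (auto simp: a_def b_def)

lemma T_in_E: "x \<in> E \<Longrightarrow> T x \<in> E"
  using linear_maps_E[OF linear_T T_e_in_E] .

text \<open>Only the column of \<open>a k\<close> has a component along \<open>a (Suc k)\<close>:
  remainders lie in the span of the \<open>b j\<close>, and a \<open>b j\<close> maps to some
  \<open>b\<close> or to \<open>a 0\<close>.\<close>

lemma fa_Suc_T:
  assumes k: "k \<in> D"
  shows "\<exists>\<eta>. \<eta> \<noteq> 0 \<and> (\<forall>x\<in>E. fa (Suc k) (T x) = \<eta> * fa k x)"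
proof -
  obtain \<eta> \<rho> where \<eta>: "\<eta> \<noteq> 0" "\<rho> \<in> span (range b)" "T (a k) = scl \<eta> (a (Suc k)) + \<rho>"
    using T_a_in[OF k] by blast
  have "fa (Suc k) (T x) = \<eta> * fa k x" if "x \<in> E" for x
  proof (rule functional.linear_eq_on_span[OF _ _ _ that])
    show "Vector_Spaces.linear scl (*) (\<lambda>x. fa (Suc k) (T x))"
      by (simp add: Vector_Spaces.linear_iff f_add f_scale op.linear_add[OF linear_T]
          op.linear_scale[OF linear_T] vector_space_axioms functional.vs2.vector_space_axioms)
    show "Vector_Spaces.linear scl (*) (\<lambda>x. \<eta> * fa k x)"
      by (rule functional.linear_compose_scale_right[OF linear_f])
    fix v assume "v \<in> range e"
    then consider j where "v = a j" | j where "v = b j" unfolding range_e_eq by blast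
    then show "fa (Suc k) (T v) = \<eta> * fa k v"
    proof cases
      case (1 j)
      show ?thesis
      proof (cases "j = k")
        case True
        then show ?thesis using \<eta> by (simp add: 1 f_add f_scale fa_span_b)
      next
        case False
        show ?thesis
        proof (cases "j \<in> D")
          case True
          then obtain \<eta>' \<rho>' where "\<rho>' \<in> span (range b)" "T (a j) = scl \<eta>' (a (Suc j)) + \<rho>'"
            using T_a_in by blast
          then show ?thesis using False by (simp add: 1 f_add f_scale fa_span_b)
        qed (use False in \<open>simp add: 1 T_a_notin\<close>)
      qed
    next
      case (2 j)
      then show ?thesis by (cases j) (simp_all add: T_bSuc T_b0)
    qed
  qed
  then show ?thesis using \<eta>(1) by blast
qed

lemma fa_pow_T:
  assumes "\<And>l. l < i \<Longrightarrow> k + l \<in> D"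
  shows "\<exists>c. c \<noteq> 0 \<and> (\<forall>x\<in>E. fa (k + i) ((T ^^ i) x) = c * fa k x)"
  using assms
proof (induction i)
  case 0
  show ?case by (intro exI[of _ 1]) simp
next
  case (Suc i)
  then obtain c where c: "c \<noteq> 0" "\<And>x. x \<in> E \<Longrightarrow> fa (k + i) ((T ^^ i) x) = c * fa k x" by auto
  obtain \<eta> where \<eta>: "\<eta> \<noteq> 0" "\<And>x. x \<in> E \<Longrightarrow> fa (Suc (k + i)) (T x) = \<eta> * fa (k + i) x"
    using fa_Suc_T[of "k + i"] Suc.prems[of i] by auto
  have "fa (k + Suc i) ((T ^^ Suc i) x) = (\<eta> * c) * fa k x" if "x \<in> E" for x
    using \<eta>(2)[OF funpow_in_E[of T x i]] T_in_E that c(2)[OF that] by simp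
  then show ?case using c(1) \<eta>(1) by (intro exI[of _ "\<eta> * c"]) simp
qed

lemma T_pow_b: "(T ^^ i) (b j) = (if i \<le> j then b (j - i) else (T ^^ (i - Suc j)) (a 0))"
proof (induction i)
  case (Suc i)
  consider "i < j" | "i = j" | "j < i" by linarith
  then show ?case
  proof cases
    case 1
    then have "j - i = Suc (j - Suc i)" by simp
    then show ?thesis using Suc 1 by (simp add: T_bSuc)
  next
    case 2
    then show ?thesis using Suc by (simp add: T_b0)
  next
    case 3
    then have "Suc i - Suc j = Suc (i - Suc j)" by simp
    then show ?thesis using Suc 3 by (simp only:) simp
  qed
qed simp

lemma T_pow_b_span:
  assumes "x \<in> span (b ` {J..})" "i \<le> J"
  shows "(T ^^ i) x \<in> span (b ` {J - i..})"
proof (rule linear_maps_span[OF T_pow_linear assms(1)])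
  fix y assume "y \<in> b ` {J..}"
  then obtain j where j: "J \<le> j" "y = b j" by auto
  then have "(T ^^ i) y = b (j - i)" "J - i \<le> j - i" using assms(2) by (auto simp: T_pow_b)
  then show "(T ^^ i) y \<in> span (b ` {J - i..})" by (simp add: span_base)
qed

text \<open>Every coordinate of \<open>x\<close> reappears as a coordinate of \<open>T x\<close>:
  first the \<open>a\<close>-coordinates, up to nonzero factors, and once these vanish the
  \<open>b\<close>-coordinates, which are merely shifted.\<close>

lemma injective_T:
  assumes D: "D = UNIV" and x: "x \<in> E" and Tx: "T x = 0"
  shows "x = 0"
proof -
  have fa0: "fa k x = 0" for k
    using fa_Suc_T[of k] D x Tx by auto
  have "x \<in> span (range b)"
  proof -
    obtain N where N: "x \<in> span (e ` {..<N})" using E_finite x by blast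
    have "scl (f k x) (e k) \<in> span (range b)" for k
      by (cases k rule: index_cases) (auto simp: fa0 span_zero b_def[symmetric] intro!: span_scale intro: span_base)
    then show ?thesis by (subst span_e_expand[OF N]) (intro span_sum)
  qed
  moreover have T_b: "fa 0 (T y) = fb 0 y \<and> (\<forall>j. fb j (T y) = fb (Suc j) y)" if "y \<in> span (range b)" for y
    using that
  proof (induction rule: span_induct_alt)
    case base
    then show ?case by (simp add: op.linear_0[OF linear_T])
  next
    case (step c y z)
    then obtain j where "y = b j" by blast
    then show ?case using step(2)
      by (cases j) (auto simp: f_add f_scale op.linear_add[OF linear_T] op.linear_scale[OF linear_T] T_bSuc T_b0)
  qed
  ultimately have "fb 0 x = 0" "fb (Suc j) x = 0" for j using Tx by force+
  then have "fb j x = 0" for j by (cases j) auto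
  then have "f i x = 0" for i using fa0 by (cases i rule: index_cases) auto
  then show ?thesis using E_eq_0I[OF x] by blast
qed

text \<open>The vectors that some power of \<open>T\<close> carries into the cyclic subspace of
  \<open>a 0\<close> form an invariant subspace \<open>W\<close>. It contains \<open>b j\<close>,
  which reaches \<open>a 0\<close> after \<open>j + 1\<close> steps, and then each
  \<open>a (Suc k)\<close>, obtained from \<open>T (a k)\<close> by removing its remainder.
  Injectivity excludes \<open>P = 0\<close>.\<close>

lemma cyclic_T:
  assumes D: "D = UNIV" and x: "x \<in> E" "x \<noteq> 0"
  shows "\<exists>j P. P \<noteq> 0 \<and> (T ^^ j) x = poly_operator P T (a 0)"
proof -
  define V where "V = range (\<lambda>P. poly_operator P T (a 0))"
  have V: "subspace V" unfolding V_def by (rule subspace_poly_operators)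
  have TV: "(T ^^ i) y \<in> V" if "y \<in> V" for y i
    using that poly_operators_closed[OF linear_T] by (induction i) (auto simp: V_def)
  define W where "W = {y. \<exists>j. (T ^^ j) y \<in> V}"
  have W: "subspace W"
  proof (rule subspaceI)
    show "0 \<in> W" using subspace_0[OF V] by (auto simp: W_def intro: exI[of _ 0])
    fix c y y' assume "y \<in> W"
    then obtain j where j: "(T ^^ j) y \<in> V" unfolding W_def by blast
    then show "scl c y \<in> W"
      using subspace_scale[OF V, of "(T ^^ j) y" c] by (auto simp: W_def op.linear_scale[OF T_pow_linear])
    assume "y' \<in> W"
    then obtain j' where j': "(T ^^ j') y' \<in> V" unfolding W_def by blast
    have "(T ^^ (j' + j)) y \<in> V" "(T ^^ (j + j')) y' \<in> V"
      using TV[OF j, of j'] TV[OF j', of j] by (simp_all add: funpow_add)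
    then have "(T ^^ (j + j')) (y + y') \<in> V"
      using subspace_add[OF V] by (simp add: op.linear_add[OF T_pow_linear] add.commute)
    then show "y + y' \<in> W" by (auto simp: W_def)
  qed
  have TW: "T y \<in> W" if "y \<in> W" for y
  proof -
    obtain j where "(T ^^ j) y \<in> V" using \<open>y \<in> W\<close> unfolding W_def by blast
    then have "(T ^^ j) (T y) \<in> V" using TV[of "(T ^^ j) y" 1] by (simp add: funpow_swap1)
    then show ?thesis by (auto simp: W_def)
  qed
  have a0: "a 0 \<in> V" by (simp add: V_def poly_operators_base)
  have bW: "b j \<in> W" for j
    using a0 T_pow_b[of "Suc j" j] by (auto simp: W_def intro!: exI[of _ "Suc j"])
  then have spanb: "span (range b) \<subseteq> W" using W by (intro span_minimal) auto
  have aW: "a k \<in> W" for k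
  proof (induction k)
    case 0
    show ?case using a0 by (auto simp: W_def intro: exI[of _ 0])
  next
    case (Suc k)
    obtain \<eta> \<rho> where \<eta>: "\<eta> \<noteq> 0" "\<rho> \<in> span (range b)" "T (a k) = scl \<eta> (a (Suc k)) + \<rho>"
      using T_a_in[of k] D by auto
    have "T (a k) - \<rho> \<in> W" using TW[OF Suc] \<eta>(2) spanb by (intro subspace_diff[OF W]) auto
    from subspace_scale[OF W this, of "inverse \<eta>"] show ?case using \<eta>(1) by (simp add: \<eta>(3))
  qed
  have "E \<subseteq> W" using aW bW W by (intro span_minimal) (auto simp: range_e_eq)
  then obtain j P where P: "(T ^^ j) x = poly_operator P T (a 0)" using x(1) by (auto simp: W_def V_def)
  have "(T ^^ i) x \<noteq> 0" for i
    using x injective_T[OF D funpow_in_E[of T x]] T_in_E by (induction i) auto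
  then have "P \<noteq> 0" using P by (auto simp: poly_operator_def)
  then show ?thesis using P by blast
qed

end

text \<open>The perturbed power is a polynomial in \<open>\<eta>\<close> whose constant term is the
  unperturbed one. The coefficients \<open>w\<close> do not depend on \<open>\<eta>\<close>, so the
  difference tends to 0 with \<open>\<eta>\<close>.\<close>

lemma rank_one_perturbation_pow:
  assumes S: "Vector_Spaces.linear scl scl S"
  shows "\<exists>w. \<forall>\<eta>. ((\<lambda>x. S x + scl (f k x) (scl \<eta> y)) ^^ i) u = (S ^^ i) u + (\<Sum>j<i. scl (\<eta> ^ Suc j) (w j))"
proof (induction i)
  case (Suc i)
  then obtain w where w: "\<And>\<eta>. ((\<lambda>x. S x + scl (f k x) (scl \<eta> y)) ^^ i) u = (S ^^ i) u + (\<Sum>j<i. scl (\<eta> ^ Suc j) (w j))"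
    by blast
  define w' where "w' j = (if j < i then S (w j) else 0) +
    (case j of 0 \<Rightarrow> scl (f k ((S ^^ i) u)) y | Suc j' \<Rightarrow> scl (f k (w j')) y)" for j
  have "((\<lambda>x. S x + scl (f k x) (scl \<eta> y)) ^^ Suc i) u = (S ^^ Suc i) u + (\<Sum>j<Suc i. scl (\<eta> ^ Suc j) (w' j))" for \<eta>
  proof -
    have "(\<Sum>j<Suc i. scl (\<eta> ^ Suc j) (w' j))
        = (\<Sum>j<Suc i. scl (\<eta> ^ Suc j) (if j < i then S (w j) else 0))
          + (\<Sum>j<Suc i. scl (\<eta> ^ Suc j) (case j of 0 \<Rightarrow> scl (f k ((S ^^ i) u)) y | Suc j' \<Rightarrow> scl (f k (w j')) y))"
      by (simp only: w'_def scale_right_distrib sum.distrib)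
    also have "(\<Sum>j<Suc i. scl (\<eta> ^ Suc j) (if j < i then S (w j) else 0)) = (\<Sum>j<i. scl (\<eta> ^ Suc j) (S (w j)))"
      by simp
    also have "(\<Sum>j<Suc i. scl (\<eta> ^ Suc j) (case j of 0 \<Rightarrow> scl (f k ((S ^^ i) u)) y | Suc j' \<Rightarrow> scl (f k (w j')) y))
        = scl (\<eta> ^ Suc 0) (scl (f k ((S ^^ i) u)) y) + (\<Sum>j<i. scl (\<eta> ^ Suc (Suc j)) (scl (f k (w j)) y))"
      by (subst sum.lessThan_Suc_shift) (simp only: nat.case)
    also have "\<dots> = scl (f k ((S ^^ i) u + (\<Sum>j<i. scl (\<eta> ^ Suc j) (w j)))) (scl \<eta> y)"
    proof -
      have t: "scl (\<eta> ^ Suc j * c) (scl \<eta> y) = scl (\<eta> ^ Suc (Suc j)) (scl c y)" for j c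
        by (simp only: scale_scale power_Suc mult_ac)
      have t0: "scl (\<eta> ^ Suc 0) (scl c y) = scl c (scl \<eta> y)" for c
        by (simp only: scale_scale power_Suc power_0 mult_1_right mult_1_left mult.commute)
      show ?thesis
        unfolding f_add f_sum f_scale scale_left_distrib scale_sum_left t t0 ..
    qed
    finally show ?thesis
      by (simp only: funpow.simps comp_apply w op.linear_add[OF S] op.linear_sum[OF S] op.linear_scale[OF S] add.assoc)
  qed
  then show ?case by blast
qed simp

lemma rank_one_perturbation_converges:
  assumes S: "Vector_Spaces.linear scl scl S" and \<eta>: "\<eta> \<longlonglongrightarrow> 0"
  shows "converges (\<lambda>m. ((\<lambda>x. S x + scl (f k x) (scl (\<eta> m) y)) ^^ i) u - (S ^^ i) u) 0"
proof -
  obtain w where w: "\<And>\<eta>. ((\<lambda>x. S x + scl (f k x) (scl \<eta> y)) ^^ i) u = (S ^^ i) u + (\<Sum>j<i. scl (\<eta> ^ Suc j) (w j))"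
    using rank_one_perturbation_pow[OF S] by blast
  have "converges (\<lambda>m. \<Sum>j<i. scl (\<eta> m ^ Suc j) (w j)) 0"
    using tendsto_power[OF \<eta>, of "Suc _"] by (intro converges_0_sum converges_0_scale) simp
  then show ?thesis by (simp only: w add_diff_cancel_left')
qed


text \<open>
  Until \<open>\<rho>\<close> has been shifted down to \<open>a\<^sub>n\<close>, the perturbed orbit is \<open>T\<^sup>m u + \<Phi> \<rho>\<close> with \<open>\<Phi>\<close> a fixed
  polynomial in \<open>T\<close>. Along the chain \<open>T\<^sup>n u, \<dots>, u, b\<^sub>0, b\<^sub>1, \<dots>\<close> the map \<open>\<Phi>\<close> is a shift plus terms
  farther out, so the coefficients of \<open>\<rho>\<close> are found one after the other.
\<close>

lemma chain_steering:
  assumes st: "chain_state T {..<n}" and z: "z \<in> span (a ` {..n} \<union> range b)"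
  obtains \<rho> m where "\<rho> \<in> span (b ` {J..})"
    "((\<lambda>x. T x + scl (fa n x) \<rho>) ^^ m) (a 0) - z \<in> span (b ` {r..})"
    "\<And>i. i \<le> J \<Longrightarrow> ((\<lambda>x. T x + scl (fa n x) \<rho>) ^^ i) (a 0) - (T ^^ i) (a 0) \<in> span (b ` {J - i..})"
proof -
  note T = linear_T[OF st] and Tpow = T_pow_linear[OF st]
  define V where "V = span (a ` {..n} \<union> range b)"
  \<comment> \<open>The \<open>a n\<close>-coordinate along the orbit of \<open>a 0\<close>. It
    takes exactly \<open>n\<close> steps to arrive there, so \<open>\<phi> n\<close> is the first
    nonzero value.\<close>
  define \<phi> where "\<phi> l = fa n ((T ^^ l) (a 0))" for l
  have \<phi>_low: "\<phi> l = 0" if "l < n" for l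
  proof -
    have "\<exists>c. c \<noteq> 0 \<and> (\<forall>x\<in>E. fa (n - l + l) ((T ^^ l) x) = c * fa (n - l) x)"
      using that by (intro fa_pow_T[OF st]) auto
    then show ?thesis using that by (auto simp: \<phi>_def)
  qed
  have \<phi>_n: "\<phi> n \<noteq> 0"
    using fa_pow_T[OF st, of n 0] by (auto simp: \<phi>_def)
  have fa_b: "fa n ((T ^^ i) (b j)) = 0" if "i \<le> j + n" for i j
  proof (cases "i \<le> j")
    case False
    then have "fa n ((T ^^ i) (b j)) = \<phi> (i - Suc j)" by (simp add: T_pow_b[OF st] \<phi>_def)
    then show ?thesis using \<phi>_low[of "i - Suc j"] that False by simp
  qed (simp add: T_pow_b[OF st])
  \<comment> \<open>In the joined chain \<open>g\<close> the vector \<open>b J\<close> has index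
    \<open>M\<close>. The time \<open>m\<close> is such that the summand with
    \<open>\<phi> n\<close> in \<open>\<Phi>\<close> is \<open>T\<close> to the power
    \<open>M\<close>, which takes \<open>g (M + i)\<close> to \<open>g i\<close>.\<close>
  define M where "M = J + n + 1"
  define m where "m = M + 1 + n"
  define g where "g i = (if i \<le> n then (T ^^ (n - i)) (a 0) else b (i - n - 1))" for i
  have T_g: "T (g (Suc i)) = g i" for i
  proof -
    consider "Suc i \<le> n" | "i = n" | "n < i" by linarith
    then show ?thesis
    proof cases
      case 1
      then have "n - i = Suc (n - Suc i)" by simp
      then show ?thesis using 1 by (simp add: g_def)
    next
      case 2
      then show ?thesis by (simp add: g_def T_b0[OF st])
    next
      case 3
      then have "Suc i - n - 1 = Suc (i - n - 1)" by simp
      then show ?thesis using 3 by (simp only: g_def T_bSuc[OF st]) (simp add: T_bSuc[OF st])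
    qed
  qed
  have T_pow_g: "(T ^^ i) (g j) = g (j - i)" if "i \<le> j" for i j
    using that
  proof (induction i)
    case (Suc i)
    then have "j - i = Suc (j - Suc i)" by simp
    then show ?case using Suc by (simp add: T_g)
  qed simp
  have V_g: "V \<subseteq> span (range g)"
  proof -
    have gb: "b j = g (j + n + 1)" for j by (simp add: g_def)
    have b_high: "span (range b) \<subseteq> span (g ` {i..})" if "i \<le> n" for i
    proof (intro span_minimal subspace_span subsetI)
      fix y assume "y \<in> range b"
      then obtain j where "y = g (j + n + 1)" using gb by blast
      then show "y \<in> span (g ` {i..})" using that by (simp add: span_base)
    qed
    have ag: "a k \<in> span (g ` {n - k..})" if "k \<le> n" for k
      using that
    proof (induction k)
      case 0
      have "a 0 = g n" by (simp add: g_def)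
      then show ?case by (simp add: span_base)
    next
      case (Suc k)
      obtain \<eta> \<rho> where \<eta>: "\<eta> \<noteq> 0" "\<rho> \<in> span (range b)" "T (a k) = scl \<eta> (a (Suc k)) + \<rho>"
        using T_a_in[OF st, of k] Suc.prems by auto
      have "T (a k) \<in> span (g ` {n - Suc k..})"
      proof (rule linear_maps_span[OF T])
        show "a k \<in> span (g ` {n - k..})" using Suc by simp
        fix y assume "y \<in> g ` {n - k..}"
        then obtain i where i: "n - k \<le> i" "y = g i" by auto
        then obtain i' where "i = Suc i'" using Suc.prems by (cases i) auto
        then show "T y \<in> span (g ` {n - Suc k..})" using i by (simp add: T_g span_base)
      qed
      then have "T (a k) - \<rho> \<in> span (g ` {n - Suc k..})"
        using \<eta>(2) b_high[of "n - Suc k"] by (intro span_diff) auto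
      from span_scale[OF this, of "inverse \<eta>"] show ?case using \<eta>(1) by (simp add: \<eta>(3))
    qed
    have "a k \<in> span (range g)" if "k \<le> n" for k
      using ag[OF that] span_mono[of "g ` {n - k..}" "range g"] by auto
    moreover have "b j \<in> span (range g)" for j by (simp add: gb span_base)
    ultimately show ?thesis unfolding V_def by (intro span_minimal) auto
  qed
  have TV: "T x \<in> V" if "x \<in> V" for x
    using that unfolding V_def
  proof (rule linear_maps_span[OF T])
    fix y assume "y \<in> a ` {..n} \<union> range b"
    then consider k where "k < n" "y = a k" | "y = a n" | j where "y = b j"
      by (auto simp: le_less)
    then show "T y \<in> span (a ` {..n} \<union> range b)"
    proof cases
      case (1 k)
      then obtain \<eta> \<rho> where \<eta>: "\<rho> \<in> span (range b)" "T (a k) = scl \<eta> (a (Suc k)) + \<rho>"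
        using T_a_in[OF st, of k] by auto
      have "\<rho> \<in> span (a ` {..n} \<union> range b)" using \<eta>(1) span_mono[of "range b"] by blast
      moreover have "a (Suc k) \<in> span (a ` {..n} \<union> range b)" using 1 by (simp add: span_base)
      ultimately show ?thesis by (simp add: 1 \<eta>(2) span_add span_scale)
    next
      case 2
      then show ?thesis by (simp add: T_a_notin[OF st] span_zero)
    next
      case (3 j)
      then show ?thesis by (cases j) (simp_all add: T_bSuc[OF st] T_b0[OF st] span_base)
    qed
  qed
  define \<Phi> where "\<Phi> x = (\<Sum>l<m. scl (\<phi> l) ((T ^^ (m - 1 - l)) x))" for x
  have \<Phi>: "Vector_Spaces.linear scl scl \<Phi>"
    unfolding \<Phi>_def by (intro op.linear_compose_sum ballI op.linear_compose_scale_right Tpow)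
  have \<Phi>_g: "\<Phi> (g (M + i)) - scl (\<phi> n) (g i) \<in> span (g ` {Suc i..})" for i
  proof -
    have "\<Phi> (g (M + i)) = (\<Sum>l\<in>{n..<m}. scl (\<phi> l) ((T ^^ (m - 1 - l)) (g (M + i))))"
      unfolding \<Phi>_def using \<phi>_low by (intro sum.mono_neutral_right) (auto simp: m_def not_le)
    also have "\<dots> = (\<Sum>l\<in>{n..<m}. scl (\<phi> l) (g (i + (l - n))))"
    proof (intro sum.cong refl)
      fix l assume l: "l \<in> {n..<m}"
      then have "m - 1 - l \<le> M + i" "M + i - (m - 1 - l) = i + (l - n)" by (auto simp: m_def)
      then show "scl (\<phi> l) ((T ^^ (m - 1 - l)) (g (M + i))) = scl (\<phi> l) (g (i + (l - n)))"
        by (simp add: T_pow_g)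
    qed
    also have "\<dots> = scl (\<phi> n) (g i) + (\<Sum>l\<in>{Suc n..<m}. scl (\<phi> l) (g (i + (l - n))))"
      by (subst sum.atLeast_Suc_lessThan) (simp_all add: m_def)
    finally have "\<Phi> (g (M + i)) - scl (\<phi> n) (g i) = (\<Sum>l\<in>{Suc n..<m}. scl (\<phi> l) (g (i + (l - n))))" by simp
    also have "\<dots> \<in> span (g ` {Suc i..})"
      by (intro span_sum span_scale span_base) auto
    finally show ?thesis .
  qed
  \<comment> \<open>Back substitution: \<open>\<phi> n\<close> is nonzero, so a multiple of
    \<open>g (M + t)\<close> cancels the component of the error along \<open>g t\<close> and changes
    it otherwise only farther out.\<close>
  have solve: "\<exists>\<rho>\<in>span (g ` {M..}). \<Phi> \<rho> - y \<in> span (g ` {t..})" if y: "y \<in> span (range g)" for y t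
  proof (induction t)
    case 0
    have "- y \<in> span (g ` {0..})" using y by (intro span_neg) (simp add: atLeast_0)
    then show ?case by (intro bexI[of _ 0]) (simp_all add: op.linear_0[OF \<Phi>] span_zero)
  next
    case (Suc t)
    then obtain \<rho> where \<rho>: "\<rho> \<in> span (g ` {M..})" "\<Phi> \<rho> - y \<in> span (g ` {t..})" by blast
    have "{t..} = insert t {Suc t..}" by auto
    then have "\<Phi> \<rho> - y \<in> span (insert (g t) (g ` {Suc t..}))" using \<rho>(2) by simp
    then obtain k where k: "\<Phi> \<rho> - y - scl k (g t) \<in> span (g ` {Suc t..})"
      unfolding span_breakdown_eq by blast
    define \<rho>' where "\<rho>' = \<rho> - scl (k / \<phi> n) (g (M + t))"
    have eq: "\<Phi> \<rho>' - y = (\<Phi> \<rho> - y - scl k (g t)) - scl (k / \<phi> n) (\<Phi> (g (M + t)) - scl (\<phi> n) (g t))"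
      using \<phi>_n by (simp add: \<rho>'_def op.linear_diff[OF \<Phi>] op.linear_scale[OF \<Phi>] scale_right_diff_distrib)
    have "\<Phi> \<rho>' - y \<in> span (g ` {Suc t..})"
      unfolding eq by (intro span_diff span_scale k \<Phi>_g)
    moreover have "\<rho>' \<in> span (g ` {M..})"
      unfolding \<rho>'_def using \<rho>(1) by (intro span_diff span_scale) (auto intro: span_base)
    ultimately show ?case by (intro bexI[of _ \<rho>']) simp_all
  qed
  have pow_V: "(T ^^ i) (a 0) \<in> V" for i
    using TV by (induction i) (auto simp: V_def intro: span_base)
  have "z - (T ^^ m) (a 0) \<in> V"
    using z pow_V unfolding V_def by (intro span_diff) auto
  then have "z - (T ^^ m) (a 0) \<in> span (range g)" using V_g by blast
  from solve[OF this, of "r + n + 1"] obtain \<rho> where \<rho>: "\<rho> \<in> span (g ` {M..})"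
    "\<Phi> \<rho> - (z - (T ^^ m) (a 0)) \<in> span (g ` {r + n + 1..})" by blast
  have g_b: "span (g ` {t + n + 1..}) \<subseteq> span (b ` {t..})" for t
  proof (intro span_minimal subspace_span subsetI)
    fix y assume "y \<in> g ` {t + n + 1..}"
    then obtain i where "t + n + 1 \<le> i" "y = g i" by auto
    then have "y = b (i - n - 1)" "t \<le> i - n - 1" by (auto simp: g_def)
    then show "y \<in> span (b ` {t..})" by (simp add: span_base)
  qed
  have \<rho>_b: "\<rho> \<in> span (b ` {J..})" using \<rho>(1) g_b[of J] by (auto simp: M_def)
  define S where "S x = T x + scl (fa n x) \<rho>" for x
  \<comment> \<open>From \<open>b j\<close> it takes \<open>j + 1\<close> steps to
    \<open>a 0\<close> and \<open>n\<close> more to \<open>a n\<close>. Within the times considered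
    the perturbation therefore does not act on its own output.\<close>
  have fa_\<rho>: "fa n ((T ^^ i) \<rho>) = 0" if "i \<le> J + n" for i
  proof -
    have "fa n x = 0" if "x \<in> (T ^^ i) ` span (b ` {J..})" for x
    proof -
      have "x \<in> span ((T ^^ i) ` b ` {J..})" using that by (simp add: op.linear_span_image[OF Tpow])
      then show ?thesis
        by (rule functional.linear_eq_0_on_span[OF linear_f, rotated])
          (use fa_b \<open>i \<le> J + n\<close> in auto)
    qed
    then show ?thesis using \<rho>_b by blast
  qed
  have S_pow: "(S ^^ i) (a 0) = (T ^^ i) (a 0) + (\<Sum>l<i. scl (\<phi> l) ((T ^^ (i - 1 - l)) \<rho>))" if "i \<le> m" for i
    using that
  proof (induction i)
    case (Suc i)
    let ?D = "\<Sum>l<i. scl (\<phi> l) ((T ^^ (i - 1 - l)) \<rho>)"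
    have "\<phi> l * fa n ((T ^^ (i - 1 - l)) \<rho>) = 0" if "l < i" for l
    proof (cases "l < n")
      case False
      then have "i - 1 - l \<le> J + n" using Suc.prems that by (simp add: m_def M_def)
      then show ?thesis by (simp add: fa_\<rho>)
    qed (simp add: \<phi>_low)
    then have "fa n ?D = 0" unfolding f_sum f_scale by (intro sum.neutral ballI) simp
    then have "fa n ((S ^^ i) (a 0)) = \<phi> i" using Suc by (simp add: f_add \<phi>_def)
    moreover have "T ?D = (\<Sum>l<i. scl (\<phi> l) ((T ^^ (Suc i - 1 - l)) \<rho>))"
    proof -
      have "T ((T ^^ (i - 1 - l)) \<rho>) = (T ^^ (Suc i - 1 - l)) \<rho>" if "l < i" for l
      proof -
        have "Suc i - 1 - l = Suc (i - 1 - l)" using that by simp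
        then show ?thesis by simp
      qed
      then show ?thesis by (simp add: op.linear_sum[OF T] op.linear_scale[OF T])
    qed
    ultimately show ?case using Suc by (simp add: S_def op.linear_add[OF T])
  qed simp
  show thesis
  proof (rule that[OF \<rho>_b, of m, folded S_def])
    have eq: "(S ^^ m) (a 0) - z = \<Phi> \<rho> - (z - (T ^^ m) (a 0))" by (simp add: S_pow \<Phi>_def)
    show "(S ^^ m) (a 0) - z \<in> span (b ` {r..})" unfolding eq using \<rho>(2) g_b[of r] by blast
    fix i assume i: "i \<le> J"
    have "(S ^^ i) (a 0) - (T ^^ i) (a 0) = (\<Sum>l<i. scl (\<phi> l) ((T ^^ (i - 1 - l)) \<rho>))"
      using i by (simp add: S_pow m_def M_def)
    also have "\<dots> \<in> span (b ` {J - i..})"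
    proof (intro span_sum span_scale)
      fix l assume "l \<in> {..<i}"
      then have "span (b ` {J - (i - 1 - l)..}) \<subseteq> span (b ` {J - i..})"
        by (intro span_mono image_mono) auto
      then show "(T ^^ (i - 1 - l)) \<rho> \<in> span (b ` {J - i..})"
        using T_pow_b_span[OF st \<rho>_b, of "i - 1 - l"] i by auto
    qed
    finally show "(S ^^ i) (a 0) - (T ^^ i) (a 0) \<in> span (b ` {J - i..})" .
  qed
qed

lemma linear_rank_one_perturbation:
  assumes "Vector_Spaces.linear scl scl T"
  shows "Vector_Spaces.linear scl scl (\<lambda>x. T x + scl (f k x) y)"
proof (rule op.linear_compose_add[OF assms])
  show "Vector_Spaces.linear scl scl (\<lambda>x. scl (f k x) y)"
    unfolding Vector_Spaces.linear_iff
    by (auto simp: f_add f_scale scale_left_distrib vector_space_axioms)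
qed

text \<open>First \<open>\<rho>\<close> alone is added: it starts at \<open>M + r\<close>, so the
  orbit up to time \<open>M\<close> and the target at time \<open>m\<close> are met up to far out
  \<open>b j\<close> invisible to \<open>p s\<close>. A small nonzero multiple of
  \<open>a (Suc n)\<close> then continues the chain, at the cost of an arbitrarily small
  error.\<close>

lemma chain_stage:
  assumes st: "chain_state T {..<n}" and z: "z \<in> span (a ` {..n} \<union> range b)" and d: "0 < d"
  obtains T' m \<eta> \<rho> where "chain_state T' {..<Suc n}" "\<And>k. k \<noteq> \<alpha> n \<Longrightarrow> T' (e k) = T (e k)"
    "T' (a n) = scl \<eta> (a (Suc n)) + \<rho>" "p s \<rho> = 0" "p s (scl \<eta> (a (Suc n))) \<le> d"
    "\<And>i. i \<le> M \<Longrightarrow> p s ((T' ^^ i) (a 0) - (T ^^ i) (a 0)) \<le> d"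
    "p s ((T' ^^ m) (a 0) - z) \<le> d"
proof -
  note T = linear_T[OF st]
  obtain r where r: "\<And>j. r \<le> j \<Longrightarrow> p s (b j) = 0" using far_b by blast
  have p_far: "p s x = 0" if "x \<in> span (b ` {t..})" "r \<le> t" for x t
    by (rule p_zero_span[OF that(1)]) (use r that(2) in auto)
  obtain \<rho> m where \<rho>: "\<rho> \<in> span (b ` {M + r..})"
    "((\<lambda>x. T x + scl (fa n x) \<rho>) ^^ m) (a 0) - z \<in> span (b ` {r..})"
    "\<And>i. i \<le> M + r \<Longrightarrow> ((\<lambda>x. T x + scl (fa n x) \<rho>) ^^ i) (a 0) - (T ^^ i) (a 0) \<in> span (b ` {M + r - i..})"
    using chain_steering[OF st z] by blast
  define S where "S x = T x + scl (fa n x) \<rho>" for x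
  have S: "Vector_Spaces.linear scl scl S"
    unfolding S_def [abs_def] by (rule linear_rank_one_perturbation[OF T])
  have S0: "p s ((S ^^ m) (a 0) - z) = 0"
    using p_far[OF \<rho>(2)] by (simp add: S_def [abs_def])
  have S1: "p s ((S ^^ i) (a 0) - (T ^^ i) (a 0)) = 0" if "i \<le> M" for i
    using p_far[OF \<rho>(3)[of i]] that by (simp add: S_def [abs_def])
  define \<eta> where "\<eta> t = (of_real (1 / real (Suc t)) :: 'k)" for t
  have \<eta>0: "\<eta> t \<noteq> 0" for t by (simp add: \<eta>_def del: of_nat_Suc)
  have "(\<lambda>t. of_real (1 / real (Suc t)) :: 'k) \<longlonglongrightarrow> of_real 0"
    by (intro tendsto_of_real LIMSEQ_Suc[OF lim_1_over_n])
  then have \<eta>: "\<eta> \<longlonglongrightarrow> 0" by (simp only: \<eta>_def [abs_def] of_real_0)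
  define S' where "S' t x = S x + scl (fa n x) (scl (\<eta> t) (a (Suc n)))" for t x
  have conv: "converges (\<lambda>t. (S' t ^^ i) (a 0) - (S ^^ i) (a 0)) 0" for i
    unfolding S'_def by (rule rank_one_perturbation_converges[OF S \<eta>])
  have "\<forall>\<^sub>F t in sequentially. \<forall>i\<in>{..max M m}. p s ((S' t ^^ i) (a 0) - (S ^^ i) (a 0)) < d"
    using d by (intro eventually_ball_finite ballI converges_0_eventually conv) auto
  moreover have "\<forall>\<^sub>F t in sequentially. p s (scl (\<eta> t) (a (Suc n))) < d"
    using d by (intro converges_0_eventually converges_0_scale \<eta>)
  ultimately have "\<forall>\<^sub>F t in sequentially. (\<forall>i\<in>{..max M m}. p s ((S' t ^^ i) (a 0) - (S ^^ i) (a 0)) < d)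
      \<and> p s (scl (\<eta> t) (a (Suc n))) < d"
    by (rule eventually_conj)
  then obtain t where t: "\<And>i. i \<le> max M m \<Longrightarrow> p s ((S' t ^^ i) (a 0) - (S ^^ i) (a 0)) < d"
    "p s (scl (\<eta> t) (a (Suc n))) < d"
    unfolding eventually_sequentially by force
  have \<rho>b: "\<rho> \<in> span (range b)" using \<rho>(1) span_mono[of "b ` {M + r..}" "range b"] by auto
  have S'_eq: "S' t x = T x + scl (fa n x) (scl (\<eta> t) (a (Suc n)) + \<rho>)" for x
    by (simp add: S'_def S_def scale_right_distrib)
  have S'_an: "S' t (a n) = scl (\<eta> t) (a (Suc n)) + \<rho>"
    by (simp add: S'_eq T_a_notin[OF st])
  show thesis
  proof (rule that[of "S' t" "\<eta> t" \<rho> m])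
    show "S' t (a n) = scl (\<eta> t) (a (Suc n)) + \<rho>" by (rule S'_an)
    show "chain_state (S' t) {..<Suc n}" unfolding chain_state_def
    proof (intro conjI allI impI ballI)
      show "Vector_Spaces.linear scl scl (S' t)"
        unfolding S'_eq [abs_def] by (rule linear_rank_one_perturbation[OF T])
      show "S' t (b (Suc j)) = b j" for j by (simp add: S'_eq T_bSuc[OF st])
      show "S' t (b 0) = a 0" by (simp add: S'_eq T_b0[OF st])
      show "S' t (a k) = 0" if "k \<notin> {..<Suc n}" for k
        using that by (simp add: S'_eq T_a_notin[OF st])
      show "\<exists>\<eta> \<rho>. \<eta> \<noteq> 0 \<and> \<rho> \<in> span (range b) \<and> S' t (a k) = scl \<eta> (a (Suc k)) + \<rho>"
        if "k \<in> {..<Suc n}" for k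
      proof (cases "k = n")
        case True
        then show ?thesis using S'_an \<eta>0 \<rho>b by blast
      next
        case False
        then show ?thesis using T_a_in[OF st, of k] that by (simp add: S'_eq)
      qed
    qed
    show "S' t (e k) = T (e k)" if "k \<noteq> \<alpha> n" for k
      using that by (simp add: S'_eq f_e)
    show "p s \<rho> = 0" using p_far[OF \<rho>(1)] by simp
    show "p s (scl (\<eta> t) (a (Suc n))) \<le> d" using t(2) by simp
    show "p s ((S' t ^^ i) (a 0) - (T ^^ i) (a 0)) \<le> d" if "i \<le> M" for i
      using p_triangle[of s "(S' t ^^ i) (a 0)" "(T ^^ i) (a 0)" "(S ^^ i) (a 0)"] t(1)[of i] S1[OF that] that
      by (simp add: le_max_iff_disj)
    show "p s ((S' t ^^ m) (a 0) - z) \<le> d"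
      using p_triangle[of s "(S' t ^^ m) (a 0)" z "(S ^^ m) (a 0)"] t(1)[of m] S0 by simp
  qed
qed

lemma hypercyclic_two_chains:
  fixes z :: "nat \<Rightarrow> 'a"
  assumes zE: "\<And>s. z s \<in> E"
    and rec: "\<And>s s0. \<exists>t\<ge>s0. z t = z s"
    and z: "\<And>y n d. y \<in> E \<Longrightarrow> 0 < d \<Longrightarrow> \<exists>s. p n (z s - y) < d"
  shows "\<exists>T. bounded_operator T \<and> T ` E \<subseteq> E \<and> (\<forall>x\<in>E - {0}. dense_orbit T x)"
proof -
  let ?u = "a 0"
  define V where "V s = span (a ` {..s} \<union> range b)" for s
  \<comment> \<open>Stage \<open>s\<close> can steer only to targets in \<open>V s\<close>; others
    are replaced by 0. No target is lost, because each one recurs after it has become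
    reachable.\<close>
  define z' where "z' s = (if z s \<in> V s then z s else 0)" for s
  have z'V: "z' s \<in> V s" for s by (simp add: z'_def V_def span_zero)
  have V_mono: "V s \<subseteq> V t" if "s \<le> t" for s t
    unfolding V_def using that by (intro span_mono Un_mono image_mono) auto
  have V_ev: "\<exists>s. x \<in> V s" if "x \<in> E" for x
    using that
  proof (induction rule: span_induct_alt)
    case base
    show ?case by (simp add: V_def span_zero)
  next
    case (step c y w)
    then obtain s where s: "w \<in> V s" by blast
    have "\<exists>t. y \<in> V t"
      using step(1) unfolding range_e_eq by (auto simp: V_def intro!: span_base)
    then obtain t where t: "y \<in> V t" by blast
    have "scl c y + w \<in> V (max s t)"
      using s t V_mono[of s "max s t"] V_mono[of t "max s t"]
      unfolding V_def by (intro span_add span_scale) auto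
    then show ?case by blast
  qed
  have z'_dense: "\<exists>s\<ge>s0. p n (z' s - y) < d" if y: "y \<in> E" and d: "0 < d" for y n d s0
  proof -
    obtain s where s: "p n (z s - y) < d" using z[OF y d] by blast
    obtain t0 where t0: "z s \<in> V t0" using V_ev[OF zE] by blast
    obtain t where t: "max s0 t0 \<le> t" "z t = z s" using rec by blast
    then have "z' t = z s" using t0 V_mono[of t0 t] by (auto simp: z'_def)
    then show ?thesis using s t(1) by auto
  qed
  \<comment> \<open>Besides smallness the column keeps its level condition: a seminorm below the
    level of \<open>a n\<close> sees only the multiple of \<open>a (Suc n)\<close>.\<close>
  define col where "col n y \<longleftrightarrow> C (\<alpha> n) * p (\<alpha> n) y \<le> (1/2) ^ \<alpha> n \<and>
    (\<exists>\<eta> \<rho>. y = scl \<eta> (a (Suc n)) + \<rho> \<and> (\<forall>i<lev (\<alpha> n). p i \<rho> = 0))" for n y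
  define ok where "ok n \<sigma> \<longleftrightarrow> chain_state (fst \<sigma>) {..<n} \<and> (\<forall>k<n. col k (fst \<sigma> (a k)))"
    for n and \<sigma> :: "('a \<Rightarrow> 'a) \<times> nat"
  define step where "step n \<sigma> \<sigma>' \<longleftrightarrow> snd \<sigma> \<le> snd \<sigma>' \<and>
      (\<forall>k. k \<noteq> \<alpha> n \<longrightarrow> fst \<sigma>' (e k) = fst \<sigma> (e k)) \<and>
      (\<forall>i\<le>snd \<sigma>. p n ((fst \<sigma>' ^^ i) ?u - (fst \<sigma> ^^ i) ?u) \<le> (1/2) ^ n) \<and>
      (\<exists>m\<le>snd \<sigma>'. p n ((fst \<sigma>' ^^ m) ?u - z' n) \<le> (1/2) ^ n)"
    for n and \<sigma> \<sigma>' :: "('a \<Rightarrow> 'a) \<times> nat"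
  have "\<exists>\<Sigma>. \<forall>n. ok n (\<Sigma> n) \<and> step n (\<Sigma> n) (\<Sigma> (Suc n))"
  proof (rule dependent_nat_choice)
    obtain T where T: "Vector_Spaces.linear scl scl T"
      "\<And>i. T (e i) = (if i \<in> range \<alpha> then 0 else if i = \<beta> 0 then a 0 else b (inv \<beta> i - 1))"
      using ex_linear_on_family[OF inj_e independent_e,
          of "\<lambda>i. if i \<in> range \<alpha> then 0 else if i = \<beta> 0 then a 0 else b (inv \<beta> i - 1)"] by blast
    have "T (a k) = 0" for k by (simp add: a_def T(2))
    moreover have "T (b 0) = a 0" "T (b (Suc j)) = b j" for j
      using \<alpha>_neq_\<beta> inj_\<beta> by (auto simp: b_def T(2) inj_eq)
    ultimately have "ok 0 (T, 0)" using T(1) by (simp add: ok_def chain_state_def)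
    then show "\<exists>\<sigma>. ok 0 \<sigma>" by blast
  next
    fix \<sigma> n assume ok: "ok n \<sigma>"
    define T M where "T = fst \<sigma>" and "M = snd \<sigma>"
    have st: "chain_state T {..<n}" using ok by (simp add: ok_def T_def)
    \<comment> \<open>\<open>p s\<close> dominates the seminorm of the approximation, the one
      measuring the column, and all those for which \<open>\<rho>\<close> must be invisible.\<close>
    define s where "s = max n (max (\<alpha> n) (lev (\<alpha> n)))"
    define d where "d = min ((1/2) ^ n) ((1/2) ^ \<alpha> n / C (\<alpha> n))"
    have d: "0 < d" "d \<le> (1/2) ^ n" "C (\<alpha> n) * d \<le> (1/2) ^ \<alpha> n"
    proof -
      show "0 < d" "d \<le> (1/2) ^ n" using C_pos[of "\<alpha> n"] by (simp_all add: d_def)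
      have "d \<le> (1/2) ^ \<alpha> n / C (\<alpha> n)" by (simp add: d_def)
      then show "C (\<alpha> n) * d \<le> (1/2) ^ \<alpha> n"
        using C_pos[of "\<alpha> n"] by (simp only: pos_le_divide_eq mult.commute)
    qed
    obtain T' m \<eta> \<rho> where T': "chain_state T' {..<Suc n}" "\<And>k. k \<noteq> \<alpha> n \<Longrightarrow> T' (e k) = T (e k)"
      "T' (a n) = scl \<eta> (a (Suc n)) + \<rho>" "p s \<rho> = 0" "p s (scl \<eta> (a (Suc n))) \<le> d"
      "\<And>i. i \<le> M \<Longrightarrow> p s ((T' ^^ i) (a 0) - (T ^^ i) (a 0)) \<le> d"
      "p s ((T' ^^ m) (a 0) - z' n) \<le> d"
      by (rule chain_stage[OF st z'V[unfolded V_def] d(1), of s M]) blast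
    have "p (\<alpha> n) (T' (a n)) \<le> p s (T' (a n))" by (rule p_mono) (simp add: s_def)
    also have "\<dots> \<le> d"
      using p_add[of s "scl \<eta> (a (Suc n))" \<rho>] T'(3,4,5) by simp
    finally have "C (\<alpha> n) * p (\<alpha> n) (T' (a n)) \<le> C (\<alpha> n) * d"
      using C_pos[of "\<alpha> n"] by (intro mult_left_mono) auto
    then have "C (\<alpha> n) * p (\<alpha> n) (T' (a n)) \<le> (1/2) ^ \<alpha> n" using d(3) by linarith
    moreover have "p i \<rho> = 0" if "i < lev (\<alpha> n)" for i
    proof -
      have "i \<le> s" using that by (simp add: s_def)
      then show ?thesis using p_mono[of i s \<rho>] p_nonneg[of i \<rho>] T'(4) by simp
    qed
    ultimately have "col n (T' (a n))" using T'(3) unfolding col_def by blast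
    moreover have "col k (T' (a k))" if "k < n" for k
    proof -
      have "T' (a k) = T (a k)" using T'(2)[of "\<alpha> k"] that inj_\<alpha> by (simp add: a_def inj_eq)
      then show ?thesis using ok that by (simp add: ok_def T_def)
    qed
    ultimately have "ok (Suc n) (T', max M m)"
      using T'(1) by (auto simp: ok_def less_Suc_eq)
    moreover have "step n \<sigma> (T', max M m)"
    proof -
      have le: "p n x \<le> (1/2) ^ n" if "p s x \<le> d" for x
        using p_mono[of n s x] that d(2) by (simp add: s_def)
      show ?thesis
        unfolding step_def fst_conv snd_conv T_def[symmetric] M_def[symmetric]
        using T'(2) le[OF T'(6)] le[OF T'(7)] by (auto intro!: exI[of _ m])
    qed
    ultimately show "\<exists>\<sigma>'. ok (Suc n) \<sigma>' \<and> step n \<sigma> \<sigma>'" by blast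
  qed
  then obtain \<Sigma> where \<Sigma>: "\<And>n. ok n (\<Sigma> n)" "\<And>n. step n (\<Sigma> n) (\<Sigma> (Suc n))" by blast
  define T M where "T n = fst (\<Sigma> n)" and "M n = snd (\<Sigma> n)" for n
  have st: "chain_state (T n) {..<n}" and col: "k < n \<Longrightarrow> col k (T n (a k))" for n k
    using \<Sigma>(1)[of n] by (auto simp: ok_def T_def)
  have M_le: "M n \<le> M (Suc n)"
    and same: "k \<noteq> \<alpha> n \<Longrightarrow> T (Suc n) (e k) = T n (e k)"
    and keep: "i \<le> M n \<Longrightarrow> p n ((T (Suc n) ^^ i) ?u - (T n ^^ i) ?u) \<le> (1/2) ^ n"
    and hit: "\<exists>m\<le>M (Suc n). p n ((T (Suc n) ^^ m) ?u - z' n) \<le> (1/2) ^ n" for n k i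
    using \<Sigma>(2)[of n] by (auto simp: step_def T_def M_def)
  have M_mono: "M s \<le> M t" if "s \<le> t" for s t
    by (rule lift_Suc_mono_le[of M, OF M_le that])
  have stable: "\<exists>s0. \<forall>s\<ge>s0. T s (e i) = T s0 (e i)" for i
  proof (cases i rule: index_cases)
    case (a k)
    have "T s (e i) = T (Suc k) (e i)" if "Suc k \<le> s" for s
      using that
    proof (induction s rule: dec_induct)
      case (step s)
      then have "i \<noteq> \<alpha> s" using inj_\<alpha> by (simp add: a inj_eq)
      then show ?case using step same by simp
    qed simp
    then show ?thesis by blast
  next
    case (b j)
    have "T s (e i) = T 0 (e i)" for s
      by (induction s) (simp_all add: same b \<alpha>_neq_\<beta>)
    then show ?thesis by blast
  qed
  obtain m where m: "\<And>s. m s \<le> M (Suc s)" "\<And>s. p s ((T (Suc s) ^^ m s) ?u - z' s) \<le> (1/2) ^ s"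
    using hit by metis
  have keep': "p s ((T (Suc s) ^^ m i) ?u - (T s ^^ m i) ?u) \<le> (1/2) ^ s" if "i < s" for s i
    using m(1)[of i] M_mono[of "Suc i" s] that by (intro keep) simp
  obtain S where S: "Vector_Spaces.linear scl scl S"
    "\<And>k. \<exists>s0. \<forall>s\<ge>s0. T s (e k) = S (e k)" "\<And>x. x \<in> E \<Longrightarrow> \<exists>s0. \<forall>s\<ge>s0. T s x = S x"
    "\<And>y n d. y \<in> E \<Longrightarrow> 0 < d \<Longrightarrow> \<exists>i. p n ((S ^^ i) ?u - y) < d"
  proof (rule stage_limit[OF linear_T[OF st] T_e_in_E[OF st] stable a_in_E m(2) keep' z'_dense])
    fix S assume "Vector_Spaces.linear scl scl S"
      "\<And>k. \<exists>s0. \<forall>s\<ge>s0. T s (e k) = S (e k)" "\<And>x. x \<in> E \<Longrightarrow> \<exists>s0. \<forall>s\<ge>s0. T s x = S x"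
      "\<And>y n d. y \<in> E \<Longrightarrow> 0 < d \<Longrightarrow> \<exists>i. p n ((S ^^ i) ?u - y) < d"
    then show thesis by (rule that)
  qed
  have S_at: "\<exists>s\<ge>s0. T s (e i) = S (e i)" for i s0
    using S(2)[of i] by (meson linorder_linear order_trans)
  have S_state: "chain_state S UNIV"
    unfolding chain_state_def
  proof (intro conjI allI impI ballI S(1))
    show "S (b (Suc j)) = b j" for j
      using S_at[of 0 "\<beta> (Suc j)"] T_bSuc[OF st, of _ j] by (metis b_def)
    show "S (b 0) = a 0"
      using S_at[of 0 "\<beta> 0"] T_b0[OF st] by (metis b_def)
    show "\<exists>\<eta> \<rho>. \<eta> \<noteq> 0 \<and> \<rho> \<in> span (range b) \<and> S (a k) = scl \<eta> (a (Suc k)) + \<rho>" for k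
    proof -
      obtain s where s: "Suc k \<le> s" "T s (a k) = S (a k)" using S_at[of "Suc k" "\<alpha> k"] by (auto simp: a_def)
      then show ?thesis using T_a_in[OF st[of s], of k] by simp
    qed
  qed simp
  have S_col: "col k (S (a k))" for k
  proof -
    obtain s where "Suc k \<le> s" "T s (a k) = S (a k)" using S_at[of "Suc k" "\<alpha> k"] by (auto simp: a_def)
    then show ?thesis using col[of k s] by simp
  qed
  have bd: "\<exists>m M. 0 \<le> M \<and> (\<forall>x\<in>E. p n (S x) \<le> M * p m x)" for n
  proof (rule columns_bounded[OF S(1), of 0], unfold scale_zero_left diff_zero)
    fix n
    define F where "F = {j. lev (\<beta> j) \<le> n}"
    have finF: "finite F" unfolding F_def by (rule finite_\<beta>)
    have b_out: "p n (b j) = 0" if "j \<notin> F" for j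
      using that by (simp add: F_def b_def p_e)
    \<comment> \<open>The columns visible to \<open>p n\<close> are the one of \<open>b 0\<close>,
      those mapped to some \<open>b j\<close> with \<open>j\<close> in the finite set
      \<open>F\<close>, and those of \<open>a k\<close> with \<open>lev (\<alpha> k) \<le> n\<close>
      or with \<open>a (Suc k)\<close> visible. Each kind has bounded level.\<close>
    obtain L1 where L1: "\<And>j. j \<in> F \<Longrightarrow> lev (\<beta> (Suc j)) \<le> L1"
      using finF by (metis finite_imageI finite_nat_set_iff_bounded_le image_eqI)
    obtain L2 where L2: "\<And>k. lev (\<alpha> (Suc k)) \<le> n \<Longrightarrow> lev (\<alpha> k) \<le> L2"
      using levels_\<alpha> by blast
    show "\<exists>m. \<forall>i. p n (S (e i)) \<noteq> 0 \<longrightarrow> lev i \<le> m"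
    proof (intro exI allI impI)
      fix i assume nz: "p n (S (e i)) \<noteq> 0"
      show "lev i \<le> max (lev (\<beta> 0)) (max L1 (max L2 n))"
      proof (cases i rule: index_cases)
        case (a k)
        obtain \<eta> \<rho> where \<rho>: "S (a k) = scl \<eta> (a (Suc k)) + \<rho>"
          "\<And>i. i < lev (\<alpha> k) \<Longrightarrow> p i \<rho> = 0"
          using S_col[of k] unfolding col_def by blast
        show ?thesis
        proof (cases "lev (\<alpha> k) \<le> n")
          case False
          then have "p n \<rho> = 0" using \<rho>(2) by simp
          have "p n (S (e i)) \<le> norm \<eta> * p n (a (Suc k))"
            using p_add[of n "scl \<eta> (a (Suc k))" \<rho>] \<rho>(1) \<open>p n \<rho> = 0\<close>
            by (simp add: \<open>i = \<alpha> k\<close> a_def)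
          moreover have "0 < p n (S (e i))" using nz p_nonneg[of n "S (e i)"] by linarith
          ultimately have "p n (a (Suc k)) \<noteq> 0" by auto
          then have "lev (\<alpha> (Suc k)) \<le> n" using p_e by (auto simp: a_def not_le[symmetric])
          then show ?thesis using L2 by (simp add: a le_max_iff_disj)
        qed (simp add: a)
      next
        case (b j)
        show ?thesis
        proof (cases j)
          case 0
          then show ?thesis by (simp add: b)
        next
          case (Suc j')
          then have "S (e i) = b j'" using T_bSuc[OF S_state, of j'] by (simp add: b b_def)
          then have "j' \<in> F" using nz b_out by auto
          then show ?thesis using L1 by (simp add: b Suc le_max_iff_disj)
        qed
      qed
    qed
    obtain k1 where k1: "\<And>j. j \<in> F \<Longrightarrow> \<beta> (Suc j) < k1"
      using finF by (metis finite_imageI finite_nat_set_iff_bounded image_eqI)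
    show "\<exists>k0. \<forall>k\<ge>k0. C k * p n (S (e k)) \<le> (1/2) ^ k"
    proof (intro exI allI impI)
      fix i assume i: "max n (max k1 (Suc (\<beta> 0))) \<le> i"
      show "C i * p n (S (e i)) \<le> (1/2) ^ i"
      proof (cases i rule: index_cases)
        case (a k)
        have "C i * p n (S (e i)) \<le> C i * p i (S (e i))"
          using C_pos[of i] i by (intro mult_left_mono p_mono) auto
        also have "\<dots> \<le> (1/2) ^ i" using S_col[of k] by (simp add: col_def a a_def)
        finally show ?thesis .
      next
        case (b j)
        then obtain j' where j': "j = Suc j'" using i by (cases j) auto
        then have "j' \<notin> F" using k1[of j'] i b by auto
        moreover have "S (e i) = b j'" using T_bSuc[OF S_state, of j'] by (simp add: b j' b_def)
        ultimately show ?thesis using b_out by simp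
      qed
    qed
  qed
  show ?thesis
    by (rule hypercyclic_extension[OF S(1) T_e_in_E[OF S_state] a_in_E bd S(4) cyclic_T[OF S_state refl]])
qed

end

section \<open>Hypercyclic operators preserving a dense subspace\<close>

context graded_basis begin

text \<open>\<open>D\<close> may lie outside \<open>E\<close>, so its members are replaced by
  approximations from \<open>E\<close>. Reading the index as a pair and ignoring the second
  component makes every term recur.\<close>

lemma ex_recurrent_dense_sequence:
  assumes D: "countable D" and dense: "\<And>x n d. 0 < d \<Longrightarrow> \<exists>y\<in>D. p n (y - x) < d"
  obtains z :: "nat \<Rightarrow> 'a" where "\<And>s. z s \<in> E" "\<And>s s0. \<exists>t\<ge>s0. z t = z s"
    "\<And>y n d. 0 < d \<Longrightarrow> \<exists>s. p n (z s - y) < d"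
proof -
  have "\<forall>x i. \<exists>y. y \<in> E \<and> p i (x - y) < 1 / real (Suc i)"
    using dense_span by (meson of_nat_0_less_iff zero_less_Suc zero_less_divide_1_iff)
  then obtain h where h: "\<And>x i. h x i \<in> E" "\<And>x i. p i (x - h x i) < 1 / real (Suc i)" by metis
  define G where "G = (\<lambda>(x, i). h x i) ` (D \<times> (UNIV :: nat set))"
  have G: "countable G" unfolding G_def using D by (intro countable_image countable_SIGMA) auto
  have GE: "G \<subseteq> E" using h(1) by (auto simp: G_def)
  have "D \<noteq> {}" using dense[of 1] by auto
  then have G0: "G \<noteq> {}" by (auto simp: G_def)
  define z where "z s = from_nat_into G (fst (prod_decode s))" for s
  show thesis
  proof (rule that[of z])
    show "z s \<in> E" for s using from_nat_into[OF G0] GE by (auto simp: z_def)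
    show "\<exists>t\<ge>s0. z t = z s" for s s0
      by (rule exI[of _ "prod_encode (fst (prod_decode s), s0)"]) (simp add: z_def le_prod_encode_2)
    show "\<exists>s. p n (z s - y) < d" if d: "0 < d" for y n d
    proof -
      obtain x where x: "x \<in> D" "p n (x - y) < d / 2" using dense[of "d / 2" n y] d by auto
      obtain i0 where i0: "1 / real (Suc i0) < d / 2" using nat_approx_posE[of "d / 2"] d by auto
      define i where "i = max n i0"
      have "p n (h x i - x) \<le> p i (x - h x i)"
        using p_mono[of n i "x - h x i"] by (simp add: i_def p_minus_commute)
      also have "\<dots> < 1 / real (Suc i)" by (rule h)
      also have "\<dots> \<le> 1 / real (Suc i0)" by (simp add: i_def frac_le)
      finally have "p n (h x i - y) < d"
        using x(2) i0 p_triangle[of n "h x i" y x] by simp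
      moreover have "h x i \<in> G" using x(1) by (auto simp: G_def)
      then obtain k where "from_nat_into G k = h x i" using from_nat_into_surj[OF G] by blast
      then have "z (prod_encode (k, 0)) = h x i" by (simp add: z_def)
      ultimately show ?thesis by metis
    qed
  qed
qed

lemma ex_hypercyclic_operator:
  assumes D: "countable D" and dense: "\<And>x n d. 0 < d \<Longrightarrow> \<exists>y\<in>D. p n (y - x) < d"
  shows "\<exists>T. bounded_operator T \<and> T ` E \<subseteq> E \<and> (\<forall>x\<in>E - {0}. dense_orbit T x)"
proof -
  obtain z :: "nat \<Rightarrow> 'a" where z: "\<And>s. z s \<in> E" "\<And>s s0. \<exists>t\<ge>s0. z t = z s"
    "\<And>y n d. 0 < d \<Longrightarrow> \<exists>s. p n (z s - y) < d"
  proof (rule ex_recurrent_dense_sequence[OF D dense])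
    fix z :: "nat \<Rightarrow> 'a"
    assume "\<And>s. z s \<in> E" "\<And>s s0. \<exists>t\<ge>s0. z t = z s" "\<And>y n d. 0 < d \<Longrightarrow> \<exists>s. p n (z s - y) < d"
    then show thesis by (rule that)
  qed
  show ?thesis
  proof (cases "\<exists>L. \<forall>k. lev k \<le> L")
    case True
    then obtain L where L: "\<And>k. lev k \<le> L" by blast
    show ?thesis
    proof (rule hypercyclic_bounded_levels[OF L z(1)])
      fix y n s0 and d :: real assume "0 < d"
      then obtain s where s: "p n (z s - y) < d" using z(3) by blast
      obtain t where "t \<ge> s0" "z t = z s" using z(2) by blast
      then show "\<exists>s\<ge>s0. p n (z s - y) < d" using s by auto
    qed
  next
    case False
    then have unb: "\<exists>k. L < lev k" for L by (meson not_less)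
    obtain \<alpha> \<beta> :: "nat \<Rightarrow> nat" where ab: "inj \<alpha>" "inj \<beta>" "range \<alpha> \<inter> range \<beta> = {}" "range \<alpha> \<union> range \<beta> = UNIV"
      "\<And>L. finite {j. lev (\<beta> j) \<le> L}"
      "\<And>L. \<exists>M. \<forall>k. lev (\<alpha> (Suc k)) \<le> L \<longrightarrow> lev (\<alpha> k) \<le> M"
      by (rule split_by_levels[of lev]) (use unb in blast)+
    interpret two_chains scl p emb e f lev C \<alpha> \<beta>
      by unfold_locales (rule ab)+
    show ?thesis using z by (intro hypercyclic_two_chains)
  qed
qed

end

section \<open>Transfer between seminorms and topology\<close>

lemma frechet_hypercyclic_subspace:
  fixes scl :: "'k::real_normed_field \<Rightarrow> 'a::{ab_group_add, topological_space} \<Rightarrow> 'a"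
    and emb :: "'k \<Rightarrow> complex"
  assumes frechet: "frechet_space scl"
    and HB: "\<And>q e. seminorm scl q \<Longrightarrow> 0 < q e
      \<Longrightarrow> \<exists>f M. Vector_Spaces.linear scl (*) f \<and> (\<forall>x. norm (f x) \<le> M * q x) \<and> f e = 1"
    and emb: "\<And>c d. emb (c + d) = emb c + emb d" "\<And>c d. emb (c * d) = emb c * emb d"
      "emb 1 = 1" "\<And>c. norm (emb c) = norm c"
    and sep: "separable_space (euclidean :: 'a topology)"
    and inf: "infinite_dimensional scl (UNIV :: 'a set)"
    and dense: "closure A = UNIV" and count: "countable_dimensional scl A"
  shows "\<exists>T. Vector_Spaces.linear scl scl T \<and> continuous_on UNIV T \<and>
    T ` A \<subseteq> A \<and> A - {0} \<subseteq> hypercyclic_vectors T"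
proof -
  interpret frechet_space scl by (rule frechet)
  obtain p :: "nat \<Rightarrow> 'a \<Rightarrow> real" where p': "\<forall>n. seminorm scl (p n)" "\<forall>n x. p n x \<le> p (Suc n) x"
    "\<forall>x. (\<forall>n. p n x = 0) \<longrightarrow> x = 0"
    "\<forall>U. open U \<longleftrightarrow> (\<forall>x\<in>U. \<exists>n. \<exists>d>0. {y. p n (y - x) < d} \<subseteq> U)"
    "\<forall>X :: nat \<Rightarrow> 'a. (\<forall>n. \<forall>d>0. \<exists>N. \<forall>i\<ge>N. \<forall>j\<ge>N. p n (X i - X j) < d) \<longrightarrow> (\<exists>L. X \<longlonglongrightarrow> L)"
    using frechet_seminorms by (elim exE conjE) (rule that)
  note p = p'[rule_format]
  have p0: "p n 0 = 0" for n
  proof -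
    have "p n (scl 0 0) = norm (0 :: 'k) * p n 0" using p(1)[of n] unfolding seminorm_def by blast
    then show ?thesis by simp
  qed
  have p_nn: "0 \<le> p n x" for n x using p(1)[of n] by (simp add: seminorm_def)
  have open_ball: "open {y. p n (y - x) < d}" for n x d
    unfolding p(4)
  proof
    fix y assume y: "y \<in> {y. p n (y - x) < d}"
    have "{w. p n (w - y) < d - p n (y - x)} \<subseteq> {y. p n (y - x) < d}"
    proof
      fix w assume "w \<in> {w. p n (w - y) < d - p n (y - x)}"
      moreover have "p n ((w - y) + (y - x)) \<le> p n (w - y) + p n (y - x)"
        using p(1)[of n] unfolding seminorm_def by blast
      ultimately show "w \<in> {y. p n (y - x) < d}" by simp
    qed
    then show "\<exists>m. \<exists>d'>0. {w. p m (w - y) < d'} \<subseteq> {y. p n (y - x) < d}"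
      using y by (intro exI[of _ n] exI[of _ "d - p n (y - x)"]) simp
  qed
  \<comment> \<open>Seminorm balls form a neighbourhood base, so density can be tested with one
    seminorm at a time. This translates all three densities involved: of the subspace, of the
    countable set, and of the orbits.\<close>
  have closure_iff: "closure S = UNIV \<longleftrightarrow> (\<forall>x n d. 0 < d \<longrightarrow> (\<exists>y\<in>S. p n (y - x) < d))" for S
  proof
    assume S: "closure S = UNIV"
    show "\<forall>x n d. 0 < d \<longrightarrow> (\<exists>y\<in>S. p n (y - x) < d)"
    proof (intro allI impI)
      fix x n and d :: real assume "0 < d"
      then have "x \<in> {y. p n (y - x) < d}" by (simp add: p0)
      moreover have "x \<in> closure S" using S by simp
      ultimately have "S \<inter> {y. p n (y - x) < d} \<noteq> {}"
        using open_ball closure_iff_nhds_not_empty by (metis order_refl)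
      then show "\<exists>y\<in>S. p n (y - x) < d" by blast
    qed
  next
    assume S: "\<forall>x n d. 0 < d \<longrightarrow> (\<exists>y\<in>S. p n (y - x) < d)"
    have "x \<in> closure S" for x
      unfolding closure_iff_nhds_not_empty
    proof (intro allI impI)
      fix V U assume U: "U \<subseteq> V" "open U" "x \<in> U"
      then obtain n d where "0 < d" "{y. p n (y - x) < d} \<subseteq> U" using p(4) by blast
      then show "S \<inter> V \<noteq> {}" using S U(1) by blast
    qed
    then show "closure S = UNIV" by blast
  qed
  interpret graded_seminorms scl p emb
  proof (unfold_locales)
    show "seminorm scl (p n)" "p n x \<le> p (Suc n) x" for n x by (rule p)+
    show "x = 0" if "\<And>n. p n x = 0" for x using p(3) that .
    show "\<exists>L. \<forall>n. (\<lambda>i. p n (X i - L)) \<longlonglongrightarrow> 0"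
      if "\<And>n d. 0 < d \<Longrightarrow> \<exists>N. \<forall>i\<ge>N. \<forall>j\<ge>N. p n (X i - X j) < d" for X :: "nat \<Rightarrow> 'a"
    proof -
      have "\<exists>L. X \<longlonglongrightarrow> L" by (rule p(5)) (rule that)
      then obtain L where L: "X \<longlonglongrightarrow> L" by blast
      have "(\<lambda>i. p n (X i - L)) \<longlonglongrightarrow> 0" for n
      proof (rule tendstoI)
        fix d :: real assume "0 < d"
        then show "\<forall>\<^sub>F i in sequentially. dist (p n (X i - L)) 0 < d"
          using topological_tendstoD[OF L open_ball[of n L d]] by (simp add: p0 p_nn)
      qed
      then show ?thesis by blast
    qed
    show "\<exists>f M. Vector_Spaces.linear scl (*) f \<and> (\<forall>x. norm (f x) \<le> M * q x) \<and> f e = 1"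
      if "seminorm scl q" "0 < q e" for q e using HB that .
    show "emb (c + d) = emb c + emb d" "emb (c * d) = emb c * emb d" for c d by (rule emb)+
    show "emb 1 = 1" "norm (emb c) = norm c" for c by (rule emb)+
  qed
  obtain B where B: "countable B" "independent B" "span B = A"
    using count by (auto simp: countable_dimensional_def hamel_basis_def)
  obtain D0 where D0: "infinite D0" "independent D0"
    using inf by (auto simp: infinite_dimensional_def hamel_basis_def)
  have denseA: "\<exists>y\<in>span B. p n (x - y) < d" if "0 < d" for x n d
    using dense that unfolding closure_iff B(3) by (metis p_minus_commute)
  obtain D where D: "countable D" "closure D = (UNIV :: 'a set)"
    using sep by (auto simp: separable_space_def)
  obtain e f lev C where basis: "graded_basis scl p emb e f lev C" "span (range e) = span B"
    using ex_graded_basis[OF B(1,2) denseA D0] by metis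
  interpret graded_basis scl p emb e f lev C by (rule basis)
  obtain T where T: "bounded_operator T" "T ` A \<subseteq> A" "\<And>x. x \<in> A - {0} \<Longrightarrow> dense_orbit T x"
    using ex_hypercyclic_operator[OF D(1)] D(2) unfolding closure_iff basis(2) B(3) by metis
  have lin: "Vector_Spaces.linear scl scl T" using T(1) by (simp add: bounded_operator_def)
  have "continuous_on UNIV T"
    unfolding continuous_on_open_vimage[OF open_UNIV]
  proof (intro allI impI)
    fix U :: "'a set" assume U: "open U"
    have "\<exists>n. \<exists>d>0. {y. p n (y - x) < d} \<subseteq> T -` U" if x: "T x \<in> U" for x
    proof -
      obtain n d where nd: "0 < d" "{y. p n (y - T x) < d} \<subseteq> U" using U x p(4) by blast
      obtain m M where M: "0 \<le> M" "\<And>x. p n (T x) \<le> M * p m x"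
        using T(1) unfolding bounded_operator_def by blast
      have "T y \<in> U" if y: "p m (y - x) < d / (M + 1)" for y
      proof -
        have "p n (T y - T x) \<le> M * p m (y - x)" using M(2)[of "y - x"] by (simp add: op.linear_diff[OF lin])
        also have "\<dots> \<le> (M + 1) * p m (y - x)" by (intro mult_right_mono) auto
        also have "\<dots> < d" using y M(1) by (simp add: field_simps)
        finally show ?thesis using nd(2) by blast
      qed
      then show ?thesis using nd(1) M(1) by (intro exI[of _ m] exI[of _ "d / (M + 1)"]) auto
    qed
    then show "open (T -` U \<inter> UNIV)" unfolding p(4) by simp
  qed
  moreover have "A - {0} \<subseteq> hypercyclic_vectors T"
  proof
    fix x assume "x \<in> A - {0}"
    then have "dense_orbit T x" by (rule T)
    then show "x \<in> hypercyclic_vectors T"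
      unfolding hypercyclic_vectors_def mem_Collect_eq closure_iff operator_orbit_def dense_orbit_def by blast
  qed
  ultimately show ?thesis using lin T(2) by blast
qed

theorem theorem3p4:
  "(\<forall>(scl :: real \<Rightarrow> 'a::{ring, topological_space} \<Rightarrow> 'a) (A :: 'a set).
      frechet_algebra scl \<and> separable_space (euclidean :: 'a topology) \<and>
      infinite_dimensional scl (UNIV :: 'a set) \<and>
      linear_subalgebra scl A \<and> closure A = UNIV \<and> countable_dimensional scl A \<longrightarrow>
      (\<exists>T. Vector_Spaces.linear scl scl T \<and> continuous_on UNIV T \<and>
        T ` A \<subseteq> A \<and> A - {0} \<subseteq> hypercyclic_vectors T)) \<and>
   (\<forall>(scl :: complex \<Rightarrow> 'a \<Rightarrow> 'a) (A :: 'a set).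
      frechet_algebra scl \<and> separable_space (euclidean :: 'a topology) \<and>
      infinite_dimensional scl (UNIV :: 'a set) \<and>
      linear_subalgebra scl A \<and> closure A = UNIV \<and> countable_dimensional scl A \<longrightarrow>
      (\<exists>T. Vector_Spaces.linear scl scl T \<and> continuous_on UNIV T \<and>
        T ` A \<subseteq> A \<and> A - {0} \<subseteq> hypercyclic_vectors T))"
proof (intro conjI allI impI; elim conjE)
  fix scl :: "real \<Rightarrow> 'a \<Rightarrow> 'a" and A :: "'a set"
  assume "frechet_algebra scl"
  then interpret frechet_algebra scl .
  assume *: "separable_space (euclidean :: 'a topology)" "infinite_dimensional scl (UNIV :: 'a set)"
    "closure A = UNIV" "countable_dimensional scl A"
  show "\<exists>T. Vector_Spaces.linear scl scl T \<and> continuous_on UNIV T \<and>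
        T ` A \<subseteq> A \<and> A - {0} \<subseteq> hypercyclic_vectors T"
  proof (rule frechet_hypercyclic_subspace[OF frechet_space_axioms, where emb = complex_of_real])
    fix q e assume q: "seminorm scl q" "0 < q e"
    obtain g where g: "Vector_Spaces.linear scl (*) g" "\<And>x. \<bar>g x\<bar> \<le> q x" "g e = q e"
      by (rule ex_dominated_functional[OF vector_space_axioms q(1), of e]) blast
    show "\<exists>f M. Vector_Spaces.linear scl (*) f \<and> (\<forall>x. norm (f x) \<le> M * q x) \<and> f e = 1"
    proof (intro exI[of _ "\<lambda>x. g x / q e"] exI[of _ "1 / q e"] conjI allI)
      show "Vector_Spaces.linear scl (*) (\<lambda>x. g x / q e)"
        using g(1) by (simp add: Vector_Spaces.linear_iff add_divide_distrib)
      show "norm (g x / q e) \<le> 1 / q e * q x" for x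
        using g(2)[of x] q(2) by (simp add: divide_right_mono)
      show "g e / q e = 1" using g(3) q(2) by simp
    qed
  qed (use * in simp_all)
next
  fix scl :: "complex \<Rightarrow> 'a \<Rightarrow> 'a" and A :: "'a set"
  assume "frechet_algebra scl"
  then interpret frechet_algebra scl .
  assume *: "separable_space (euclidean :: 'a topology)" "infinite_dimensional scl (UNIV :: 'a set)"
    "closure A = UNIV" "countable_dimensional scl A"
  show "\<exists>T. Vector_Spaces.linear scl scl T \<and> continuous_on UNIV T \<and>
        T ` A \<subseteq> A \<and> A - {0} \<subseteq> hypercyclic_vectors T"
  proof (rule frechet_hypercyclic_subspace[OF frechet_space_axioms, where emb = "\<lambda>c. c"])
    fix q e assume q: "seminorm scl q" "0 < q e"
    show "\<exists>f M. Vector_Spaces.linear scl (*) f \<and> (\<forall>x. norm (f x) \<le> M * q x) \<and> f e = 1"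
      by (rule ex_dominated_functional_complex[OF vector_space_axioms q]) blast
  qed (use * in simp_all)
qed

end
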